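(* Let $X$ be a Special--Dirichlet process on $[0,t]$. Suppose that $$X=M+\Gamma=\widetilde M+\widetilde\Gamma,$$ where both decompositions satisfy the definition of a Special--Dirichlet process (so $M,\widetilde M$ are local martingales, and $\Gamma,\widetilde\Gamma$ are adapted càdlàg processes with $[\Gamma]^c_t=[\widetilde\Gamma]^c_t=0$ whose jumps are carried by thin predictable sets and are $\mathcal F_{s-}$-measurable), and where $M_0=\widetilde M_0=0$. Then $M=\widetilde M$ up to indistinguishability on $[0,t]$.
   Context: All processes are real-valued, defined on a common filtered probability space $(\Omega,\mathcal F,\{\mathcal F_s\}_{s\ge0},\mathbb P)$ satisfying the usual conditions, and adapted; $t>0$ is a fixed time horizon. Quadratic variation. A refining sequence is a sequence $D_n=\{\tau^n_0,\dots,\tau^n_{m_n}\}$ of finite increasing families of stopping times with $0=\tau^n_0\le\tau^n_1\le\cdots\le\tau^n_{m_n}=t$ and $\max_{0\le i<m_n}(\tau^n_{i+1}-\tau^n_i)\to0$ in probability. A càdlàg process $Y$ admits a quadratic variation $[Y]$ if there is an increasing continuous process $[Y]^c$ such that, with $[Y]_s=[Y]^c_s+\sum_{u\le s}(\Delta Y_u)^2$ for $0\le s\le t$, there is a refining sequence $(D_n)$ for which $\sum_{i=0}^{m_n-1}(Y_{\tau^n_{i+1}\wedge s}-Y_{\tau^n_i\wedge s})^2\to[Y]_s$ in probability for every $0\le s\le t$. Writing $[Y]$ or $[Y]^c$ carries the understanding that $Y$ admits a quadratic variation. Special--Dirichlet process. A càdlàg adapted process $X$ on $[0,t]$ is Special--Dirichlet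 if $X=M+\Gamma$, where $M$ is a local martingale with $M_0=0$ and $\Gamma$ is an adapted càdlàg process such that $[\Gamma]^c_t=0$, the jumps of $\Gamma$ are carried by a thin predictable set (i.e. $\{\Delta\Gamma\neq0\}$ is contained in a countable union of graphs of predictable stopping times), and $\Delta\Gamma_s$ is $\mathcal F_{s-}$-measurable for $s\le t$ (the jumps are predictable: also $\Delta\Gamma_T$ is $\mathcal F_{T-}$-measurable on $\{T\le t\}$ for predictable stopping times $T$).
   Formalization: The quadratic variations of both Γ and Γ̃ are taken along one common refining sequence; if each may use its own sequence, the claim fails (a continuous Γ can have zero bracket along one sequence while Γ+B, B Brownian, has zero bracket along another). *)

theory Defs
  imports "HOL-Probability.Probability"
begin

text \<open>
  Time is indexed by \<^typ>\<open>real\<close>, so that \<^const>\<open>stopping_time\<close> and \<^locale>\<open>filtration\<close> apply.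
  Only indices \<open>s \<ge> 0\<close> matter: a filtration on \<open>[0, \<infinity>)\<close> extends by \<open>F s = F 0\<close> for \<open>s < 0\<close>, and for
  a nonnegative \<open>T\<close> the conditions of \<^const>\<open>stopping_time\<close> at negative indices hold trivially.
  A process is a function \<open>Y :: real \<Rightarrow> 'a \<Rightarrow> real\<close> of time and outcome, of which only the values on
  \<open>[0, t]\<close> are used.
\<close>

locale usual_filtered_prob_space =
  prob_space P + complete_measure P + filtration "space P" F
  for P :: "'a measure" and F :: "real \<Rightarrow> 'a measure" +
  assumes sets_F_subset: "\<And>s. sets (F s) \<subseteq> sets P"
    and null_sets_F: "null_sets P \<subseteq> sets (F 0)"
    and right_continuous_F: "\<And>s. 0 \<le> s \<Longrightarrow> sets (F s) = (\<Inter>u\<in>{s<..}. sets (F u))"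

definition tendsto_in_prob :: "'a measure \<Rightarrow> (nat \<Rightarrow> 'a \<Rightarrow> real) \<Rightarrow> ('a \<Rightarrow> real) \<Rightarrow> bool" where
  "tendsto_in_prob P X L \<longleftrightarrow>
     (\<forall>n. X n \<in> borel_measurable P) \<and> L \<in> borel_measurable P \<and>
     (\<forall>\<epsilon>>0. (\<lambda>n. measure P {\<omega> \<in> space P. \<bar>X n \<omega> - L \<omega>\<bar> > \<epsilon>}) \<longlonglongrightarrow> 0)"

definition adapted_on :: "(real \<Rightarrow> 'a measure) \<Rightarrow> real \<Rightarrow> (real \<Rightarrow> 'a \<Rightarrow> real) \<Rightarrow> bool" where
  "adapted_on F t Y \<longleftrightarrow> (\<forall>s\<in>{0..t}. Y s \<in> borel_measurable (F s))"

definition cadlag_on :: "real \<Rightarrow> (real \<Rightarrow> real) \<Rightarrow> bool" where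
  "cadlag_on t f \<longleftrightarrow>
     (\<forall>s\<in>{0..<t}. (f \<longlongrightarrow> f s) (at_right s)) \<and>
     (\<forall>s\<in>{0<..t}. \<exists>l. (f \<longlongrightarrow> l) (at_left s))"

definition cadlag_adapted :: "'a measure \<Rightarrow> (real \<Rightarrow> 'a measure) \<Rightarrow> real \<Rightarrow> (real \<Rightarrow> 'a \<Rightarrow> real) \<Rightarrow> bool" where
  "cadlag_adapted P F t Y \<longleftrightarrow>
     adapted_on F t Y \<and> (\<forall>\<omega>\<in>space P. cadlag_on t (\<lambda>s. Y s \<omega>))"

text \<open>There is no jump at time 0, i.e. \<open>Y\<^bsub>0-\<^esub> = Y\<^bsub>0\<^esub>\<close>.\<close>

definition jump :: "(real \<Rightarrow> real) \<Rightarrow> real \<Rightarrow> real" where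
  "jump f s = (if s \<le> 0 then 0 else f s - Lim (at_left s) f)"

definition nonneg_stopping_time :: "'a measure \<Rightarrow> (real \<Rightarrow> 'a measure) \<Rightarrow> ('a \<Rightarrow> real) \<Rightarrow> bool" where
  "nonneg_stopping_time P F T \<longleftrightarrow> stopping_time F T \<and> (\<forall>\<omega>\<in>space P. 0 \<le> T \<omega>)"

text \<open>
  Stopping times are finite valued. On the horizon \<open>[0, t]\<close> this loses nothing: replacing a predictable
  time \<open>T\<close> with values in \<open>[0, \<infinity>]\<close> by \<open>min T (t + 1)\<close> gives a predictable time with the same graph
  in \<open>[0, t]\<close> and the same trace of the strict past \<open>F\<^bsub>T-\<^esub>\<close> on \<open>{T \<le> t}\<close>.
\<close>

definition predictable_time :: "'a measure \<Rightarrow> (real \<Rightarrow> 'a measure) \<Rightarrow> ('a \<Rightarrow> real) \<Rightarrow> bool" where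
  "predictable_time P F T \<longleftrightarrow>
     nonneg_stopping_time P F T \<and>
     (\<exists>S :: nat \<Rightarrow> 'a \<Rightarrow> real.
        (\<forall>n. nonneg_stopping_time P F (S n)) \<and>
        (\<forall>\<omega>\<in>space P. incseq (\<lambda>n. S n \<omega>) \<and> (\<lambda>n. S n \<omega>) \<longlonglongrightarrow> T \<omega> \<and>
                      (0 < T \<omega> \<longrightarrow> (\<forall>n. S n \<omega> < T \<omega>))))"

text \<open>The left limit \<open>F\<^bsub>s-\<^esub>\<close> of the filtration, with \<open>F\<^bsub>0-\<^esub> = F\<^bsub>0\<^esub>\<close>.\<close>

definition F_left :: "'a measure \<Rightarrow> (real \<Rightarrow> 'a measure) \<Rightarrow> real \<Rightarrow> 'a measure" where
  "F_left P F s = sigma (space P) (sets (F 0) \<union> (\<Union>u\<in>{0..<s}. sets (F u)))"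

text \<open>The strict past \<open>F\<^bsub>T-\<^esub>\<close> of a stopping time.\<close>

definition strict_past :: "'a measure \<Rightarrow> (real \<Rightarrow> 'a measure) \<Rightarrow> ('a \<Rightarrow> real) \<Rightarrow> 'a measure" where
  "strict_past P F T =
     sigma (space P) (sets (F 0) \<union> {A \<inter> {\<omega> \<in> space P. u < T \<omega>} | A u. 0 \<le> u \<and> A \<in> sets (F u)})"

definition martingale_on :: "'a measure \<Rightarrow> (real \<Rightarrow> 'a measure) \<Rightarrow> real \<Rightarrow> (real \<Rightarrow> 'a \<Rightarrow> real) \<Rightarrow> bool" where
  "martingale_on P F t M \<longleftrightarrow>
     adapted_on F t M \<and> (\<forall>s\<in>{0..t}. integrable P (M s)) \<and>
     (\<forall>s u. 0 \<le> s \<and> s \<le> u \<and> u \<le> t \<longrightarrow> (AE \<omega> in P. real_cond_exp P (F s) (M u) \<omega> = M s \<omega>))"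

text \<open>
  On the closed interval \<open>[0, t]\<close> a localizing sequence has to reach \<open>t\<close> eventually, almost surely;
  this is convergence to \<open>\<infinity>\<close> for the process stopped at \<open>t\<close>.
\<close>

definition local_martingale_on :: "'a measure \<Rightarrow> (real \<Rightarrow> 'a measure) \<Rightarrow> real \<Rightarrow> (real \<Rightarrow> 'a \<Rightarrow> real) \<Rightarrow> bool" where
  "local_martingale_on P F t M \<longleftrightarrow>
     cadlag_adapted P F t M \<and>
     (\<exists>T :: nat \<Rightarrow> 'a \<Rightarrow> real.
        (\<forall>n. nonneg_stopping_time P F (T n)) \<and>
        (\<forall>\<omega>\<in>space P. incseq (\<lambda>n. T n \<omega>)) \<and>
        (AE \<omega> in P. \<exists>n. t \<le> T n \<omega>) \<and>
        (\<forall>n. martingale_on P F t (\<lambda>s \<omega>. M (min s (T n \<omega>)) \<omega> - M 0 \<omega>)))"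

text \<open>The \<open>n\<close>-th family of the sequence is \<open>\<tau> n 0, \<dots>, \<tau> n (m n)\<close>.\<close>

definition refining_sequence ::
    "'a measure \<Rightarrow> (real \<Rightarrow> 'a measure) \<Rightarrow> real \<Rightarrow> (nat \<Rightarrow> nat) \<Rightarrow> (nat \<Rightarrow> nat \<Rightarrow> 'a \<Rightarrow> real) \<Rightarrow> bool" where
  "refining_sequence P F t m \<tau> \<longleftrightarrow>
     (\<forall>n. \<forall>i\<le>m n. nonneg_stopping_time P F (\<tau> n i)) \<and>
     (\<forall>n. \<forall>\<omega>\<in>space P. \<tau> n 0 \<omega> = 0 \<and> \<tau> n (m n) \<omega> = t \<and>
                        (\<forall>i<m n. \<tau> n i \<omega> \<le> \<tau> n (Suc i) \<omega>)) \<and>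
     tendsto_in_prob P (\<lambda>n \<omega>. Max ((\<lambda>i. \<tau> n (Suc i) \<omega> - \<tau> n i \<omega>) ` {..<m n})) (\<lambda>\<omega>. 0)"

text \<open>
  \<open>qv_cont_part P F t m \<tau> Y C\<close>: the process \<open>Y\<close> admits a quadratic variation along the refining
  sequence \<open>(m, \<tau>)\<close>, with continuous part \<open>[Y]\<^sup>c = C\<close>. Summability of the squared jumps is
  required explicitly because \<^const>\<open>infsum\<close> is 0 on families that are not summable.
\<close>

definition qv_cont_part ::
    "'a measure \<Rightarrow> (real \<Rightarrow> 'a measure) \<Rightarrow> real \<Rightarrow> (nat \<Rightarrow> nat) \<Rightarrow> (nat \<Rightarrow> nat \<Rightarrow> 'a \<Rightarrow> real) \<Rightarrow>
     (real \<Rightarrow> 'a \<Rightarrow> real) \<Rightarrow> (real \<Rightarrow> 'a \<Rightarrow> real) \<Rightarrow> bool" where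
  "qv_cont_part P F t m \<tau> Y C \<longleftrightarrow>
     refining_sequence P F t m \<tau> \<and>
     adapted_on F t C \<and>
     (\<forall>\<omega>\<in>space P. continuous_on {0..t} (\<lambda>s. C s \<omega>) \<and> mono_on {0..t} (\<lambda>s. C s \<omega>)) \<and>
     (AE \<omega> in P. (\<lambda>u. (jump (\<lambda>s. Y s \<omega>) u)\<^sup>2) summable_on {0<..t}) \<and>
     (\<forall>s\<in>{0..t}.
        tendsto_in_prob P
          (\<lambda>n \<omega>. \<Sum>i<m n. (Y (min (\<tau> n (Suc i) \<omega>) s) \<omega> - Y (min (\<tau> n i \<omega>) s) \<omega>)\<^sup>2)
          (\<lambda>\<omega>. C s \<omega> + (\<Sum>\<^sub>\<infinity>u\<in>{0<..s}. (jump (\<lambda>r. Y r \<omega>) u)\<^sup>2)))"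

definition jumps_thin_predictable ::
    "'a measure \<Rightarrow> (real \<Rightarrow> 'a measure) \<Rightarrow> real \<Rightarrow> (real \<Rightarrow> 'a \<Rightarrow> real) \<Rightarrow> bool" where
  "jumps_thin_predictable P F t Y \<longleftrightarrow>
     (\<exists>S :: nat \<Rightarrow> 'a \<Rightarrow> real. (\<forall>k. predictable_time P F (S k)) \<and>
        (\<forall>\<omega>\<in>space P. \<forall>s\<in>{0..t}. jump (\<lambda>r. Y r \<omega>) s \<noteq> 0 \<longrightarrow> (\<exists>k. S k \<omega> = s)))"

definition jumps_predictable ::
    "'a measure \<Rightarrow> (real \<Rightarrow> 'a measure) \<Rightarrow> real \<Rightarrow> (real \<Rightarrow> 'a \<Rightarrow> real) \<Rightarrow> bool" where
  "jumps_predictable P F t Y \<longleftrightarrow>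
     (\<forall>s\<in>{0..t}. (\<lambda>\<omega>. jump (\<lambda>r. Y r \<omega>) s) \<in> borel_measurable (F_left P F s)) \<and>
     (\<forall>T. predictable_time P F T \<longrightarrow>
        (\<lambda>\<omega>. if T \<omega> \<le> t then jump (\<lambda>r. Y r \<omega>) (T \<omega>) else 0) \<in> borel_measurable (strict_past P F T))"

text \<open>
  The bracket depends on the refining sequence: there is a continuous adapted \<open>Y\<close> that has zero
  quadratic variation along one deterministic refining sequence while \<open>Y + B\<close>, for a Brownian
  motion \<open>B\<close>, has zero quadratic variation along another. Then \<open>Y = 0 + Y = - B + (Y + B)\<close>, and a
  decomposition with \<open>[\<Gamma>]\<^sup>c\<^sub>t = 0\<close> is not unique if each bracket may use its own sequence. The
  sequence \<open>(m, \<tau>)\<close> along which brackets are taken is therefore a parameter here.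
\<close>

definition special_dirichlet_decomposition ::
    "'a measure \<Rightarrow> (real \<Rightarrow> 'a measure) \<Rightarrow> real \<Rightarrow> (nat \<Rightarrow> nat) \<Rightarrow> (nat \<Rightarrow> nat \<Rightarrow> 'a \<Rightarrow> real) \<Rightarrow>
     (real \<Rightarrow> 'a \<Rightarrow> real) \<Rightarrow> (real \<Rightarrow> 'a \<Rightarrow> real) \<Rightarrow> (real \<Rightarrow> 'a \<Rightarrow> real) \<Rightarrow> bool" where
  "special_dirichlet_decomposition P F t m \<tau> X M \<Gamma> \<longleftrightarrow>
     (AE \<omega> in P. \<forall>s\<in>{0..t}. X s \<omega> = M s \<omega> + \<Gamma> s \<omega>) \<and>
     local_martingale_on P F t M \<and>
     (AE \<omega> in P. M 0 \<omega> = 0) \<and>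
     cadlag_adapted P F t \<Gamma> \<and>
     (\<exists>C. qv_cont_part P F t m \<tau> \<Gamma> C \<and> (AE \<omega> in P. C t \<omega> = 0)) \<and>
     jumps_thin_predictable P F t \<Gamma> \<and>
     jumps_predictable P F t \<Gamma>"

definition special_dirichlet ::
    "'a measure \<Rightarrow> (real \<Rightarrow> 'a measure) \<Rightarrow> real \<Rightarrow> (nat \<Rightarrow> nat) \<Rightarrow> (nat \<Rightarrow> nat \<Rightarrow> 'a \<Rightarrow> real) \<Rightarrow>
     (real \<Rightarrow> 'a \<Rightarrow> real) \<Rightarrow> bool" where
  "special_dirichlet P F t m \<tau> X \<longleftrightarrow>
     cadlag_adapted P F t X \<and> (\<exists>M \<Gamma>. special_dirichlet_decomposition P F t m \<tau> X M \<Gamma>)"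

end

theory Submission
  imports Defs
begin

text \<open>
  Put \<open>N = M - M' = \<Gamma>' - \<Gamma>\<close>. At a predictable time \<open>T\<close> the jump of the local martingale \<open>N\<close> has
  conditional expectation \<open>0\<close> given \<open>F\<^bsub>T-\<^esub>\<close>, and as a jump of \<open>\<Gamma>' - \<Gamma>\<close> it is \<open>F\<^bsub>T-\<^esub>\<close>-measurable, so
  it vanishes. Since the jumps of \<open>\<Gamma>\<close> and \<open>\<Gamma>'\<close> are carried by countably many predictable times, \<open>N\<close> is
  continuous, and \<open>\<Gamma>\<close> and \<open>\<Gamma>'\<close> have the same jumps. Both quadratic variations are the sums of the
  squared jumps, which forces the square sums of \<open>N = \<Gamma>' - \<Gamma>\<close> along the refining sequence to tend to
  \<open>0\<close>. After localization \<open>N\<close> is a bounded martingale with zero quadratic variation, hence \<open>0\<close>.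
\<close>

section \<open>Limits of conditional expectations\<close>

text \<open>The jump of \<open>N\<close> at \<open>T\<close> need not be integrable, so its
  conditional expectation is only meaningful after localization. The argument runs on events
  \<open>T \<le> R n\<close> for localizing times \<open>R n\<close>; these events lie in the strict
  past of \<open>T\<close>, so cutting down to them is compatible with conditioning. For a true
  martingale the jump integrates to 0 over the strict past because the values sampled along an
  announcing sequence are conditional expectations of the terminal value and converge in L1 to the
  left limit. The brackets converge only in probability. As both are taken along the same
  partitions, one subsequence makes the mesh and both square sums converge almost surely, and from
  there on the comparison is pathwise. The partition points are stopping times, so the martingale
  property is needed at stopping times, hence optional sampling. Boundedness of \<open>N\<close>
  does not bound its square sums, so their expectations need not follow their limit in probability:
  the discrete martingale is stopped once its square sum has reached \<epsilon>, and the error is a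
  multiple of a probability that tends to 0.\<close>

lemma integrable_imp_set_integrable:
  fixes f :: "'a \<Rightarrow> real"
  shows "integrable M f \<Longrightarrow> A \<in> sets M \<Longrightarrow> set_integrable M A f"
  unfolding set_integrable_def by (rule integrable_mult_indicator)

text \<open>Monotonicity applied to -|f| \<le> f \<le> |f| bounds the conditional expectation
  pointwise by that of |f|, whose integral is that of |f|.\<close>

lemma (in prob_space) integral_abs_cond_exp_le:
  assumes "subalgebra M G" and [measurable]: "integrable M f"
  shows "(\<integral>x. \<bar>real_cond_exp M G f x\<bar> \<partial>M) \<le> (\<integral>x. \<bar>f x\<bar> \<partial>M)"
proof -
  interpret finite_measure_subalgebra M G
    using assms(1) by unfold_locales
  have "AE x in M. real_cond_exp M G (\<lambda>x. - \<bar>f x\<bar>) x \<le> real_cond_exp M G f x"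
    by (rule real_cond_exp_mono) (use assms(2) in auto)
  moreover have "AE x in M. real_cond_exp M G f x \<le> real_cond_exp M G (\<lambda>x. \<bar>f x\<bar>) x"
    by (rule real_cond_exp_mono) (use assms(2) in auto)
  moreover have "AE x in M. real_cond_exp M G (\<lambda>x. -1 * \<bar>f x\<bar>) x = -1 * real_cond_exp M G (\<lambda>x. \<bar>f x\<bar>) x"
    by (rule real_cond_exp_cmult) (use assms(2) in auto)
  ultimately have "AE x in M. \<bar>real_cond_exp M G f x\<bar> \<le> real_cond_exp M G (\<lambda>x. \<bar>f x\<bar>) x"
    by eventually_elim auto
  moreover have "integrable M (real_cond_exp M G f)"
    "integrable M (real_cond_exp M G (\<lambda>x. \<bar>f x\<bar>))"
    by (use assms(2) in \<open>auto intro!: real_cond_exp_int\<close>)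
  ultimately have "(\<integral>x. \<bar>real_cond_exp M G f x\<bar> \<partial>M) \<le> (\<integral>x. real_cond_exp M G (\<lambda>x. \<bar>f x\<bar>) x \<partial>M)"
    by (intro integral_mono_AE) auto
  also have "\<dots> = (\<integral>x. \<bar>f x\<bar> \<partial>M)"
    by (rule real_cond_exp_int) (use assms(2) in auto)
  finally show ?thesis .
qed

section \<open>Truncation of integrable functions\<close>

definition truncate :: "real \<Rightarrow> real \<Rightarrow> real" where
  "truncate c x = max (- c) (min c x)"

lemma truncate_measurable [measurable]: "truncate c \<in> borel_measurable borel"
  unfolding truncate_def by measurable

lemma abs_truncate_le: "0 \<le> c \<Longrightarrow> \<bar>truncate c x\<bar> \<le> c"
  by (auto simp: truncate_def)

text \<open>Under the hypothesis, \<open>truncate c x\<close> is the point of [-c, c] nearest to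
  \<open>x\<close>. This allows a bounded conditional expectation to be replaced by a
  truncation.\<close>

lemma abs_diff_truncate_le: "\<bar>y\<bar> \<le> c \<Longrightarrow> \<bar>x - truncate c x\<bar> \<le> \<bar>x - y\<bar>"
  by (auto simp: truncate_def)

lemma tendsto_truncate: "(f \<longlongrightarrow> l) A \<Longrightarrow> ((\<lambda>x. truncate c (f x)) \<longlongrightarrow> truncate c l) A"
  unfolding truncate_def by (intro tendsto_intros)

text \<open>Each value of \<open>f\<close> is eventually left unchanged, and |f| dominates the
  error.\<close>

lemma (in prob_space) integral_abs_diff_truncate_tendsto_0:
  assumes [measurable]: "integrable M f"
  shows "(\<lambda>n. \<integral>x. \<bar>f x - truncate (real n) (f x)\<bar> \<partial>M) \<longlonglongrightarrow> 0"
proof -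
  have "(\<lambda>n. \<integral>x. \<bar>f x - truncate (real n) (f x)\<bar> \<partial>M) \<longlonglongrightarrow> (\<integral>x. 0 \<partial>M)"
  proof (rule integral_dominated_convergence[where w="\<lambda>x. \<bar>f x\<bar>"])
    show "AE x in M. (\<lambda>n. \<bar>f x - truncate (real n) (f x)\<bar>) \<longlonglongrightarrow> 0"
    proof (rule AE_I2)
      fix x
      obtain N where "\<bar>f x\<bar> \<le> real N"
        using real_arch_simple by blast
      then have "\<forall>\<^sub>F n in sequentially. \<bar>f x - truncate (real n) (f x)\<bar> = 0"
        by (intro eventually_sequentiallyI[of N]) (auto simp: truncate_def)
      then show "(\<lambda>n. \<bar>f x - truncate (real n) (f x)\<bar>) \<longlonglongrightarrow> 0"
        by (rule tendsto_eventually)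
    qed
    show "AE x in M. norm \<bar>f x - truncate (real n) (f x)\<bar> \<le> \<bar>f x\<bar>" for n
      by (auto simp: truncate_def)
  qed (use assms in auto)
  then show ?thesis by simp
qed

text \<open>Truncating \<open>L\<close> at level \<open>c\<close> splits \<open>X k\<close> into a part bounded by \<open>c\<close> and a part that is small
  in \<open>L\<^sup>1\<close> uniformly in \<open>k\<close>; this takes the place of uniform integrability.\<close>

lemma (in prob_space) cond_exp_L1_limit:
  fixes L Y :: "'a \<Rightarrow> real" and X :: "nat \<Rightarrow> 'a \<Rightarrow> real"
  assumes L [measurable]: "integrable M L"
    and G: "\<And>k. subalgebra M (G k)"
    and XG: "\<And>k. X k \<in> borel_measurable (G k)"
    and X [measurable]: "\<And>k. integrable M (X k)"
    and XL: "\<And>k A. A \<in> sets (G k) \<Longrightarrow> (\<integral>x\<in>A. X k x \<partial>M) = (\<integral>x\<in>A. L x \<partial>M)"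
    and Y [measurable]: "Y \<in> borel_measurable M"
    and lim: "AE x in M. (\<lambda>k. X k x) \<longlonglongrightarrow> Y x"
  shows "integrable M Y" and "(\<lambda>k. \<integral>x. \<bar>X k x - Y x\<bar> \<partial>M) \<longlonglongrightarrow> 0"
proof -
  have [measurable]: "X k \<in> borel_measurable M" for k
    using X by simp
  have fms: "finite_measure_subalgebra M (G k)" for k
    using G by (simp add: finite_measure_subalgebra_def finite_measure_subalgebra_axioms_def finite_measure_axioms)
  have ce: "AE x in M. real_cond_exp M (G k) L x = X k x" for k
  proof -
    interpret finite_measure_subalgebra M "G k" by (rule fms)
    show ?thesis
      by (rule real_cond_exp_charact) (use XL XG L X in auto)
  qed
  have absX: "(\<integral>x. \<bar>X k x\<bar> \<partial>M) \<le> (\<integral>x. \<bar>L x\<bar> \<partial>M)" for k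
  proof -
    have "(\<integral>x. \<bar>X k x\<bar> \<partial>M) = (\<integral>x. \<bar>real_cond_exp M (G k) L x\<bar> \<partial>M)"
      using ce[of k] by (intro integral_cong_AE) auto
    then show ?thesis using integral_abs_cond_exp_le[OF G L] by simp
  qed
  \<comment> \<open>\<open>B\<close>, the conditional expectation of the truncated \<open>L\<close>,
    is bounded by \<open>c\<close>, and \<open>X k - B\<close> is the conditional expectation of the
    truncation error of \<open>L\<close>. Since \<open>truncate c (X k)\<close> is at least as near
    to \<open>X k\<close> as \<open>B\<close>, the L1 contraction gives a bound independent of
    \<open>k\<close>.\<close>
  have trunc: "(\<integral>x. \<bar>X k x - truncate c (X k x)\<bar> \<partial>M) \<le> (\<integral>x. \<bar>L x - truncate c (L x)\<bar> \<partial>M)"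
    if c: "0 \<le> c" for k c
  proof -
    interpret finite_measure_subalgebra M "G k" by (rule fms)
    define B where "B = real_cond_exp M (G k) (\<lambda>x. truncate c (L x))"
    have intc [measurable]: "integrable M (\<lambda>x. truncate c (L x))"
      by (rule integrable_const_bound[where B=c]) (auto simp: abs_truncate_le c)
    have "AE x in M. truncate c (L x) \<le> c" "AE x in M. - c \<le> truncate c (L x)"
      using abs_truncate_le[OF c] by (auto simp: abs_le_iff minus_le_iff)
    then have "AE x in M. B x \<le> c" "AE x in M. - c \<le> B x"
      unfolding B_def using real_cond_exp_le_c[OF intc] real_cond_exp_ge_c[OF intc] by blast+
    then have B: "AE x in M. \<bar>B x\<bar> \<le> c" by eventually_elim auto
    have "AE x in M. real_cond_exp M (G k) (\<lambda>x. L x - truncate c (L x)) x = X k x - B x"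
      using real_cond_exp_diff[OF L intc] ce[of k] unfolding B_def by eventually_elim simp
    with B have "AE x in M. \<bar>X k x - truncate c (X k x)\<bar> \<le> \<bar>real_cond_exp M (G k) (\<lambda>x. L x - truncate c (L x)) x\<bar>"
      by eventually_elim (auto dest: abs_diff_truncate_le)
    then have "(\<integral>x. \<bar>X k x - truncate c (X k x)\<bar> \<partial>M)
        \<le> (\<integral>x. \<bar>real_cond_exp M (G k) (\<lambda>x. L x - truncate c (L x)) x\<bar> \<partial>M)"
      by (intro integral_mono_AE' integrable_abs real_cond_exp_int Bochner_Integration.integrable_diff L intc) auto
    also have "\<dots> \<le> (\<integral>x. \<bar>L x - truncate c (L x)\<bar> \<partial>M)"
      by (intro integral_abs_cond_exp_le G Bochner_Integration.integrable_diff L intc)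
    finally show ?thesis .
  qed
  \<comment> \<open>Fatou with the uniform bound \<open>absX\<close>. Integrability of
    \<open>Y\<close> is needed first, because the tail of \<open>Y\<close> is cut off as
    well.\<close>
  have "(\<integral>\<^sup>+x. ennreal \<bar>Y x\<bar> \<partial>M) = (\<integral>\<^sup>+x. liminf (\<lambda>k. ennreal \<bar>X k x\<bar>) \<partial>M)"
  proof (rule nn_integral_cong_AE)
    show "AE x in M. ennreal \<bar>Y x\<bar> = liminf (\<lambda>k. ennreal \<bar>X k x\<bar>)"
      using lim
    proof eventually_elim
      fix x assume "(\<lambda>k. X k x) \<longlonglongrightarrow> Y x"
      then have "(\<lambda>k. ennreal \<bar>X k x\<bar>) \<longlonglongrightarrow> ennreal \<bar>Y x\<bar>"
        by (intro tendsto_intros)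
      then show "ennreal \<bar>Y x\<bar> = liminf (\<lambda>k. ennreal \<bar>X k x\<bar>)"
        by (rule lim_imp_Liminf[symmetric, OF trivial_limit_sequentially])
    qed
  qed
  also have "\<dots> \<le> liminf (\<lambda>k. \<integral>\<^sup>+x. ennreal \<bar>X k x\<bar> \<partial>M)"
    by (rule nn_integral_liminf) auto
  also have "\<dots> \<le> limsup (\<lambda>k. \<integral>\<^sup>+x. ennreal \<bar>X k x\<bar> \<partial>M)"
    by (rule Liminf_le_Limsup) simp
  also have "\<dots> \<le> ennreal (\<integral>x. \<bar>L x\<bar> \<partial>M)"
  proof (intro Limsup_bounded always_eventually allI)
    fix k
    have "(\<integral>\<^sup>+x. ennreal \<bar>X k x\<bar> \<partial>M) = ennreal (\<integral>x. \<bar>X k x\<bar> \<partial>M)"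
      using X[of k] by (intro nn_integral_eq_integral) auto
    then show "(\<integral>\<^sup>+x. ennreal \<bar>X k x\<bar> \<partial>M) \<le> ennreal (\<integral>x. \<bar>L x\<bar> \<partial>M)"
      using absX[of k] by (simp add: ennreal_leI)
  qed
  finally have "(\<integral>\<^sup>+x. ennreal \<bar>Y x\<bar> \<partial>M) < \<infinity>"
    by (simp add: le_less_trans)
  then show intY [measurable]: "integrable M Y"
    by (intro integrableI_bounded) auto
  show "(\<lambda>k. \<integral>x. \<bar>X k x - Y x\<bar> \<partial>M) \<longlonglongrightarrow> 0"
  proof (rule LIMSEQ_I)
    fix r :: real assume "0 < r"
    \<comment> \<open>One truncation level has to serve both \<open>L\<close>, which controls all
      \<open>X k\<close> through \<open>trunc\<close>, and the limit \<open>Y\<close>. The remaining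
      third is for the truncated sequence, where dominated convergence applies.\<close>
    then have r3: "0 < r / 3" by simp
    have "\<forall>\<^sub>F n in sequentially. (\<integral>x. \<bar>L x - truncate (real n) (L x)\<bar> \<partial>M) < r/3"
      "\<forall>\<^sub>F n in sequentially. (\<integral>x. \<bar>Y x - truncate (real n) (Y x)\<bar> \<partial>M) < r/3"
      using order_tendstoD(2)[OF integral_abs_diff_truncate_tendsto_0[OF L] r3]
        order_tendstoD(2)[OF integral_abs_diff_truncate_tendsto_0[OF intY] r3] by auto
    then have "\<forall>\<^sub>F n in sequentially. (\<integral>x. \<bar>L x - truncate (real n) (L x)\<bar> \<partial>M) < r/3
        \<and> (\<integral>x. \<bar>Y x - truncate (real n) (Y x)\<bar> \<partial>M) < r/3"
      by (rule eventually_conj)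
    then obtain n where n: "(\<integral>x. \<bar>L x - truncate (real n) (L x)\<bar> \<partial>M) < r/3"
      "(\<integral>x. \<bar>Y x - truncate (real n) (Y x)\<bar> \<partial>M) < r/3"
      by (auto simp: eventually_sequentially)
    define c where "c = real n"
    have c: "0 \<le> c" unfolding c_def by simp
    have intcX [measurable]: "integrable M (\<lambda>x. truncate c (X k x))" for k
      by (rule integrable_const_bound[where B=c]) (auto simp: abs_truncate_le c)
    have intcY [measurable]: "integrable M (\<lambda>x. truncate c (Y x))"
      by (rule integrable_const_bound[where B=c]) (auto simp: abs_truncate_le c)
    have "(\<lambda>k. \<integral>x. \<bar>truncate c (X k x) - truncate c (Y x)\<bar> \<partial>M) \<longlonglongrightarrow> (\<integral>x. 0 \<partial>M)"
    proof (rule integral_dominated_convergence[where w="\<lambda>x. 2 * c"])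
      show "AE x in M. (\<lambda>k. \<bar>truncate c (X k x) - truncate c (Y x)\<bar>) \<longlonglongrightarrow> 0"
        using lim by eventually_elim (auto intro!: tendsto_rabs_zero simp: LIM_zero_iff tendsto_truncate)
      show "AE x in M. norm \<bar>truncate c (X k x) - truncate c (Y x)\<bar> \<le> 2 * c" for k
      proof (rule AE_I2)
        fix x
        show "norm \<bar>truncate c (X k x) - truncate c (Y x)\<bar> \<le> 2 * c"
          using abs_truncate_le[OF c, of "X k x"] abs_truncate_le[OF c, of "Y x"] by (simp add: abs_le_iff)
      qed
    qed auto
    then have "\<forall>\<^sub>F k in sequentially. (\<integral>x. \<bar>truncate c (X k x) - truncate c (Y x)\<bar> \<partial>M) < r/3"
      using order_tendstoD(2)[OF _ r3] by simp
    then obtain K where K: "\<And>k. k \<ge> K \<Longrightarrow> (\<integral>x. \<bar>truncate c (X k x) - truncate c (Y x)\<bar> \<partial>M) < r/3"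
      by (auto simp: eventually_sequentially)
    have "norm ((\<integral>x. \<bar>X k x - Y x\<bar> \<partial>M) - 0) < r" if "k \<ge> K" for k
    proof -
      have "(\<integral>x. \<bar>X k x - Y x\<bar> \<partial>M) \<le> (\<integral>x. \<bar>X k x - truncate c (X k x)\<bar>
          + \<bar>truncate c (X k x) - truncate c (Y x)\<bar> + \<bar>Y x - truncate c (Y x)\<bar> \<partial>M)"
        by (intro integral_mono) (auto intro!: Bochner_Integration.integrable_add integrable_abs
            Bochner_Integration.integrable_diff X intY intcX intcY)
      also have "\<dots> = (\<integral>x. \<bar>X k x - truncate c (X k x)\<bar> \<partial>M)
          + (\<integral>x. \<bar>truncate c (X k x) - truncate c (Y x)\<bar> \<partial>M) + (\<integral>x. \<bar>Y x - truncate c (Y x)\<bar> \<partial>M)"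
        using X[of k] intY intcX[of k] intcY by simp
      also have "\<dots> < r"
        using trunc[OF c, of k] n K[OF that] unfolding c_def by simp
      finally show ?thesis by simp
    qed
    then show "\<exists>K. \<forall>k\<ge>K. norm ((\<integral>x. \<bar>X k x - Y x\<bar> \<partial>M) - 0) < r" by blast
  qed
qed

text \<open>Along \<open>k \<ge> n\<close> the integrals of \<open>X k\<close> over \<open>A\<close>
  are constant, and L1 convergence passes this on to \<open>Y\<close>. The \<open>G k\<close> may
  shrink or grow: the lemma serves for times approaching a stopping time from above as well as for
  an announcing sequence.\<close>

lemma (in prob_space) cond_exp_limit_set_integral:
  fixes L Y :: "'a \<Rightarrow> real" and X :: "nat \<Rightarrow> 'a \<Rightarrow> real"
  assumes L: "integrable M L"
    and G: "\<And>k. subalgebra M (G k)"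
    and XG: "\<And>k. X k \<in> borel_measurable (G k)"
    and X: "\<And>k. integrable M (X k)"
    and XL: "\<And>k A. A \<in> sets (G k) \<Longrightarrow> (\<integral>x\<in>A. X k x \<partial>M) = (\<integral>x\<in>A. L x \<partial>M)"
    and Y: "Y \<in> borel_measurable M"
    and lim: "AE x in M. (\<lambda>k. X k x) \<longlonglongrightarrow> Y x"
    and A: "\<And>k. k \<ge> (n::nat) \<Longrightarrow> A \<in> sets (G k)"
  shows "(\<integral>x\<in>A. Y x \<partial>M) = (\<integral>x\<in>A. L x \<partial>M)"
proof -
  have intY: "integrable M Y" and conv: "(\<lambda>k. \<integral>x. \<bar>X k x - Y x\<bar> \<partial>M) \<longlonglongrightarrow> 0"
    using cond_exp_L1_limit[OF assms(1-7)] by auto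
  have AM [measurable]: "A \<in> sets M"
    using A[of n] G[of n] by (auto simp: subalgebra_def)
  have "(\<lambda>k. \<integral>x\<in>A. X k x \<partial>M) \<longlonglongrightarrow> (\<integral>x\<in>A. Y x \<partial>M)"
    unfolding set_lebesgue_integral_def
  proof (rule tendsto_L1_int)
    show "(\<lambda>k. \<integral>\<^sup>+ x. norm (indicat_real A x *\<^sub>R X k x - indicat_real A x *\<^sub>R Y x) \<partial>M) \<longlonglongrightarrow> 0"
    proof (rule tendsto_sandwich[OF always_eventually always_eventually tendsto_const])
      show "(\<lambda>k. ennreal (\<integral>x. \<bar>X k x - Y x\<bar> \<partial>M)) \<longlonglongrightarrow> 0"
        using tendsto_ennrealI[OF conv] by simp
      show "\<forall>k. (\<integral>\<^sup>+ x. norm (indicat_real A x *\<^sub>R X k x - indicat_real A x *\<^sub>R Y x) \<partial>M) \<le> ennreal (\<integral>x. \<bar>X k x - Y x\<bar> \<partial>M)"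
      proof
        fix k
        have "(\<integral>\<^sup>+ x. norm (indicat_real A x *\<^sub>R X k x - indicat_real A x *\<^sub>R Y x) \<partial>M) \<le> (\<integral>\<^sup>+ x. \<bar>X k x - Y x\<bar> \<partial>M)"
          by (intro nn_integral_mono) (auto simp: indicator_def)
        also have "\<dots> = ennreal (\<integral>x. \<bar>X k x - Y x\<bar> \<partial>M)"
          using X[of k] intY by (intro nn_integral_eq_integral) auto
        finally show "(\<integral>\<^sup>+ x. norm (indicat_real A x *\<^sub>R X k x - indicat_real A x *\<^sub>R Y x) \<partial>M) \<le> ennreal (\<integral>x. \<bar>X k x - Y x\<bar> \<partial>M)" .
      qed
    qed simp
  qed (intro integrable_mult_indicator[OF AM] X intY)+
  moreover have "(\<lambda>k. \<integral>x\<in>A. X k x \<partial>M) \<longlonglongrightarrow> (\<integral>x\<in>A. L x \<partial>M)"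
    using XL A by (intro tendsto_eventually eventually_sequentiallyI[of n]) auto
  ultimately show ?thesis by (rule LIMSEQ_unique)
qed

section \<open>Optional sampling\<close>

text \<open>Times are rounded upwards, so that a rounded stopping time is again a stopping time and
  right-continuity recovers the original value. The cap at \<open>s\<close> keeps all values within
  the time interval under consideration.\<close>

definition grid_up :: "real \<Rightarrow> nat \<Rightarrow> real \<Rightarrow> real" where
  "grid_up s k x = min s (of_int \<lceil>real (Suc k) * x\<rceil> / real (Suc k))"

lemma grid_up_le: "grid_up s k x \<le> s"
  by (simp add: grid_up_def)

lemma grid_up_ge: "x \<le> s \<Longrightarrow> x \<le> grid_up s k x"
  unfolding grid_up_def by (simp add: field_simps del: of_nat_Suc)

lemma grid_up_upper: "grid_up s k x \<le> x + 1 / real (Suc k)"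
proof -
  have "of_int \<lceil>real (Suc k) * x\<rceil> \<le> real (Suc k) * x + 1"
    by linarith
  then have "of_int \<lceil>real (Suc k) * x\<rceil> / real (Suc k) \<le> (real (Suc k) * x + 1) / real (Suc k)"
    by (rule divide_right_mono) simp
  also have "\<dots> = x + 1 / real (Suc k)"
    by (simp add: field_simps)
  finally show ?thesis by (simp add: grid_up_def min_le_iff_disj)
qed

lemma grid_up_tendsto: "x \<le> s \<Longrightarrow> (\<lambda>k. grid_up s k x) \<longlonglongrightarrow> x"
proof (rule tendsto_sandwich[OF always_eventually always_eventually tendsto_const])
  have "(\<lambda>k. 1 / real (Suc k)) \<longlonglongrightarrow> 0"
    by (rule LIMSEQ_Suc[OF lim_1_over_n])
  from tendsto_add[OF tendsto_const[of x] this]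
  show "(\<lambda>k. x + 1 / real (Suc k)) \<longlonglongrightarrow> x" by simp
qed (auto intro: grid_up_ge grid_up_upper simp del: of_nat_Suc)

lemma finite_grid_up_image: "finite (grid_up s k ` {0..s})"
proof (rule finite_subset)
  show "grid_up s k ` {0..s} \<subseteq> (\<lambda>j. min s (of_int j / real (Suc k))) ` {0..\<lceil>real (Suc k) * s\<rceil>}"
  proof
    fix y assume "y \<in> grid_up s k ` {0..s}"
    then obtain x where x: "0 \<le> x" "x \<le> s" "y = grid_up s k x" by auto
    then have "0 \<le> real (Suc k) * x" "real (Suc k) * x \<le> real (Suc k) * s"
      by (auto intro: mult_left_mono simp del: of_nat_Suc)
    then have "\<lceil>real (Suc k) * x\<rceil> \<in> {0..\<lceil>real (Suc k) * s\<rceil>}"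
      using ceiling_mono[of 0 "real (Suc k) * x"] ceiling_mono[of "real (Suc k) * x" "real (Suc k) * s"]
      by (simp del: of_nat_Suc)
    then show "y \<in> (\<lambda>j. min s (of_int j / real (Suc k))) ` {0..\<lceil>real (Suc k) * s\<rceil>}"
      unfolding x(3) grid_up_def by (rule imageI)
  qed
qed simp

lemma grid_up_nonneg: "0 \<le> x \<Longrightarrow> x \<le> s \<Longrightarrow> 0 \<le> grid_up s k x"
  using grid_up_ge[of x s k] by simp

text \<open>Some \<open>y k\<close> may equal \<open>x\<close>, so continuity is used within the
  closed half line \<open>{x..}\<close>. At \<open>x = t\<close> nothing is known to the right, but
  there \<open>y\<close> is constant.\<close>

lemma cadlag_on_right_sequence:
  assumes f: "cadlag_on t f" and x: "0 \<le> x" "x \<le> t"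
    and y: "\<And>k. x \<le> y k" "\<And>k. y k \<le> t" "y \<longlonglongrightarrow> x"
  shows "(\<lambda>k. f (y k)) \<longlonglongrightarrow> f x"
proof (cases "x = t")
  case True
  then have "y k = x" for k using y(1,2)[of k] by (intro antisym) auto
  then show ?thesis by simp
next
  case False
  then have "(f \<longlongrightarrow> f x) (at x within {x<..})"
    using f x by (auto simp: cadlag_on_def)
  then have "continuous (at x within {x<..}) f"
    by (simp add: continuous_within)
  then have "continuous (at x within {x..}) f"
    by (simp add: continuous_within at_within_Ici_at_right)
  then show ?thesis
    by (rule continuous_within_tendsto_compose) (use y in auto)
qed

section \<open>Stopped values and sampling at stopping times\<close>

context usual_filtered_prob_space
begin

lemma subalgebra_F: "subalgebra P (F s)"
  using sets_F_subset[of s] by (auto simp: subalgebra_def space_F)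

lemma F_measurable_mono: "f \<in> borel_measurable (F s) \<Longrightarrow> s \<le> u \<Longrightarrow> f \<in> borel_measurable (F u)"
  by (rule measurable_from_subalg) (auto simp: subalgebra_def space_F sets_F_mono)

text \<open>\<open>T\<close> is finite-valued, so \<open>A\<close> is exhausted by its parts on
  \<open>T \<le> n\<close>.\<close>

lemma subalgebra_pre_sigma:
  assumes T: "stopping_time F T"
  shows "subalgebra P (pre_sigma T)"
proof -
  have "A \<in> sets P" if A: "A \<in> sets (pre_sigma T)" for A
  proof -
    have "A = (\<Union>n. {\<omega>\<in>A. T \<omega> \<le> real n})"
      using real_arch_simple by auto
    also have "\<dots> \<in> sets P"
      using sets_pre_sigmaD[OF T A] sets_F_subset by (intro sets.countable_UN) blast
    finally show ?thesis .
  qed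
  then show ?thesis by (auto simp: subalgebra_def space_pre_sigma)
qed

lemma bounded_stopping_time_measurable:
  assumes T: "stopping_time F T" and le: "\<And>\<omega>. \<omega> \<in> space P \<Longrightarrow> T \<omega> \<le> s"
  shows "T \<in> borel_measurable (F s)"
proof (rule borel_measurableI_le)
  fix c
  show "{\<omega> \<in> space (F s). T \<omega> \<le> c} \<in> sets (F s)"
  proof (cases "c \<le> s")
    case True
    then show ?thesis using stopping_time_le_const[OF T] by (simp add: pred_def)
  next
    case False
    then have "{\<omega> \<in> space (F s). T \<omega> \<le> c} = space (F s)"
      using le by (force simp: space_F)
    then show ?thesis by simp
  qed
qed

text \<open>Below the cap, the rounded time is at most \<open>u\<close> exactly when
  \<open>T\<close> is at most the largest grid point not exceeding \<open>u\<close>; this event is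
  known at time \<open>u\<close>.\<close>

lemma stopping_time_grid_up:
  assumes T: "stopping_time F T"
  shows "stopping_time F (\<lambda>\<omega>. grid_up s k (T \<omega>))"
proof
  fix u
  show "Measurable.pred (F u) (\<lambda>\<omega>. grid_up s k (T \<omega>) \<le> u)"
  proof (cases "s \<le> u")
    case True
    then have "grid_up s k x \<le> u" for x using grid_up_le order_trans by blast
    then show ?thesis by simp
  next
    case False
    have "grid_up s k x \<le> u \<longleftrightarrow> x \<le> of_int \<lfloor>real (Suc k) * u\<rfloor> / real (Suc k)" for x
    proof -
      have "grid_up s k x \<le> u \<longleftrightarrow> of_int \<lceil>real (Suc k) * x\<rceil> \<le> real (Suc k) * u"
        using False by (auto simp: grid_up_def min_le_iff_disj field_simps simp del: of_nat_Suc)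
      also have "\<dots> \<longleftrightarrow> \<lceil>real (Suc k) * x\<rceil> \<le> \<lfloor>real (Suc k) * u\<rfloor>"
        by (simp only: le_floor_iff)
      also have "\<dots> \<longleftrightarrow> real (Suc k) * x \<le> of_int \<lfloor>real (Suc k) * u\<rfloor>"
        by (simp only: ceiling_le_iff)
      also have "\<dots> \<longleftrightarrow> x \<le> of_int \<lfloor>real (Suc k) * u\<rfloor> / real (Suc k)"
        by (simp add: field_simps del: of_nat_Suc)
      finally show ?thesis .
    qed
    moreover have "of_int \<lfloor>real (Suc k) * u\<rfloor> / real (Suc k) \<le> u"
      by (simp add: field_simps del: of_nat_Suc)
    ultimately show ?thesis
      using stopping_time_le_const[OF T] by simp
  qed
qed

lemma finite_range_stopped_measurable:
  fixes T :: "'a \<Rightarrow> real" and Y :: "real \<Rightarrow> 'a \<Rightarrow> real"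
  assumes T: "T \<in> borel_measurable (F s)" and Q: "finite Q" "\<And>\<omega>. \<omega> \<in> space P \<Longrightarrow> T \<omega> \<in> Q"
    and Y: "\<And>q. q \<in> Q \<Longrightarrow> Y q \<in> borel_measurable (F s)"
  shows "(\<lambda>\<omega>. Y (T \<omega>) \<omega>) \<in> borel_measurable (F s)"
proof (rule measurable_compose_countable'[where I=Q and g=T])
  show "T \<in> F s \<rightarrow>\<^sub>M count_space Q"
    unfolding measurable_count_space_eq2[OF Q(1)]
  proof (intro conjI ballI)
    show "T -` {a} \<inter> space (F s) \<in> sets (F s)" for a
      by (rule measurable_sets[OF T]) simp
  qed (use Q(2) in \<open>auto simp: space_F\<close>)
qed (use Q Y in \<open>auto simp: countable_finite\<close>)

text \<open>Rounding \<open>min T s\<close> upwards gives finitely many values \<open>q\<close>. The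
  cap keeps them at most \<open>s\<close>, so that each \<open>Y q\<close> is measurable with
  respect to \<open>F s\<close>; right-continuity of the paths then gives the limit.\<close>

lemma stopped_measurable_F:
  assumes Y: "cadlag_adapted P F t Y" and T: "nonneg_stopping_time P F T"
    and s: "0 \<le> s" "s \<le> t"
  shows "(\<lambda>\<omega>. Y (min (T \<omega>) s) \<omega>) \<in> borel_measurable (F s)"
proof (rule borel_measurable_LIMSEQ_real[where u="\<lambda>k \<omega>. Y (grid_up s k (min (T \<omega>) s)) \<omega>"])
  have T': "stopping_time F (\<lambda>\<omega>. min (T \<omega>) s)"
    using T by (auto simp: nonneg_stopping_time_def intro: stopping_time_min stopping_time_const)
  show "(\<lambda>\<omega>. Y (grid_up s k (min (T \<omega>) s)) \<omega>) \<in> borel_measurable (F s)" for k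
  proof (rule finite_range_stopped_measurable[where Y=Y and T="\<lambda>\<omega>. grid_up s k (min (T \<omega>) s)",
        OF _ finite_grid_up_image])
    show "(\<lambda>\<omega>. grid_up s k (min (T \<omega>) s)) \<in> borel_measurable (F s)"
      by (intro bounded_stopping_time_measurable stopping_time_grid_up T' grid_up_le)
    show "grid_up s k (min (T \<omega>) s) \<in> grid_up s k ` {0..s}" if "\<omega> \<in> space P" for \<omega>
      using that T s by (auto simp: nonneg_stopping_time_def)
    show "Y q \<in> borel_measurable (F s)" if q: "q \<in> grid_up s k ` {0..s}" for q
    proof -
      obtain x where "0 \<le> x" "x \<le> s" "q = grid_up s k x"
        using q by auto
      then have "0 \<le> q" "q \<le> s"
        by (simp_all add: grid_up_nonneg grid_up_le)
      moreover from this have "Y q \<in> borel_measurable (F q)"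
        using Y s by (auto simp: cadlag_adapted_def adapted_on_def)
      ultimately show ?thesis by (blast intro: F_measurable_mono)
    qed
  qed
  show "(\<lambda>k. Y (grid_up s k (min (T \<omega>) s)) \<omega>) \<longlonglongrightarrow> Y (min (T \<omega>) s) \<omega>" if "\<omega> \<in> space (F s)" for \<omega>
  proof (rule cadlag_on_right_sequence[where f="\<lambda>s. Y s \<omega>"])
    show "cadlag_on t (\<lambda>s. Y s \<omega>)"
      using Y that by (auto simp: cadlag_adapted_def space_F)
    show "0 \<le> min (T \<omega>) s"
      using T s that by (auto simp: nonneg_stopping_time_def space_F)
    show "grid_up s k (min (T \<omega>) s) \<le> t" for k
      by (rule order_trans[OF grid_up_le s(2)])
  qed (use s in \<open>auto intro: grid_up_ge grid_up_tendsto\<close>)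
qed

text \<open>On \<open>T \<le> s\<close> the value at \<open>T\<close> is the value at
  \<open>min T (min s t)\<close>. The minimum with \<open>t\<close> stays within the interval on
  which \<open>Y\<close> is adapted.\<close>

lemma stopped_measurable_pre_sigma:
  assumes Y: "cadlag_adapted P F t Y" and T: "nonneg_stopping_time P F T"
    and le: "\<And>\<omega>. \<omega> \<in> space P \<Longrightarrow> T \<omega> \<le> t" and t: "0 \<le> t"
  shows "(\<lambda>\<omega>. Y (T \<omega>) \<omega>) \<in> borel_measurable (pre_sigma T)"
proof (rule borel_measurableI_le)
  have ST: "stopping_time F T" using T by (simp add: nonneg_stopping_time_def)
  fix c
  show "{\<omega> \<in> space (pre_sigma T). Y (T \<omega>) \<omega> \<le> c} \<in> sets (pre_sigma T)"
  proof (rule sets_pre_sigmaI[OF ST])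
    fix s
    show "{\<omega> \<in> {\<omega> \<in> space (pre_sigma T). Y (T \<omega>) \<omega> \<le> c}. T \<omega> \<le> s} \<in> sets (F s)"
    proof (cases "0 \<le> s")
      case False
      then have "{\<omega> \<in> {\<omega> \<in> space (pre_sigma T). Y (T \<omega>) \<omega> \<le> c}. T \<omega> \<le> s} = {}"
        using T by (fastforce simp: nonneg_stopping_time_def space_pre_sigma)
      then show ?thesis by (simp only: sets.empty_sets)
    next
      case True
      have "(\<lambda>\<omega>. Y (min (T \<omega>) (min s t)) \<omega>) \<in> borel_measurable (F s)"
        using True t by (intro F_measurable_mono[OF stopped_measurable_F[OF Y T]]) auto
      moreover have "Measurable.pred (F s) (\<lambda>\<omega>. T \<omega> \<le> s)"
        by (rule stopping_timeD[OF ST])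
      ultimately have "{\<omega> \<in> space (F s). Y (min (T \<omega>) (min s t)) \<omega> \<le> c \<and> T \<omega> \<le> s} \<in> sets (F s)"
        by measurable
      also have "{\<omega> \<in> space (F s). Y (min (T \<omega>) (min s t)) \<omega> \<le> c \<and> T \<omega> \<le> s}
          = {\<omega> \<in> {\<omega> \<in> space (pre_sigma T). Y (T \<omega>) \<omega> \<le> c}. T \<omega> \<le> s}"
        using le by (auto simp: space_F space_pre_sigma min_absorb1)
      finally show ?thesis .
    qed
  qed
qed

lemma martingale_on_set_integral:
  fixes L :: "real \<Rightarrow> 'a \<Rightarrow> real"
  assumes L: "martingale_on P F t L" and s: "0 \<le> s" "s \<le> t" and A: "A \<in> sets (F s)"
  shows "(\<integral>\<omega>\<in>A. L s \<omega> \<partial>P) = (\<integral>\<omega>\<in>A. L t \<omega> \<partial>P)"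
proof -
  interpret finite_measure_subalgebra P "F s"
    using subalgebra_F by unfold_locales
  have int: "integrable P (L s)" "integrable P (L t)"
    using L s by (auto simp: martingale_on_def)
  have "AE \<omega> in P. real_cond_exp P (F s) (L t) \<omega> = L s \<omega>"
    using L s by (auto simp: martingale_on_def)
  moreover have "A \<in> sets P" using A sets_F_subset by blast
  ultimately have "(\<integral>\<omega>\<in>A. real_cond_exp P (F s) (L t) \<omega> \<partial>P) = (\<integral>\<omega>\<in>A. L s \<omega> \<partial>P)"
    using int unfolding set_lebesgue_integral_def
    by (intro integral_cong_AE) auto
  then show ?thesis using real_cond_exp_intA[OF int(2) A] by simp
qed

text \<open>\<open>A\<close> splits into the finitely many events \<open>T = q\<close> within
  \<open>A\<close>, each of which lies in \<open>F q\<close>, and the martingale identity is applied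
  to each.\<close>

lemma finite_range_optional_sampling:
  assumes L: "martingale_on P F t L" and T: "stopping_time F T"
    and Q: "finite Q" "Q \<subseteq> {0..t}" "\<And>\<omega>. \<omega> \<in> space P \<Longrightarrow> T \<omega> \<in> Q"
  shows "integrable P (\<lambda>\<omega>. L (T \<omega>) \<omega>)"
    and "A \<in> sets (pre_sigma T) \<Longrightarrow> (\<integral>\<omega>\<in>A. L (T \<omega>) \<omega> \<partial>P) = (\<integral>\<omega>\<in>A. L t \<omega> \<partial>P)"
proof -
  have L_int: "integrable P (L q)" if "q \<in> Q" for q
    using L Q that by (auto simp: martingale_on_def)
  have Tq: "{\<omega>\<in>A. T \<omega> = q} \<in> sets (F q)" if "A \<in> sets (pre_sigma T)" for q A
  proof -
    have "{\<omega>\<in>A. T \<omega> \<le> q} \<inter> {\<omega>\<in>space (F q). T \<omega> = q} \<in> sets (F q)"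
      using sets_pre_sigmaD[OF T that] stopping_time_eq_const[OF T, of q]
      by (intro sets.Int) (auto simp: pred_def)
    also have "{\<omega>\<in>A. T \<omega> \<le> q} \<inter> {\<omega>\<in>space (F q). T \<omega> = q} = {\<omega>\<in>A. T \<omega> = q}"
      using sets.sets_into_space[OF that] by (auto simp: space_F space_pre_sigma)
    finally show ?thesis .
  qed
  have sumQ: "indicator A \<omega> *\<^sub>R f (T \<omega>) = (\<Sum>q\<in>Q. indicator {\<omega>\<in>A. T \<omega> = q} \<omega> *\<^sub>R f q)"
    if "\<omega> \<in> space P" for A \<omega> and f :: "real \<Rightarrow> real"
  proof -
    have "(\<Sum>q\<in>Q. indicator {\<omega>\<in>A. T \<omega> = q} \<omega> *\<^sub>R f q) = (\<Sum>q\<in>Q. if T \<omega> = q then indicator A \<omega> *\<^sub>R f q else 0)"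
      by (intro sum.cong) (auto simp: indicator_def)
    also have "\<dots> = indicator A \<omega> *\<^sub>R f (T \<omega>)"
      using Q(1) Q(3)[OF that] by (simp add: sum.delta)
    finally show ?thesis by simp
  qed
  have ind_int: "integrable P (\<lambda>\<omega>. indicator {\<omega>\<in>A. T \<omega> = q} \<omega> *\<^sub>R L u \<omega>)"
    if "A \<in> sets (pre_sigma T)" "integrable P (L u)" for A q u
    using Tq[OF that(1)] sets_F_subset that(2) by (intro integrable_mult_indicator) blast
  have sp: "space P \<in> sets (pre_sigma T)"
    using sets.top[of "pre_sigma T"] by (simp add: space_pre_sigma)
  have "integrable P (\<lambda>\<omega>. indicator (space P) \<omega> *\<^sub>R L (T \<omega>) \<omega>)"
    by (subst Bochner_Integration.integrable_cong[OF refl sumQ[of _ "space P" "\<lambda>u. L u _"]])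
      (auto simp del: scaleR_conv_of_real real_scaleR_def intro!: Bochner_Integration.integrable_sum ind_int[OF sp] L_int)
  moreover have "integrable P (\<lambda>\<omega>. indicator (space P) \<omega> *\<^sub>R L (T \<omega>) \<omega>) \<longleftrightarrow> integrable P (\<lambda>\<omega>. L (T \<omega>) \<omega>)"
    by (rule Bochner_Integration.integrable_cong) auto
  ultimately show "integrable P (\<lambda>\<omega>. L (T \<omega>) \<omega>)" by simp
  assume A: "A \<in> sets (pre_sigma T)"
  have "Q \<noteq> {}" using Q(3) not_empty by auto
  then have "0 \<le> t" using Q(2) by force
  then have Lt_int: "integrable P (L t)"
    using L by (auto simp: martingale_on_def)
  have "(\<integral>\<omega>\<in>A. L (T \<omega>) \<omega> \<partial>P) = (\<integral>\<omega>. (\<Sum>q\<in>Q. indicator {\<omega>\<in>A. T \<omega> = q} \<omega> *\<^sub>R L q \<omega>) \<partial>P)"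
    unfolding set_lebesgue_integral_def
    by (rule Bochner_Integration.integral_cong[OF refl sumQ])
  also have "\<dots> = (\<Sum>q\<in>Q. \<integral>\<omega>\<in>{\<omega>\<in>A. T \<omega> = q}. L q \<omega> \<partial>P)"
    unfolding set_lebesgue_integral_def
    by (intro Bochner_Integration.integral_sum ind_int[OF A] L_int)
  also have "\<dots> = (\<Sum>q\<in>Q. \<integral>\<omega>\<in>{\<omega>\<in>A. T \<omega> = q}. L t \<omega> \<partial>P)"
    using Q(2) by (intro sum.cong refl martingale_on_set_integral[OF L _ _ Tq[OF A]]) auto
  also have "\<dots> = (\<integral>\<omega>. (\<Sum>q\<in>Q. indicator {\<omega>\<in>A. T \<omega> = q} \<omega> *\<^sub>R L t \<omega>) \<partial>P)"
    unfolding set_lebesgue_integral_def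
    by (intro Bochner_Integration.integral_sum[symmetric] ind_int[OF A] Lt_int)
  also have "\<dots> = (\<integral>\<omega>\<in>A. L t \<omega> \<partial>P)"
    unfolding set_lebesgue_integral_def
    by (rule Bochner_Integration.integral_cong[OF refl sumQ[symmetric]])
  finally show "(\<integral>\<omega>\<in>A. L (T \<omega>) \<omega> \<partial>P) = (\<integral>\<omega>\<in>A. L t \<omega> \<partial>P)" .
qed

text \<open>The rounded times \<open>Tk k\<close> lie above \<open>T\<close> and tend to it, so the
  sampled values converge by right-continuity; being conditional expectations of \<open>L t\<close>,
  they converge in L1 too. The \<open>Tk k\<close> need not be monotone in \<open>k\<close>:
  \<open>T \<le> Tk k\<close> suffices for \<open>A\<close> to lie in all their
  sigma-algebras.\<close>

lemma optional_sampling: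
  assumes Lc: "cadlag_adapted P F t L" and L: "martingale_on P F t L"
    and T: "nonneg_stopping_time P F T" and le: "\<And>\<omega>. \<omega> \<in> space P \<Longrightarrow> T \<omega> \<le> t" and t: "0 \<le> t"
  shows "integrable P (\<lambda>\<omega>. L (T \<omega>) \<omega>)"
    and "A \<in> sets (pre_sigma T) \<Longrightarrow> (\<integral>\<omega>\<in>A. L (T \<omega>) \<omega> \<partial>P) = (\<integral>\<omega>\<in>A. L t \<omega> \<partial>P)"
proof -
  define Tk where "Tk = (\<lambda>k \<omega>. grid_up t k (T \<omega>))"
  have ST: "stopping_time F T" and T0: "\<And>\<omega>. \<omega> \<in> space P \<Longrightarrow> 0 \<le> T \<omega>"
    using T by (auto simp: nonneg_stopping_time_def)
  have STk: "stopping_time F (Tk k)" for k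
    unfolding Tk_def by (rule stopping_time_grid_up[OF ST])
  have ge: "T \<omega> \<le> Tk k \<omega>" "Tk k \<omega> \<le> t" if "\<omega> \<in> space P" for k \<omega>
    using grid_up_ge[OF le[OF that]] by (auto simp: Tk_def grid_up_le)
  have NTk: "nonneg_stopping_time P F (Tk k)" for k
    using STk order_trans[OF T0 ge(1)] by (auto simp: nonneg_stopping_time_def)
  have Q: "finite (grid_up t k ` {0..t})" "grid_up t k ` {0..t} \<subseteq> {0..t}"
    "\<And>\<omega>. \<omega> \<in> space P \<Longrightarrow> Tk k \<omega> \<in> grid_up t k ` {0..t}" for k
    using finite_grid_up_image T0 le by (auto simp: Tk_def grid_up_nonneg grid_up_le)
  have hyps: "integrable P (L t)" "\<And>k. subalgebra P (pre_sigma (Tk k))"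
    "\<And>k. (\<lambda>\<omega>. L (Tk k \<omega>) \<omega>) \<in> borel_measurable (pre_sigma (Tk k))"
    "\<And>k. integrable P (\<lambda>\<omega>. L (Tk k \<omega>) \<omega>)"
    "\<And>k A. A \<in> sets (pre_sigma (Tk k)) \<Longrightarrow> (\<integral>\<omega>\<in>A. L (Tk k \<omega>) \<omega> \<partial>P) = (\<integral>\<omega>\<in>A. L t \<omega> \<partial>P)"
    "(\<lambda>\<omega>. L (T \<omega>) \<omega>) \<in> borel_measurable P"
    "AE \<omega> in P. (\<lambda>k. L (Tk k \<omega>) \<omega>) \<longlonglongrightarrow> L (T \<omega>) \<omega>"
  proof -
    show "integrable P (L t)" using L t by (auto simp: martingale_on_def)
    show "subalgebra P (pre_sigma (Tk k))" for k by (rule subalgebra_pre_sigma[OF STk])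
    show "(\<lambda>\<omega>. L (Tk k \<omega>) \<omega>) \<in> borel_measurable (pre_sigma (Tk k))" for k
      by (rule stopped_measurable_pre_sigma[OF Lc NTk ge(2) t])
    show "integrable P (\<lambda>\<omega>. L (Tk k \<omega>) \<omega>)" for k
      by (rule finite_range_optional_sampling(1)[OF L STk Q])
    show "(\<integral>\<omega>\<in>A. L (Tk k \<omega>) \<omega> \<partial>P) = (\<integral>\<omega>\<in>A. L t \<omega> \<partial>P)" if "A \<in> sets (pre_sigma (Tk k))" for k A
      by (rule finite_range_optional_sampling(2)[OF L STk Q that])
    show "(\<lambda>\<omega>. L (T \<omega>) \<omega>) \<in> borel_measurable P"
      by (rule measurable_from_subalg[OF subalgebra_pre_sigma[OF ST] stopped_measurable_pre_sigma[OF Lc T le t]])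
    show "AE \<omega> in P. (\<lambda>k. L (Tk k \<omega>) \<omega>) \<longlonglongrightarrow> L (T \<omega>) \<omega>"
    proof (rule AE_I2)
      fix \<omega> assume \<omega>: "\<omega> \<in> space P"
      show "(\<lambda>k. L (Tk k \<omega>) \<omega>) \<longlonglongrightarrow> L (T \<omega>) \<omega>"
      proof (rule cadlag_on_right_sequence[where f="\<lambda>s. L s \<omega>"])
        show "cadlag_on t (\<lambda>s. L s \<omega>)"
          using Lc \<omega> by (auto simp: cadlag_adapted_def)
        show "(\<lambda>k. Tk k \<omega>) \<longlonglongrightarrow> T \<omega>"
          unfolding Tk_def by (rule grid_up_tendsto[OF le[OF \<omega>]])
      qed (use T0[OF \<omega>] le[OF \<omega>] ge[OF \<omega>] in auto)
    qed
  qed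
  show "integrable P (\<lambda>\<omega>. L (T \<omega>) \<omega>)"
    by (rule cond_exp_L1_limit(1)[OF hyps])
  assume "A \<in> sets (pre_sigma T)"
  then have "A \<in> sets (pre_sigma (Tk k))" for k
    using mono_pre_sigma[OF ST STk ge(1)] by blast
  then show "(\<integral>\<omega>\<in>A. L (T \<omega>) \<omega> \<partial>P) = (\<integral>\<omega>\<in>A. L t \<omega> \<partial>P)"
    by (intro cond_exp_limit_set_integral[OF hyps, of 0]) auto
qed

end

section \<open>Jumps at predictable times\<close>

lemma jump_eqI: "0 < s \<Longrightarrow> (f \<longlongrightarrow> l) (at_left s) \<Longrightarrow> jump f s = f s - l"
  by (simp add: jump_def tendsto_Lim trivial_limit_at_left_real)

lemma cadlag_on_left_limit:
  assumes "cadlag_on t f" "0 < s" "s \<le> t"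
  shows "(f \<longlongrightarrow> f s - jump f s) (at_left s)"
proof -
  obtain l where "(f \<longlongrightarrow> l) (at_left s)"
    using assms unfolding cadlag_on_def by (metis greaterThanAtMost_iff)
  with jump_eqI[OF assms(2) this] show ?thesis by simp
qed

lemma cadlag_on_left_sequence:
  assumes f: "cadlag_on t f" and s: "0 < s" "s \<le> t" and y: "\<And>k. y k < s" "y \<longlonglongrightarrow> s"
  shows "(\<lambda>k. f (y k)) \<longlonglongrightarrow> f s - jump f s"
proof -
  have "filterlim y (at_left s) sequentially"
    using y less_imp_neq[OF y(1)] by (auto simp: filterlim_at)
  with cadlag_on_left_limit[OF f s] show ?thesis
    by (rule filterlim_compose)
qed

lemma eventually_at_left_min:
  fixes s c :: real assumes "s \<le> c"
  shows "\<forall>\<^sub>F r in at_left s. min r c = r"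
  using assms by (auto simp: eventually_at_filter)

lemma cadlag_on_stopped:
  assumes f: "cadlag_on t f" and c: "0 \<le> c"
  shows "cadlag_on t (\<lambda>s. f (min s c) - d)"
  unfolding cadlag_on_def
proof (intro conjI ballI)
  fix s assume s: "s \<in> {0..<t}"
  show "((\<lambda>s. f (min s c) - d) \<longlongrightarrow> f (min s c) - d) (at_right s)"
  proof (cases "s < c")
    case True
    have "\<forall>\<^sub>F r in at_right s. f (min r c) - d = f r - d"
      using eventually_at_right_less[of s] order_tendstoD(2)[OF tendsto_ident_at True]
      by eventually_elim auto
    moreover have "((\<lambda>r. f r - d) \<longlongrightarrow> f s - d) (at_right s)"
      using f s by (auto simp: cadlag_on_def intro!: tendsto_intros)
    ultimately have "((\<lambda>s. f (min s c) - d) \<longlongrightarrow> f s - d) (at_right s)"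
      by (simp only: tendsto_cong)
    then show ?thesis using True by simp
  next
    case False
    then have "\<forall>\<^sub>F r in at_right s. f (min r c) - d = f (min s c) - d"
      using eventually_at_right_less[of s] by (auto elim!: eventually_mono)
    then show ?thesis by (rule tendsto_eventually)
  qed
next
  fix s assume s: "s \<in> {0<..t}"
  show "\<exists>l. ((\<lambda>s. f (min s c) - d) \<longlongrightarrow> l) (at_left s)"
  proof (cases "s \<le> c")
    case True
    obtain l where "(f \<longlongrightarrow> l) (at_left s)"
      using f s unfolding cadlag_on_def by blast
    then have "((\<lambda>r. f r - d) \<longlongrightarrow> l - d) (at_left s)"
      by (intro tendsto_intros)
    moreover have "\<forall>\<^sub>F r in at_left s. f (min r c) - d = f r - d"
      using eventually_at_left_min[OF True] by (auto elim!: eventually_mono)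
    ultimately have "((\<lambda>s. f (min s c) - d) \<longlongrightarrow> l - d) (at_left s)"
      by (simp only: tendsto_cong)
    then show ?thesis by blast
  next
    case False
    then have "\<forall>\<^sub>F r in at_left s. c < r"
      by (intro order_tendstoD(1)[OF tendsto_ident_at]) auto
    then have "\<forall>\<^sub>F r in at_left s. f (min r c) - d = f c - d"
      by (auto elim!: eventually_mono)
    then have "((\<lambda>s. f (min s c) - d) \<longlongrightarrow> f c - d) (at_left s)"
      by (rule tendsto_eventually)
    then show ?thesis by blast
  qed
qed

text \<open>To the left of \<open>s \<le> c\<close>, stopping at \<open>c\<close> changes nothing.
  The case \<open>s = c\<close> is included: a jump at the stopping time itself survives. The
  localizing events below can therefore read \<open>T \<le> R\<close>, which matters because the
  localizing times are only known to reach \<open>t\<close>.\<close>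

lemma jump_stopped:
  assumes f: "cadlag_on t f" and s: "s \<le> t" "s \<le> c"
  shows "jump (\<lambda>s. f (min s c) - d) s = jump f s"
proof (cases "0 < s")
  case True
  have "((\<lambda>r. f r - d) \<longlongrightarrow> (f s - jump f s) - d) (at_left s)"
    using cadlag_on_left_limit[OF f True s(1)] by (intro tendsto_intros)
  moreover have "\<forall>\<^sub>F r in at_left s. f (min r c) - d = f r - d"
    using eventually_at_left_min[OF s(2)] by (auto elim!: eventually_mono)
  ultimately have "((\<lambda>r. f (min r c) - d) \<longlongrightarrow> (f s - jump f s) - d) (at_left s)"
    by (simp only: tendsto_cong)
  from jump_eqI[OF True this] s show ?thesis by simp
qed (simp add: jump_def)

lemma jump_diff_eq:
  assumes c: "cadlag_on t f" "cadlag_on t f'" "cadlag_on t g" "cadlag_on t g'"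
    and eq: "\<And>r. r \<in> {0..t} \<Longrightarrow> f r + g r = f' r + g' r" and s: "s \<le> t"
  shows "jump f s - jump f' s = jump g' s - jump g s"
proof (cases "0 < s")
  case True
  have lim: "((\<lambda>r. f r + g r) \<longlongrightarrow> (f s - jump f s) + (g s - jump g s)) (at_left s)"
    "((\<lambda>r. f' r + g' r) \<longlongrightarrow> (f' s - jump f' s) + (g' s - jump g' s)) (at_left s)"
    using c True s by (auto intro!: tendsto_add cadlag_on_left_limit)
  have "\<forall>\<^sub>F r in at_left s. f r + g r = f' r + g' r"
    using eventually_at_left_real[OF True] by eventually_elim (use s eq in auto)
  then have "((\<lambda>r. f r + g r) \<longlongrightarrow> (f' s - jump f' s) + (g' s - jump g' s)) (at_left s)"
    using lim(2) by (simp only: tendsto_cong)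
  with lim(1) have "(f s - jump f s) + (g s - jump g s) = (f' s - jump f' s) + (g' s - jump g' s)"
    by (rule tendsto_unique[OF trivial_limit_at_left_real])
  with eq[of s] True s show ?thesis by simp
qed (simp add: jump_def)

context usual_filtered_prob_space
begin

section \<open>The strict past of a stopping time and the jumps of martingales\<close>

lemma space_strict_past: "space (strict_past P F T) = space P"
  unfolding strict_past_def
  by (rule space_measure_of) (use sets.sets_into_space[of _ "F _"] in \<open>force simp: space_F\<close>)

lemma strict_past_generator_subset:
  "sets (F 0) \<union> {A \<inter> {\<omega> \<in> space P. u < T \<omega>} | A u. 0 \<le> u \<and> A \<in> sets (F u)} \<subseteq> Pow (space P)"
  using sets.sets_into_space[of _ "F _"] by (force simp: space_F)

lemma sets_strict_past:
  "sets (strict_past P F T) = sigma_sets (space P)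
     (sets (F 0) \<union> {A \<inter> {\<omega> \<in> space P. u < T \<omega>} | A u. 0 \<le> u \<and> A \<in> sets (F u)})"
  unfolding strict_past_def by (rule sets_measure_of[OF strict_past_generator_subset])

lemma strict_past_generatorI:
  assumes "A \<in> sets (F u)" "0 \<le> u"
  shows "A \<inter> {\<omega> \<in> space P. u < T \<omega>} \<in> sets (strict_past P F T)"
  unfolding sets_strict_past using assms by (intro sigma_sets.Basic) auto

lemma stopping_time_gt_sets:
  assumes "stopping_time F T" shows "{\<omega> \<in> space P. u < T \<omega>} \<in> sets (F u)"
  using stopping_timeD2[OF assms, of u] by (simp add: pred_def space_F)

lemma strict_past_subset:
  assumes "stopping_time F T" shows "sets (strict_past P F T) \<subseteq> sets P"
  unfolding sets_strict_past
proof (rule sets.sigma_sets_subset, safe)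
  show "A \<in> sets (F 0) \<Longrightarrow> A \<in> sets P" for A using sets_F_subset by blast
  show "A \<in> sets (F u) \<Longrightarrow> A \<inter> {\<omega> \<in> space P. u < T \<omega>} \<in> sets P" for A u
    using stopping_time_gt_sets[OF assms] sets_F_subset by blast
qed

text \<open>Two generators with thresholds \<open>u\<close> and \<open>v\<close> meet in one with
  threshold \<open>max u v\<close>. This prepares a Dynkin argument on the strict past. The sets of
  \<open>F 0\<close> are generators of their own because the others miss the event
  \<open>T = 0\<close>.\<close>

lemma strict_past_generator_Int_stable:
  "Int_stable (sets (F 0) \<union> {A \<inter> {\<omega> \<in> space P. u < T \<omega>} | A u. 0 \<le> u \<and> A \<in> sets (F u)})"
  (is "Int_stable (?F \<union> ?G)")
proof (rule Int_stableI)
  have F0: "A \<in> sets (F 0) \<Longrightarrow> 0 \<le> u \<Longrightarrow> A \<in> sets (F u)" for A u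
    using sets_F_mono by blast
  fix a b assume a: "a \<in> ?F \<union> ?G" and b: "b \<in> ?F \<union> ?G"
  have FG: "a \<inter> b \<in> ?G" if ab: "a \<in> ?F" "b \<in> ?G" for a b
  proof -
    obtain B u where B: "b = B \<inter> {\<omega> \<in> space P. u < T \<omega>}" "0 \<le> u" "B \<in> sets (F u)"
      using ab(2) by blast
    have "a \<inter> B \<in> sets (F u)"
      using F0[OF ab(1) B(2)] B(3) by (rule sets.Int)
    moreover have "a \<inter> b = (a \<inter> B) \<inter> {\<omega> \<in> space P. u < T \<omega>}"
      using B(1) by auto
    ultimately show ?thesis using B(2) by blast
  qed
  consider "a \<in> ?F" "b \<in> ?F" | "a \<in> ?F" "b \<in> ?G" | "a \<in> ?G" "b \<in> ?F" | "a \<in> ?G" "b \<in> ?G"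
    using a b by blast
  then show "a \<inter> b \<in> ?F \<union> ?G"
  proof cases
    case 3
    then show ?thesis using FG[of b a] by (simp add: Int_commute)
  next
    case 4
    then obtain A u B v where A: "a = A \<inter> {\<omega> \<in> space P. u < T \<omega>}" "0 \<le> u" "A \<in> sets (F u)"
      and B: "b = B \<inter> {\<omega> \<in> space P. v < T \<omega>}" "0 \<le> v" "B \<in> sets (F v)"
      by blast
    have "A \<in> sets (F (max u v))" "B \<in> sets (F (max u v))"
      using A(3) B(3) sets_F_mono[of u "max u v"] sets_F_mono[of v "max u v"] by auto
    then have "A \<inter> B \<in> sets (F (max u v))"
      by (rule sets.Int)
    moreover have "a \<inter> b = (A \<inter> B) \<inter> {\<omega> \<in> space P. max u v < T \<omega>}"
      using A(1) B(1) by auto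
    moreover have "0 \<le> max u v" using A(2) by simp
    ultimately have "a \<inter> b \<in> ?G" by blast
    then show ?thesis by blast
  qed (use FG in auto)
qed

text \<open>Over \<open>A\<close>, the value at \<open>min T t\<close> and the limit of the values
  sampled along the announcing sequence both integrate to the same as \<open>L t\<close>. Their
  difference is the jump.\<close>

lemma martingale_jump_integral_announced:
  fixes S :: "nat \<Rightarrow> 'a \<Rightarrow> real"
  assumes Lc: "cadlag_adapted P F t L" and L: "martingale_on P F t L"
    and T: "nonneg_stopping_time P F T" and S: "\<And>n. nonneg_stopping_time P F (S n)"
    and SI: "\<And>\<omega>. \<omega> \<in> space P \<Longrightarrow> incseq (\<lambda>n. S n \<omega>)"
    and ST: "\<And>\<omega>. \<omega> \<in> space P \<Longrightarrow> (\<lambda>n. S n \<omega>) \<longlonglongrightarrow> T \<omega>"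
    and Sless: "\<And>\<omega> n. \<omega> \<in> space P \<Longrightarrow> 0 < T \<omega> \<Longrightarrow> S n \<omega> < T \<omega>"
    and t: "0 \<le> t"
  defines "J \<equiv> \<lambda>\<omega>. if T \<omega> \<le> t then jump (\<lambda>r. L r \<omega>) (T \<omega>) else 0"
  shows "integrable P J"
    and "A \<in> sets (pre_sigma (\<lambda>\<omega>. min (S n \<omega>) t)) \<Longrightarrow> (\<integral>\<omega>\<in>A. J \<omega> \<partial>P) = 0"
proof -
  define Sk where "Sk = (\<lambda>k \<omega>. min (S k \<omega>) t)"
  define Tt where "Tt = (\<lambda>\<omega>. min (T \<omega>) t)"
  \<comment> \<open>The limit of the sampled values: the left limit at \<open>T\<close> if
    \<open>0 < T \<le> t\<close>, the terminal value if \<open>t < T\<close>, and the initial value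
    if \<open>T = 0\<close>, where \<open>jump\<close> is 0 by convention.\<close>
  define Y where "Y = (\<lambda>\<omega>. L (Tt \<omega>) \<omega> - J \<omega>)"
  have NS: "nonneg_stopping_time P F (Sk k)" for k
    using S[of k] t by (auto simp: nonneg_stopping_time_def Sk_def intro: stopping_time_min stopping_time_const)
  have NT: "nonneg_stopping_time P F Tt"
    using T t by (auto simp: nonneg_stopping_time_def Tt_def intro: stopping_time_min stopping_time_const)
  have St: "stopping_time F (Sk k)" "stopping_time F Tt" for k
    using NS NT by (auto simp: nonneg_stopping_time_def)
  have Sle: "S k \<omega> \<le> T \<omega>" if "\<omega> \<in> space P" for k \<omega>
    using incseq_le[OF SI ST] that by blast
  have lim: "(\<lambda>k. L (Sk k \<omega>) \<omega>) \<longlonglongrightarrow> Y \<omega>" if \<omega>: "\<omega> \<in> space P" for \<omega>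
  proof -
    have T0: "0 \<le> T \<omega>" and S0: "\<And>k. 0 \<le> S k \<omega>"
      using T S \<omega> by (auto simp: nonneg_stopping_time_def)
    have cL: "cadlag_on t (\<lambda>r. L r \<omega>)"
      using Lc \<omega> by (auto simp: cadlag_adapted_def)
    consider "T \<omega> = 0" | "0 < T \<omega>" "T \<omega> \<le> t" | "t < T \<omega>" using T0 by linarith
    then show ?thesis
    proof cases
      case 1
      then have "S k \<omega> = 0" for k using Sle[OF \<omega>, of k] S0[of k] by linarith
      with 1 show ?thesis using t by (simp add: Sk_def Y_def Tt_def J_def jump_def)
    next
      case 2
      then have "(\<lambda>k. L (S k \<omega>) \<omega>) \<longlonglongrightarrow> L (T \<omega>) \<omega> - jump (\<lambda>r. L r \<omega>) (T \<omega>)"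
        using Sless[OF \<omega>] ST[OF \<omega>] by (intro cadlag_on_left_sequence[OF cL]) auto
      moreover have "Sk k \<omega> = S k \<omega>" for k
        using Sless[OF \<omega> 2(1), of k] 2 by (simp add: Sk_def)
      ultimately show ?thesis using 2 by (simp add: Y_def Tt_def J_def)
    next
      case 3
      then have "\<forall>\<^sub>F k in sequentially. t < S k \<omega>"
        by (intro order_tendstoD(1)[OF ST[OF \<omega>]])
      then have "\<forall>\<^sub>F k in sequentially. L (Sk k \<omega>) \<omega> = L t \<omega>"
        by eventually_elim (simp add: Sk_def)
      with 3 show ?thesis
        by (auto simp: Y_def Tt_def J_def intro: tendsto_eventually)
    qed
  qed
  have lek: "Sk k \<omega> \<le> t" for k \<omega> by (simp add: Sk_def)
  have leT: "Tt \<omega> \<le> t" for \<omega> by (simp add: Tt_def)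
  have m: "(\<lambda>\<omega>. L (Sk k \<omega>) \<omega>) \<in> borel_measurable (pre_sigma (Sk k))" for k
    by (rule stopped_measurable_pre_sigma[OF Lc NS lek t])
  have hyps: "integrable P (L t)" "\<And>k. subalgebra P (pre_sigma (Sk k))"
    "\<And>k. (\<lambda>\<omega>. L (Sk k \<omega>) \<omega>) \<in> borel_measurable (pre_sigma (Sk k))"
    "\<And>k. integrable P (\<lambda>\<omega>. L (Sk k \<omega>) \<omega>)"
    "\<And>k A. A \<in> sets (pre_sigma (Sk k)) \<Longrightarrow> (\<integral>\<omega>\<in>A. L (Sk k \<omega>) \<omega> \<partial>P) = (\<integral>\<omega>\<in>A. L t \<omega> \<partial>P)"
    "Y \<in> borel_measurable P"
    "AE \<omega> in P. (\<lambda>k. L (Sk k \<omega>) \<omega>) \<longlonglongrightarrow> Y \<omega>"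
  proof -
    show "integrable P (L t)" using L t by (auto simp: martingale_on_def)
    show sub: "subalgebra P (pre_sigma (Sk k))" for k by (rule subalgebra_pre_sigma[OF St(1)])
    show "(\<lambda>\<omega>. L (Sk k \<omega>) \<omega>) \<in> borel_measurable (pre_sigma (Sk k))" for k by (rule m)
    show "integrable P (\<lambda>\<omega>. L (Sk k \<omega>) \<omega>)" for k
      by (rule optional_sampling(1)[OF Lc L NS lek t])
    show "(\<integral>\<omega>\<in>A. L (Sk k \<omega>) \<omega> \<partial>P) = (\<integral>\<omega>\<in>A. L t \<omega> \<partial>P)" if "A \<in> sets (pre_sigma (Sk k))" for k A
      by (rule optional_sampling(2)[OF Lc L NS lek t that])
    show "Y \<in> borel_measurable P"
      by (rule borel_measurable_LIMSEQ_real[where u="\<lambda>k \<omega>. L (Sk k \<omega>) \<omega>"])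
        (use lim measurable_from_subalg[OF sub m] in auto)
    show "AE \<omega> in P. (\<lambda>k. L (Sk k \<omega>) \<omega>) \<longlonglongrightarrow> Y \<omega>"
      using lim by (rule AE_I2)
  qed
  have intY: "integrable P Y"
    by (rule cond_exp_L1_limit(1)[OF hyps])
  have intL: "integrable P (\<lambda>\<omega>. L (Tt \<omega>) \<omega>)"
    by (rule optional_sampling(1)[OF Lc L NT leT t])
  have J: "J = (\<lambda>\<omega>. L (Tt \<omega>) \<omega> - Y \<omega>)" by (simp add: Y_def)
  show "integrable P J"
    unfolding J by (intro Bochner_Integration.integrable_diff intL intY)
  assume "A \<in> sets (pre_sigma (\<lambda>\<omega>. min (S n \<omega>) t))"
  then have A: "A \<in> sets (pre_sigma (Sk n))" by (simp add: Sk_def)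
  have AP: "A \<in> sets P" using A hyps(2) by (auto simp: subalgebra_def)
  have mono: "k \<ge> n \<Longrightarrow> A \<in> sets (pre_sigma (Sk k))" for k
    using mono_pre_sigma[OF St(1) St(1), of n k] A incseqD[OF SI, of _ n k]
    by (auto simp: Sk_def min.coboundedI1)
  have "A \<in> sets (pre_sigma Tt)"
    using mono_pre_sigma[OF St, of n] A Sle by (auto simp: Sk_def Tt_def min.coboundedI1)
  then have "(\<integral>\<omega>\<in>A. L (Tt \<omega>) \<omega> \<partial>P) = (\<integral>\<omega>\<in>A. L t \<omega> \<partial>P)"
    by (rule optional_sampling(2)[OF Lc L NT leT t])
  moreover have "(\<integral>\<omega>\<in>A. Y \<omega> \<partial>P) = (\<integral>\<omega>\<in>A. L t \<omega> \<partial>P)"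
    by (rule cond_exp_limit_set_integral[OF hyps mono])
  ultimately show "(\<integral>\<omega>\<in>A. J \<omega> \<partial>P) = 0"
    unfolding J by (subst set_integral_diff) (simp_all add: integrable_imp_set_integrable intL intY AP)
qed

text \<open>The generators of the strict past either lie in the sigma-algebras of the announcing
  times or are limits of such events, and the events over which \<open>J\<close> integrates to 0
  form a Dynkin system.\<close>

lemma martingale_predictable_jump_integral:
  assumes Lc: "cadlag_adapted P F t L" and L: "martingale_on P F t L"
    and T: "predictable_time P F T" and t: "0 \<le> t"
  defines "J \<equiv> \<lambda>\<omega>. if T \<omega> \<le> t then jump (\<lambda>r. L r \<omega>) (T \<omega>) else 0"
  shows "integrable P J"
    and "A \<in> sets (strict_past P F T) \<Longrightarrow> (\<integral>\<omega>\<in>A. J \<omega> \<partial>P) = 0"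
proof -
  have NT: "nonneg_stopping_time P F T" using T by (simp add: predictable_time_def)
  then have STT: "stopping_time F T" by (simp add: nonneg_stopping_time_def)
  obtain S :: "nat \<Rightarrow> 'a \<Rightarrow> real" where S: "\<And>n. nonneg_stopping_time P F (S n)"
    and SI: "\<And>\<omega>. \<omega> \<in> space P \<Longrightarrow> incseq (\<lambda>n. S n \<omega>)"
    and ST: "\<And>\<omega>. \<omega> \<in> space P \<Longrightarrow> (\<lambda>n. S n \<omega>) \<longlonglongrightarrow> T \<omega>"
    and Sless: "\<And>\<omega> n. \<omega> \<in> space P \<Longrightarrow> 0 < T \<omega> \<Longrightarrow> S n \<omega> < T \<omega>"
    using T unfolding predictable_time_def by blast
  have STS: "stopping_time F (S n)" and S0: "\<And>\<omega>. \<omega> \<in> space P \<Longrightarrow> 0 \<le> S n \<omega>" for n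
    using S by (auto simp: nonneg_stopping_time_def)
  show int: "integrable P J"
    unfolding J_def by (rule martingale_jump_integral_announced(1)[OF Lc L NT S SI ST Sless t])
  have ann: "(\<integral>\<omega>\<in>A. J \<omega> \<partial>P) = 0" if "A \<in> sets (pre_sigma (\<lambda>\<omega>. min (S n \<omega>) t))" for A n
    unfolding J_def by (rule martingale_jump_integral_announced(2)[OF Lc L NT S SI ST Sless t that])
  have Sle: "S k \<omega> \<le> T \<omega>" if "\<omega> \<in> space P" for k \<omega>
    using incseq_le[OF SI ST] that by blast
  have STm: "stopping_time F (\<lambda>\<omega>. min (S n \<omega>) t)" for n
    by (intro stopping_time_min stopping_time_const STS)
  have F0: "B \<in> sets (pre_sigma (\<lambda>\<omega>. min (S n \<omega>) t))" if B: "B \<in> sets (F 0)" for B n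
  proof (rule sets_pre_sigmaI[OF STm])
    fix s
    have Bsp: "B \<subseteq> space P" using sets.sets_into_space[OF B] by (simp add: space_F)
    show "{\<omega> \<in> B. min (S n \<omega>) t \<le> s} \<in> sets (F s)"
    proof (cases "0 \<le> s")
      case True
      then have "B \<inter> {\<omega> \<in> space (F s). min (S n \<omega>) t \<le> s} \<in> sets (F s)"
        using B sets_F_mono[OF True] stopping_timeD[OF STm[of n], of s] by (auto simp: pred_def)
      also have "B \<inter> {\<omega> \<in> space (F s). min (S n \<omega>) t \<le> s} = {\<omega> \<in> B. min (S n \<omega>) t \<le> s}"
        using Bsp by (auto simp: space_F)
      finally show ?thesis .
    next
      case False
      then have "{\<omega> \<in> B. min (S n \<omega>) t \<le> s} = {}"
        using Bsp S0[of _ n] t by (force simp: min_le_iff_disj)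
      then show ?thesis by (simp only: sets.empty_sets)
    qed
  qed
  \<comment> \<open>\<open>B \<inter> {u < T}\<close> need not lie in the sigma-algebra of any
    announcing time, but it is the limit of the events \<open>B \<inter> {u < S n}\<close>, which do
    if \<open>u < t\<close>. For \<open>t \<le> u\<close> the function \<open>J\<close> vanishes on
    the whole event.\<close>
  have gen: "(\<integral>\<omega>\<in>B \<inter> {\<omega> \<in> space P. u < T \<omega>}. J \<omega> \<partial>P) = 0"
    if B: "B \<in> sets (F u)" and u: "0 \<le> u" for B u
  proof (cases "u < t")
    case False
    then have "J \<omega> = 0" if "u < T \<omega>" for \<omega>
      using that by (simp add: J_def)
    then have "(\<lambda>\<omega>. indicator (B \<inter> {\<omega> \<in> space P. u < T \<omega>}) \<omega> *\<^sub>R J \<omega>) = (\<lambda>_. 0)"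
      by (auto simp: indicator_def fun_eq_iff)
    then show ?thesis by (simp add: set_lebesgue_integral_def del: real_scaleR_def)
  next
    case True
    define A where "A n = B \<inter> {\<omega> \<in> space P. u < S n \<omega>}" for n
    have Bsp: "B \<subseteq> space P" using sets.sets_into_space[OF B] by (simp add: space_F)
    have AF: "A n \<in> sets (F u)" for n
      unfolding A_def using B stopping_time_gt_sets[OF STS] by auto
    have A: "A n \<in> sets (pre_sigma (\<lambda>\<omega>. min (S n \<omega>) t))" for n
    proof (rule sets_pre_sigmaI[OF STm])
      fix s
      show "{\<omega> \<in> A n. min (S n \<omega>) t \<le> s} \<in> sets (F s)"
      proof (cases "u \<le> s")
        case True
        then have "A n \<inter> {\<omega> \<in> space (F s). min (S n \<omega>) t \<le> s} \<in> sets (F s)"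
          using AF sets_F_mono[OF True] stopping_timeD[OF STm[of n], of s] by (auto simp: pred_def)
        also have "A n \<inter> {\<omega> \<in> space (F s). min (S n \<omega>) t \<le> s} = {\<omega> \<in> A n. min (S n \<omega>) t \<le> s}"
          using Bsp by (auto simp: space_F A_def)
        finally show ?thesis .
      next
        case False
        \<comment> \<open>On \<open>A n\<close> both \<open>S n\<close> and \<open>t\<close> exceed
          \<open>u\<close>, and \<open>u\<close> exceeds \<open>s\<close>.\<close>
        then have "{\<omega> \<in> A n. min (S n \<omega>) t \<le> s} = {}"
          using \<open>u < t\<close> by (auto simp: min_le_iff_disj A_def)
        then show ?thesis by (simp only: sets.empty_sets)
      qed
    qed
    have AP: "A n \<in> sets P" for n using AF sets_F_subset by blast
    have AP': "B \<inter> {\<omega> \<in> space P. u < T \<omega>} \<in> sets P"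
      using strict_past_generatorI[OF B u] strict_past_subset[OF STT] by blast
    have "(\<lambda>n. \<integral>\<omega>\<in>A n. J \<omega> \<partial>P) \<longlonglongrightarrow> (\<integral>\<omega>\<in>B \<inter> {\<omega> \<in> space P. u < T \<omega>}. J \<omega> \<partial>P)"
      unfolding set_lebesgue_integral_def
    proof (rule integral_dominated_convergence[where w="\<lambda>\<omega>. norm (J \<omega>)"])
      show "AE \<omega> in P. (\<lambda>n. indicator (A n) \<omega> *\<^sub>R J \<omega>) \<longlonglongrightarrow> indicator (B \<inter> {\<omega> \<in> space P. u < T \<omega>}) \<omega> *\<^sub>R J \<omega>"
      proof (rule AE_I2)
        fix \<omega> assume \<omega>: "\<omega> \<in> space P"
        have "\<forall>\<^sub>F n in sequentially. indicator (A n) \<omega> *\<^sub>R J \<omega> = indicator (B \<inter> {\<omega> \<in> space P. u < T \<omega>}) \<omega> *\<^sub>R J \<omega>"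
        proof (cases "u < T \<omega>")
          case True
          have "\<forall>\<^sub>F n in sequentially. u < S n \<omega>"
            by (rule order_tendstoD(1)[OF ST[OF \<omega>] True])
          then show ?thesis
            by eventually_elim (use True in \<open>auto simp: A_def indicator_def\<close>)
        next
          case False
          then have "\<not> u < S n \<omega>" for n using Sle[OF \<omega>, of n] by linarith
          then show ?thesis using False by (auto simp: A_def indicator_def)
        qed
        then show "(\<lambda>n. indicator (A n) \<omega> *\<^sub>R J \<omega>) \<longlonglongrightarrow> indicator (B \<inter> {\<omega> \<in> space P. u < T \<omega>}) \<omega> *\<^sub>R J \<omega>"
          by (rule tendsto_eventually)
      qed
      show "AE \<omega> in P. norm (indicator (A n) \<omega> *\<^sub>R J \<omega>) \<le> norm (J \<omega>)" for n
        by (auto simp: indicator_def)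
    qed (use int AP AP' in auto)
    moreover have "(\<integral>\<omega>\<in>A n. J \<omega> \<partial>P) = 0" for n by (rule ann[OF A])
    ultimately show ?thesis by (simp add: LIMSEQ_const_iff)
  qed
  assume "A \<in> sets (strict_past P F T)"
  then have "A \<in> sigma_sets (space P)
     (sets (F 0) \<union> {A \<inter> {\<omega> \<in> space P. u < T \<omega>} | A u. 0 \<le> u \<and> A \<in> sets (F u)})"
    by (simp only: sets_strict_past)
  from strict_past_generator_Int_stable strict_past_generator_subset this
  show "(\<integral>\<omega>\<in>A. J \<omega> \<partial>P) = 0"
  proof (induction rule: sigma_sets_induct_disjoint)
    case (basic A)
    then show ?case using gen ann[OF F0] by auto
  next
    case empty
    show ?case by (simp add: set_lebesgue_integral_def)
  next
    case (compl A)
    have AP: "A \<in> sets P"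
      using compl(1) strict_past_subset[OF STT] by (auto simp: sets_strict_past)
    have "space P \<in> sets (F 0)" using sets.top[of "F 0"] by (simp add: space_F)
    from ann[OF F0[OF this]] have "(\<integral>\<omega>\<in>space P. J \<omega> \<partial>P) = 0" .
    moreover have "(\<integral>\<omega>\<in>A \<union> (space P - A). J \<omega> \<partial>P) = (\<integral>\<omega>\<in>A. J \<omega> \<partial>P) + (\<integral>\<omega>\<in>space P - A. J \<omega> \<partial>P)"
      using AP int by (intro set_integral_Un) (auto intro!: integrable_imp_set_integrable)
    moreover have "A \<union> (space P - A) = space P"
      using sets.sets_into_space[OF AP] by auto
    ultimately show ?case using compl(2) by simp
  next
    case (union A)
    have AP: "A i \<in> sets P" for i
      using union(2) strict_past_subset[OF STT] by (auto simp: sets_strict_past)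
    have "(\<integral>\<omega>\<in>(\<Union>i. A i). J \<omega> \<partial>P) = (\<Sum>i. \<integral>\<omega>\<in>A i. J \<omega> \<partial>P)"
    proof (rule lebesgue_integral_countable_add)
      show "set_integrable P (\<Union>i. A i) J"
        using AP int by (auto intro!: integrable_imp_set_integrable)
      show "i \<noteq> j \<Longrightarrow> A i \<inter> A j = {}" for i j using union(1) by (auto simp: disjoint_family_on_def)
    qed (rule AP)
    then show ?case using union(3) by simp
  qed
qed

text \<open>The complement \<open>R < T\<close> is the union over rational \<open>q \<ge> 0\<close>
  of the events \<open>R \<le> q < T\<close>, which are generators. This makes localization by
  \<open>R\<close> compatible with conditioning on the strict past of \<open>T\<close>.\<close>

lemma strict_past_less_sets:
  assumes R: "nonneg_stopping_time P F R" and T: "nonneg_stopping_time P F T"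
  shows "{\<omega> \<in> space P. T \<omega> \<le> R \<omega>} \<in> sets (strict_past P F T)"
proof -
  have R0: "0 \<le> R \<omega>" if "\<omega> \<in> space P" for \<omega>
    using R that by (simp add: nonneg_stopping_time_def)
  have "{\<omega> \<in> space P. R \<omega> < T \<omega>}
      = (\<Union>q\<in>\<rat> \<inter> {0..}. {\<omega> \<in> space P. R \<omega> \<le> q} \<inter> {\<omega> \<in> space P. q < T \<omega>})" (is "_ = ?U")
  proof (intro set_eqI iffI)
    fix \<omega> assume "\<omega> \<in> {\<omega> \<in> space P. R \<omega> < T \<omega>}"
    then have \<omega>: "\<omega> \<in> space P" "R \<omega> < T \<omega>" by auto
    obtain q where "q \<in> \<rat>" "R \<omega> < q" "q < T \<omega>"
      using Rats_dense_in_real[OF \<omega>(2)] by blast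
    with \<omega> R0[OF \<omega>(1)] show "\<omega> \<in> ?U" by (intro UN_I[of q]) auto
  qed auto
  also have "\<dots> \<in> sets (strict_past P F T)"
  proof (rule sets.countable_UN'')
    show "countable (\<rat> \<inter> {0..} :: real set)" by (simp add: countable_rat)
    fix q :: real assume "q \<in> \<rat> \<inter> {0..}"
    moreover have "{\<omega> \<in> space P. R \<omega> \<le> q} \<in> sets (F q)"
      using R stopping_timeD[of F R q] by (simp add: nonneg_stopping_time_def pred_def space_F)
    ultimately show "{\<omega> \<in> space P. R \<omega> \<le> q} \<inter> {\<omega> \<in> space P. q < T \<omega>} \<in> sets (strict_past P F T)"
      by (intro strict_past_generatorI) auto
  qed
  finally have "space (strict_past P F T) - {\<omega> \<in> space P. R \<omega> < T \<omega>} \<in> sets (strict_past P F T)"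
    by (rule sets.compl_sets)
  also have "space (strict_past P F T) - {\<omega> \<in> space P. R \<omega> < T \<omega>} = {\<omega> \<in> space P. T \<omega> \<le> R \<omega>}"
    by (auto simp: space_strict_past)
  finally show ?thesis .
qed

section \<open>Jumps of local martingales at predictable times\<close>

lemma local_martingale_localized:
  assumes M: "cadlag_adapted P F t M" and T: "nonneg_stopping_time P F T"
    and L: "martingale_on P F t (\<lambda>s \<omega>. M (min s (T \<omega>)) \<omega> - M 0 \<omega>)"
  shows "cadlag_adapted P F t (\<lambda>s \<omega>. M (min s (T \<omega>)) \<omega> - M 0 \<omega>)"
  using M T L unfolding cadlag_adapted_def martingale_on_def nonneg_stopping_time_def
  by (auto intro: cadlag_on_stopped)

text \<open>The events \<open>A n\<close> belong to the strict past, and on them \<open>D\<close>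
  agrees almost surely with a difference of jumps of true martingales, so it integrates to 0. As
  \<open>D\<close> is positive there, each \<open>A n\<close> is null, and together they exhaust
  \<open>0 < D\<close> almost surely. \<open>D\<close> is kept apart from the jumps of
  \<open>M\<close> and \<open>M'\<close> because its measurability has another source.\<close>

lemma local_martingale_predictable_jump_nonpos:
  assumes M: "local_martingale_on P F t M" and M': "local_martingale_on P F t M'"
    and T: "predictable_time P F T" and t: "0 \<le> t"
    and D: "D \<in> borel_measurable (strict_past P F T)"
    and DM: "AE \<omega> in P. D \<omega> = (if T \<omega> \<le> t then jump (\<lambda>r. M r \<omega>) (T \<omega>) - jump (\<lambda>r. M' r \<omega>) (T \<omega>) else 0)"
  shows "AE \<omega> in P. D \<omega> \<le> 0"
proof -
  have NT: "nonneg_stopping_time P F T" using T by (simp add: predictable_time_def)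
  then have STT: "stopping_time F T" by (simp add: nonneg_stopping_time_def)
  have subT: "subalgebra P (strict_past P F T)"
    using strict_past_subset[OF STT] by (simp add: subalgebra_def space_strict_past)
  have [measurable]: "D \<in> borel_measurable P"
    by (rule measurable_from_subalg[OF subT D])
  obtain R :: "nat \<Rightarrow> 'a \<Rightarrow> real" where R: "\<And>n. nonneg_stopping_time P F (R n)"
      "\<And>\<omega>. \<omega> \<in> space P \<Longrightarrow> incseq (\<lambda>n. R n \<omega>)" "AE \<omega> in P. \<exists>n. t \<le> R n \<omega>"
      "\<And>n. martingale_on P F t (\<lambda>s \<omega>. M (min s (R n \<omega>)) \<omega> - M 0 \<omega>)"
    and Mc: "cadlag_adapted P F t M"
    using M unfolding local_martingale_on_def by blast
  obtain R' :: "nat \<Rightarrow> 'a \<Rightarrow> real" where R': "\<And>n. nonneg_stopping_time P F (R' n)"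
      "\<And>\<omega>. \<omega> \<in> space P \<Longrightarrow> incseq (\<lambda>n. R' n \<omega>)" "AE \<omega> in P. \<exists>n. t \<le> R' n \<omega>"
      "\<And>n. martingale_on P F t (\<lambda>s \<omega>. M' (min s (R' n \<omega>)) \<omega> - M' 0 \<omega>)"
    and Mc': "cadlag_adapted P F t M'"
    using M' unfolding local_martingale_on_def by blast
  define A where "A n = {\<omega> \<in> space P. 0 < D \<omega>} \<inter> {\<omega> \<in> space P. T \<omega> \<le> R n \<omega>} \<inter> {\<omega> \<in> space P. T \<omega> \<le> R' n \<omega>}" for n
  have null: "AE \<omega> in P. \<omega> \<notin> A n" for n
  proof -
    define J where "J = (\<lambda>\<omega>. if T \<omega> \<le> t then jump (\<lambda>s. M (min s (R n \<omega>)) \<omega> - M 0 \<omega>) (T \<omega>) else 0)"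
    define J' where "J' = (\<lambda>\<omega>. if T \<omega> \<le> t then jump (\<lambda>s. M' (min s (R' n \<omega>)) \<omega> - M' 0 \<omega>) (T \<omega>) else 0)"
    note mj = martingale_predictable_jump_integral[OF local_martingale_localized[OF Mc R(1) R(4)[of n]] R(4) T t, folded J_def]
    note mj' = martingale_predictable_jump_integral[OF local_martingale_localized[OF Mc' R'(1) R'(4)[of n]] R'(4) T t, folded J'_def]
    have "{\<omega> \<in> space (strict_past P F T). 0 < D \<omega>} \<in> sets (strict_past P F T)"
      using D by measurable
    then have A: "A n \<in> sets (strict_past P F T)"
      unfolding A_def using strict_past_less_sets[OF R(1) NT] strict_past_less_sets[OF R'(1) NT]
      by (intro sets.Int) (auto simp: space_strict_past)
    then have AP [measurable]: "A n \<in> sets P" using strict_past_subset[OF STT] by blast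
    have eq: "AE \<omega> in P. indicator (A n) \<omega> *\<^sub>R D \<omega> = indicator (A n) \<omega> *\<^sub>R (J \<omega> - J' \<omega>)"
      using DM
    proof (rule AE_mp, intro AE_I2 impI)
      fix \<omega> assume \<omega>: "\<omega> \<in> space P"
        and D: "D \<omega> = (if T \<omega> \<le> t then jump (\<lambda>r. M r \<omega>) (T \<omega>) - jump (\<lambda>r. M' r \<omega>) (T \<omega>) else 0)"
      have cad: "cadlag_on t (\<lambda>r. M r \<omega>)" "cadlag_on t (\<lambda>r. M' r \<omega>)"
        using Mc Mc' \<omega> by (auto simp: cadlag_adapted_def)
      have "D \<omega> = J \<omega> - J' \<omega>" if "\<omega> \<in> A n"
      proof (cases "T \<omega> \<le> t")
        case True
        then show ?thesis
          using that jump_stopped[OF cad(1) True, of "R n \<omega>"] jump_stopped[OF cad(2) True, of "R' n \<omega>"]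
          unfolding D J_def J'_def A_def by simp
      qed (simp add: D J_def J'_def)
      then show "indicator (A n) \<omega> *\<^sub>R D \<omega> = indicator (A n) \<omega> *\<^sub>R (J \<omega> - J' \<omega>)"
        by (auto simp: indicator_def)
    qed
    have JJ: "integrable P (\<lambda>\<omega>. indicator (A n) \<omega> *\<^sub>R (J \<omega> - J' \<omega>))"
      by (intro integrable_mult_indicator AP Bochner_Integration.integrable_diff mj(1) mj'(1))
    then have int: "integrable P (\<lambda>\<omega>. indicator (A n) \<omega> *\<^sub>R D \<omega>)"
      using eq by (subst integrable_cong_AE) auto
    have "(\<integral>\<omega>. indicator (A n) \<omega> *\<^sub>R D \<omega> \<partial>P) = (\<integral>\<omega>. indicator (A n) \<omega> *\<^sub>R (J \<omega> - J' \<omega>) \<partial>P)"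
      using eq int JJ by (intro integral_cong_AE) auto
    also have "\<dots> = (\<integral>\<omega>\<in>A n. J \<omega> - J' \<omega> \<partial>P)"
      by (simp add: set_lebesgue_integral_def)
    also have "\<dots> = (\<integral>\<omega>\<in>A n. J \<omega> \<partial>P) - (\<integral>\<omega>\<in>A n. J' \<omega> \<partial>P)"
      using mj(1) mj'(1) AP by (intro set_integral_diff)
        (auto intro!: integrable_imp_set_integrable)
    also have "\<dots> = 0" using mj(2)[OF A] mj'(2)[OF A] by simp
    finally have "AE \<omega> in P. indicator (A n) \<omega> *\<^sub>R D \<omega> = 0"
      by (subst (asm) integral_nonneg_eq_0_iff_AE[OF int]) (auto simp: A_def indicator_def)
    then show ?thesis by eventually_elim (auto simp: A_def indicator_def)
  qed
  have "AE \<omega> in P. \<forall>n. \<omega> \<notin> A n"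
    using null by (simp add: AE_all_countable)
  with DM R(3) R'(3) AE_space show ?thesis
  proof eventually_elim
    fix \<omega> assume D: "D \<omega> = (if T \<omega> \<le> t then jump (\<lambda>r. M r \<omega>) (T \<omega>) - jump (\<lambda>r. M' r \<omega>) (T \<omega>) else 0)"
      and ex: "\<exists>n. t \<le> R n \<omega>" "\<exists>n. t \<le> R' n \<omega>" and A: "\<forall>n. \<omega> \<notin> A n" and \<omega>: "\<omega> \<in> space P"
    show "D \<omega> \<le> 0"
    proof (rule ccontr)
      assume "\<not> D \<omega> \<le> 0"
      then have pos: "0 < D \<omega>" by simp
      with D have Tt: "T \<omega> \<le> t" by (auto split: if_splits)
      obtain n n' where "t \<le> R n \<omega>" "t \<le> R' n' \<omega>" using ex by blast
      moreover have "R n \<omega> \<le> R (max n n') \<omega>" "R' n' \<omega> \<le> R' (max n n') \<omega>"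
        using incseqD[OF R(2)[OF \<omega>]] incseqD[OF R'(2)[OF \<omega>]] by auto
      ultimately have "\<omega> \<in> A (max n n')"
        using pos Tt \<omega> by (auto simp: A_def)
      with A show False by blast
    qed
  qed
qed

text \<open>Exchanging \<open>M\<close> and \<open>M'\<close> turns \<open>D\<close> into
  \<open>- D\<close>, so the one-sided bound applies twice.\<close>

lemma local_martingale_predictable_jump_zero:
  assumes M: "local_martingale_on P F t M" and M': "local_martingale_on P F t M'"
    and T: "predictable_time P F T" and t: "0 \<le> t"
    and D: "D \<in> borel_measurable (strict_past P F T)"
    and DM: "AE \<omega> in P. D \<omega> = (if T \<omega> \<le> t then jump (\<lambda>r. M r \<omega>) (T \<omega>) - jump (\<lambda>r. M' r \<omega>) (T \<omega>) else 0)"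
  shows "AE \<omega> in P. D \<omega> = 0"
proof -
  have "AE \<omega> in P. D \<omega> \<le> 0"
    by (rule local_martingale_predictable_jump_nonpos[OF assms])
  moreover have "AE \<omega> in P. - D \<omega> \<le> 0"
  proof (rule local_martingale_predictable_jump_nonpos[OF M' M T t])
    show "AE \<omega> in P. - D \<omega> = (if T \<omega> \<le> t then jump (\<lambda>r. M' r \<omega>) (T \<omega>) - jump (\<lambda>r. M r \<omega>) (T \<omega>) else 0)"
      using DM by eventually_elim auto
  qed (use D in simp)
  ultimately show ?thesis by eventually_elim auto
qed

text \<open>Each predictable time brings a null set of its own. The sequences that carry the jumps
  of \<Gamma> and of \<Gamma>' reduce the uncountably many times to countably many null
  sets.\<close>

lemma decompositions_same_jumps:
  assumes d: "special_dirichlet_decomposition P F t m \<tau> X M \<Gamma>"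
    and d': "special_dirichlet_decomposition P F t m \<tau> X M' \<Gamma>'" and t: "0 \<le> t"
  shows "AE \<omega> in P. \<forall>s\<in>{0..t}. jump (\<lambda>r. \<Gamma> r \<omega>) s = jump (\<lambda>r. \<Gamma>' r \<omega>) s"
proof -
  note d = d[unfolded special_dirichlet_decomposition_def]
    and d' = d'[unfolded special_dirichlet_decomposition_def]
  have cad: "cadlag_on t (\<lambda>r. M r \<omega>)" "cadlag_on t (\<lambda>r. M' r \<omega>)"
    "cadlag_on t (\<lambda>r. \<Gamma> r \<omega>)" "cadlag_on t (\<lambda>r. \<Gamma>' r \<omega>)" if "\<omega> \<in> space P" for \<omega>
    using d d' that by (auto simp: local_martingale_on_def cadlag_adapted_def)
  have XX: "AE \<omega> in P. \<forall>s\<in>{0..t}. M s \<omega> + \<Gamma> s \<omega> = M' s \<omega> + \<Gamma>' s \<omega>"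
    using conjunct1[OF d] conjunct1[OF d'] by eventually_elim auto
  have same: "AE \<omega> in P. T \<omega> \<le> t \<longrightarrow> jump (\<lambda>r. \<Gamma> r \<omega>) (T \<omega>) = jump (\<lambda>r. \<Gamma>' r \<omega>) (T \<omega>)"
    if T: "predictable_time P F T" for T
  proof -
    \<comment> \<open>Almost surely the jump of \<open>M - M'\<close> at \<open>T\<close>, but
      written with \<Gamma> and \<Gamma>', whose jumps are measurable with respect to the strict
      past.\<close>
    define D where "D = (\<lambda>\<omega>. (if T \<omega> \<le> t then jump (\<lambda>r. \<Gamma>' r \<omega>) (T \<omega>) else 0)
        - (if T \<omega> \<le> t then jump (\<lambda>r. \<Gamma> r \<omega>) (T \<omega>) else 0))"
    have "AE \<omega> in P. D \<omega> = 0"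
    proof (rule local_martingale_predictable_jump_zero[OF _ _ T t])
      show "local_martingale_on P F t M" "local_martingale_on P F t M'" using d d' by auto
      show "D \<in> borel_measurable (strict_past P F T)"
        unfolding D_def using d d' T by (intro borel_measurable_diff) (auto simp: jumps_predictable_def)
      show "AE \<omega> in P. D \<omega> = (if T \<omega> \<le> t then jump (\<lambda>r. M r \<omega>) (T \<omega>) - jump (\<lambda>r. M' r \<omega>) (T \<omega>) else 0)"
        using XX AE_space
      proof eventually_elim
        fix \<omega> assume eq: "\<forall>s\<in>{0..t}. M s \<omega> + \<Gamma> s \<omega> = M' s \<omega> + \<Gamma>' s \<omega>" and \<omega>: "\<omega> \<in> space P"
        show "D \<omega> = (if T \<omega> \<le> t then jump (\<lambda>r. M r \<omega>) (T \<omega>) - jump (\<lambda>r. M' r \<omega>) (T \<omega>) else 0)"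
          using jump_diff_eq[OF cad(1,2,3,4)[OF \<omega>], of "T \<omega>"] eq by (auto simp: D_def)
      qed
    qed
    then show ?thesis by eventually_elim (auto simp: D_def)
  qed
  obtain S where S: "\<And>k::nat. predictable_time P F (S k)"
    "\<And>\<omega> s. \<omega> \<in> space P \<Longrightarrow> s \<in> {0..t} \<Longrightarrow> jump (\<lambda>r. \<Gamma> r \<omega>) s \<noteq> 0 \<Longrightarrow> \<exists>k. S k \<omega> = s"
    using d unfolding jumps_thin_predictable_def by blast
  obtain S' where S': "\<And>k::nat. predictable_time P F (S' k)"
    "\<And>\<omega> s. \<omega> \<in> space P \<Longrightarrow> s \<in> {0..t} \<Longrightarrow> jump (\<lambda>r. \<Gamma>' r \<omega>) s \<noteq> 0 \<Longrightarrow> \<exists>k. S' k \<omega> = s"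
    using d' unfolding jumps_thin_predictable_def by blast
  have "AE \<omega> in P. \<forall>k. S k \<omega> \<le> t \<longrightarrow> jump (\<lambda>r. \<Gamma> r \<omega>) (S k \<omega>) = jump (\<lambda>r. \<Gamma>' r \<omega>) (S k \<omega>)"
    "AE \<omega> in P. \<forall>k. S' k \<omega> \<le> t \<longrightarrow> jump (\<lambda>r. \<Gamma> r \<omega>) (S' k \<omega>) = jump (\<lambda>r. \<Gamma>' r \<omega>) (S' k \<omega>)"
    using same S(1) S'(1) by (auto simp: AE_all_countable)
  with AE_space show ?thesis
  proof eventually_elim
    fix \<omega> assume \<omega>: "\<omega> \<in> space P"
      and eq: "\<forall>k. S k \<omega> \<le> t \<longrightarrow> jump (\<lambda>r. \<Gamma> r \<omega>) (S k \<omega>) = jump (\<lambda>r. \<Gamma>' r \<omega>) (S k \<omega>)"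
        "\<forall>k. S' k \<omega> \<le> t \<longrightarrow> jump (\<lambda>r. \<Gamma> r \<omega>) (S' k \<omega>) = jump (\<lambda>r. \<Gamma>' r \<omega>) (S' k \<omega>)"
    show "\<forall>s\<in>{0..t}. jump (\<lambda>r. \<Gamma> r \<omega>) s = jump (\<lambda>r. \<Gamma>' r \<omega>) s"
    proof (rule ballI, rule ccontr)
      fix s assume s: "s \<in> {0..t}" and ne: "jump (\<lambda>r. \<Gamma> r \<omega>) s \<noteq> jump (\<lambda>r. \<Gamma>' r \<omega>) s"
      then have "jump (\<lambda>r. \<Gamma> r \<omega>) s \<noteq> 0 \<or> jump (\<lambda>r. \<Gamma>' r \<omega>) s \<noteq> 0" by auto
      then obtain k where "S k \<omega> = s \<or> S' k \<omega> = s"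
        using S(2)[OF \<omega> s] S'(2)[OF \<omega> s] by blast
      then show False using eq ne s by auto
    qed
  qed
qed

end

section \<open>Square sums along vanishing partitions\<close>

lemma partition_index_exists:
  fixes \<tau> :: "nat \<Rightarrow> real"
  assumes "\<tau> 0 = 0" "\<tau> m = t" "0 < u" "u \<le> t"
  shows "\<exists>i<m. \<tau> i < u \<and> u \<le> \<tau> (Suc i)"
proof -
  define j where "j = (LEAST j. u \<le> \<tau> j)"
  have ex: "u \<le> \<tau> m" using assms by simp
  have j: "u \<le> \<tau> j" "j \<le> m"
    unfolding j_def using ex by (auto intro: LeastI Least_le)
  have "j \<noteq> 0" using j(1) assms by (metis not_le)
  then obtain i where i: "j = Suc i" by (cases j) auto
  have "\<not> u \<le> \<tau> i"
    by (rule not_less_Least) (simp add: j_def[symmetric] i)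
  then show ?thesis using i j by (intro exI[of _ i]) auto
qed

lemma partition_mono:
  fixes \<tau> :: "nat \<Rightarrow> real"
  assumes "\<And>i. i < m \<Longrightarrow> \<tau> i \<le> \<tau> (Suc i)" "i \<le> j" "j \<le> m"
  shows "\<tau> i \<le> \<tau> j"
  using assms(2,3) by (induction j rule: dec_induct) (use assms(1) in \<open>auto intro: order_trans\<close>)

lemma partition_index_unique:
  fixes \<tau> :: "nat \<Rightarrow> real"
  assumes mono: "\<And>i. i < m \<Longrightarrow> \<tau> i \<le> \<tau> (Suc i)"
    and i: "i < m" "\<tau> i < u" "u \<le> \<tau> (Suc i)" and j: "j < m" "\<tau> j < u" "u \<le> \<tau> (Suc j)"
  shows "i = j"
proof (rule ccontr)
  assume "i \<noteq> j"
  then consider "Suc i \<le> j" | "Suc j \<le> i" by linarith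
  then show False
  proof cases
    case 1
    then show False using partition_mono[of m \<tau>, OF mono, of "Suc i" j] i j by auto
  next
    case 2
    then show False using partition_mono[of m \<tau>, OF mono, of "Suc j" i] i j by auto
  qed
qed

lemma sum_sq_diff_le:
  fixes a b :: "'i \<Rightarrow> real"
  shows "(\<Sum>i\<in>I. (b i - a i)\<^sup>2) \<le> 2 * (\<Sum>i\<in>I. (a i)\<^sup>2) + 2 * (\<Sum>i\<in>I. (b i)\<^sup>2)"
proof -
  have "(b i - a i)\<^sup>2 \<le> 2 * (a i)\<^sup>2 + 2 * (b i)\<^sup>2" for i
    using zero_le_power2[of "a i + b i"] by (simp add: power2_eq_square algebra_simps)
  then have "(\<Sum>i\<in>I. (b i - a i)\<^sup>2) \<le> (\<Sum>i\<in>I. 2 * (a i)\<^sup>2 + 2 * (b i)\<^sup>2)"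
    by (rule sum_mono)
  then show ?thesis by (simp add: sum.distrib sum_distrib_left)
qed

lemma infsum_finite_approx:
  fixes a :: "'i \<Rightarrow> real"
  assumes "a summable_on A" "0 < \<epsilon>"
  shows "\<exists>U. finite U \<and> U \<subseteq> A \<and> infsum a A - \<epsilon> < sum a U"
proof -
  have "(sum a \<longlongrightarrow> infsum a A) (finite_subsets_at_top A)"
    using has_sum_infsum[OF assms(1)] by (simp add: has_sum_def)
  then have "\<forall>\<^sub>F U in finite_subsets_at_top A. infsum a A - \<epsilon> < sum a U"
    by (rule order_tendstoD(1)) (use assms(2) in simp)
  then show ?thesis
    unfolding eventually_finite_subsets_at_top by blast
qed

text \<open>One outcome is held fixed: the \<open>\<tau> n i\<close> are its partition points, along
  a subsequence on which the mesh tends to 0. The comparison of square sums thereby becomes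
  deterministic.\<close>

locale vanishing_partitions =
  fixes t :: real and m :: "nat \<Rightarrow> nat" and \<tau> :: "nat \<Rightarrow> nat \<Rightarrow> real"
  assumes t: "0 < t"
    and start: "\<And>n. \<tau> n 0 = 0" and finish: "\<And>n. \<tau> n (m n) = t"
    and incr: "\<And>n i. i < m n \<Longrightarrow> \<tau> n i \<le> \<tau> n (Suc i)"
    and mesh: "(\<lambda>n. Max ((\<lambda>i. \<tau> n (Suc i) - \<tau> n i) ` {..<m n})) \<longlonglongrightarrow> 0"
begin

text \<open>The intervals are open on the left and closed on the right, so \<open>u\<close> is
  approached strictly from the left and weakly from the right. In the limit the increment over such
  an interval is exactly the jump at \<open>u\<close>.\<close>

definition idx :: "nat \<Rightarrow> real \<Rightarrow> nat" where
  "idx n u = (SOME i. i < m n \<and> \<tau> n i < u \<and> u \<le> \<tau> n (Suc i))"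

lemma idx: assumes "u \<in> {0<..t}"
  shows "idx n u < m n" "\<tau> n (idx n u) < u" "u \<le> \<tau> n (Suc (idx n u))"
  using someI_ex[OF partition_index_exists[of "\<tau> n", OF start finish], of u, folded idx_def] assms by auto

lemma idx_unique: "u \<in> {0<..t} \<Longrightarrow> i < m n \<Longrightarrow> \<tau> n i < u \<Longrightarrow> u \<le> \<tau> n (Suc i) \<Longrightarrow> i = idx n u"
  using idx[of u n] by (intro partition_index_unique[of "m n" "\<tau> n" i u "idx n u"] incr) auto

lemma in_range: "i \<le> m n \<Longrightarrow> \<tau> n i \<in> {0..t}"
  using partition_mono[of "m n" "\<tau> n", OF incr, of 0 i] partition_mono[of "m n" "\<tau> n", OF incr, of i "m n"] start finish
  by auto

lemma gap_le: "i < m n \<Longrightarrow> \<tau> n (Suc i) - \<tau> n i \<le> Max ((\<lambda>i. \<tau> n (Suc i) - \<tau> n i) ` {..<m n})"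
  by (intro Max_ge) auto

lemma idx_tendsto:
  assumes u: "u \<in> {0<..t}"
  shows "(\<lambda>n. \<tau> n (idx n u)) \<longlonglongrightarrow> u" "(\<lambda>n. \<tau> n (Suc (idx n u))) \<longlonglongrightarrow> u"
proof -
  let ?M = "\<lambda>n. Max ((\<lambda>i. \<tau> n (Suc i) - \<tau> n i) ` {..<m n})"
  have "(\<lambda>n. u - ?M n) \<longlonglongrightarrow> u - 0" "(\<lambda>n. u + ?M n) \<longlonglongrightarrow> u + 0"
    by (intro tendsto_intros mesh)+
  then have M: "(\<lambda>n. u - ?M n) \<longlonglongrightarrow> u" "(\<lambda>n. u + ?M n) \<longlonglongrightarrow> u" by simp_all
  have b: "u - ?M n \<le> \<tau> n (idx n u)" "\<tau> n (idx n u) \<le> u"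
    "u \<le> \<tau> n (Suc (idx n u))" "\<tau> n (Suc (idx n u)) \<le> u + ?M n" for n
    using idx[OF u, of n] gap_le[OF idx(1)[OF u], of n] by linarith+
  show "(\<lambda>n. \<tau> n (idx n u)) \<longlonglongrightarrow> u"
    by (rule tendsto_sandwich[OF always_eventually always_eventually M(1) tendsto_const]) (use b in auto)
  show "(\<lambda>n. \<tau> n (Suc (idx n u))) \<longlonglongrightarrow> u"
    by (rule tendsto_sandwich[OF always_eventually always_eventually tendsto_const M(2)]) (use b in auto)
qed

lemma left_value_tendsto:
  assumes "cadlag_on t f" "u \<in> {0<..t}"
  shows "(\<lambda>n. f (\<tau> n (idx n u))) \<longlonglongrightarrow> f u - jump f u"
  using assms idx[OF assms(2)] idx_tendsto[OF assms(2)]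
  by (intro cadlag_on_left_sequence[OF assms(1)]) auto

lemma right_value_tendsto:
  assumes "cadlag_on t f" "u \<in> {0<..t}"
  shows "(\<lambda>n. f (\<tau> n (Suc (idx n u)))) \<longlonglongrightarrow> f u"
  using assms idx[OF assms(2)] idx_tendsto[OF assms(2)] in_range[of "Suc (idx _ u)"]
  by (intro cadlag_on_right_sequence[OF assms(1)]) (auto simp: Suc_le_eq)

lemma increment_tendsto:
  assumes "cadlag_on t f" "u \<in> {0<..t}"
  shows "(\<lambda>n. f (\<tau> n (Suc (idx n u))) - f (\<tau> n (idx n u))) \<longlonglongrightarrow> jump f u"
  using tendsto_diff[OF right_value_tendsto[OF assms] left_value_tendsto[OF assms]] by simp

text \<open>Two points in the same interval force the mesh to be at least their distance, and only
  finitely many positive distances occur in \<open>U\<close>.\<close>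

lemma idx_inj_on_eventually:
  assumes U: "finite U" "U \<subseteq> {0<..t}"
  shows "\<forall>\<^sub>F n in sequentially. inj_on (idx n) U"
proof -
  let ?M = "\<lambda>n. Max ((\<lambda>i. \<tau> n (Suc i) - \<tau> n i) ` {..<m n})"
  have "\<forall>\<^sub>F n in sequentially. u < v \<longrightarrow> ?M n < v - u" for u v
    by (cases "u < v") (auto intro: order_tendstoD(2)[OF mesh])
  then have "\<forall>\<^sub>F n in sequentially. \<forall>u\<in>U. \<forall>v\<in>U. u < v \<longrightarrow> ?M n < v - u"
    using U(1) by (intro eventually_ball_finite ballI) auto
  then show ?thesis
  proof eventually_elim
    fix n assume M: "\<forall>u\<in>U. \<forall>v\<in>U. u < v \<longrightarrow> ?M n < v - u"
    have no: "\<not> (u < v \<and> idx n u = idx n v)" if "u \<in> U" "v \<in> U" for u v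
    proof
      assume uv: "u < v \<and> idx n u = idx n v"
      have u: "u \<in> {0<..t}" and v: "v \<in> {0<..t}" using that U(2) by auto
      have "?M n \<ge> v - u"
        using idx(2)[OF u, of n] idx(3)[OF v, of n, folded conjunct2[OF uv]] gap_le[OF idx(1)[OF u], of n] by linarith
      moreover have "?M n < v - u" using M that uv by blast
      ultimately show False by simp
    qed
    show "inj_on (idx n) U"
      using no by (intro inj_onI) (metis linorder_neqE)
  qed
qed

text \<open>On the intervals around the finitely many large jumps the increments of \<open>g - f\<close> vanish in the
  limit, since \<open>f\<close> and \<open>g\<close> have the same jumps. On the remaining intervals the squared increments of
  \<open>f\<close> and of \<open>g\<close> only account for the small jumps.\<close>

lemma square_sum_diff_tendsto_0:
  assumes f: "cadlag_on t f" and g: "cadlag_on t g"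
    and jumps: "\<And>s. s \<in> {0<..t} \<Longrightarrow> jump f s = jump g s"
    and summ: "(\<lambda>u. (jump f u)\<^sup>2) summable_on {0<..t}"
    and qf: "(\<lambda>n. \<Sum>i<m n. (f (\<tau> n (Suc i)) - f (\<tau> n i))\<^sup>2) \<longlonglongrightarrow> (\<Sum>\<^sub>\<infinity>u\<in>{0<..t}. (jump f u)\<^sup>2)"
    and qg: "(\<lambda>n. \<Sum>i<m n. (g (\<tau> n (Suc i)) - g (\<tau> n i))\<^sup>2) \<longlonglongrightarrow> (\<Sum>\<^sub>\<infinity>u\<in>{0<..t}. (jump g u)\<^sup>2)"
  defines "h \<equiv> \<lambda>s. g s - f s"
  shows "(\<lambda>n. \<Sum>i<m n. (h (\<tau> n (Suc i)) - h (\<tau> n i))\<^sup>2) \<longlonglongrightarrow> 0"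
proof -
  define \<delta> where "\<delta> = (\<lambda>(f :: real \<Rightarrow> real) n i. f (\<tau> n (Suc i)) - f (\<tau> n i))"
  define Q where "Q = (\<Sum>\<^sub>\<infinity>u\<in>{0<..t}. (jump f u)\<^sup>2)"
  have qg': "(\<lambda>n. \<Sum>i<m n. (\<delta> g n i)\<^sup>2) \<longlonglongrightarrow> Q"
  proof -
    have "(\<Sum>\<^sub>\<infinity>u\<in>{0<..t}. (jump g u)\<^sup>2) = Q"
      unfolding Q_def by (rule infsum_cong) (simp add: jumps)
    with qg show ?thesis by (simp add: \<delta>_def)
  qed
  have qf': "(\<lambda>n. \<Sum>i<m n. (\<delta> f n i)\<^sup>2) \<longlonglongrightarrow> Q"
    using qf unfolding Q_def \<delta>_def by simp
  have "(\<lambda>n. \<Sum>i<m n. (\<delta> h n i)\<^sup>2) \<longlonglongrightarrow> 0"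
  proof (rule order_tendstoI)
    fix a :: real assume "a < 0"
    then show "\<forall>\<^sub>F n in sequentially. a < (\<Sum>i<m n. (\<delta> h n i)\<^sup>2)"
      by (intro always_eventually allI order.strict_trans2[OF _ sum_nonneg]) auto
  next
    fix \<epsilon> :: real assume \<epsilon>: "0 < \<epsilon>"
    \<comment> \<open>\<open>U\<close> carries all but \<open>\<epsilon>/4\<close> of the squared
      jumps. The 4 is the factor in the limit \<open>4 * (Q - q)\<close> of
      \<open>B\<close>.\<close>
    then obtain U where U: "finite U" "U \<subseteq> {0<..t}" "Q - \<epsilon>/4 < (\<Sum>u\<in>U. (jump f u)\<^sup>2)"
      using infsum_finite_approx[OF summ, of "\<epsilon>/4"] unfolding Q_def by auto
    define q where "q = (\<Sum>u\<in>U. (jump f u)\<^sup>2)"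
    \<comment> \<open>\<open>B n\<close> bounds the square sum of \<open>h\<close> as soon as the
      points of \<open>U\<close> lie in different intervals, and all its terms converge. The factors
      2 come from \<open>sum_sq_diff_le\<close> on the other intervals.\<close>
    define B where "B n = (\<Sum>u\<in>U. (\<delta> h n (idx n u))\<^sup>2)
      + 2 * ((\<Sum>i<m n. (\<delta> f n i)\<^sup>2) - (\<Sum>u\<in>U. (\<delta> f n (idx n u))\<^sup>2))
      + 2 * ((\<Sum>i<m n. (\<delta> g n i)\<^sup>2) - (\<Sum>u\<in>U. (\<delta> g n (idx n u))\<^sup>2))" for n
    have df: "(\<lambda>n. \<delta> f n (idx n u)) \<longlonglongrightarrow> jump f u" if "u \<in> U" for u
      unfolding \<delta>_def using U(2) that by (intro increment_tendsto f) auto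
    have dg: "(\<lambda>n. \<delta> g n (idx n u)) \<longlonglongrightarrow> jump f u" if "u \<in> U" for u
      using increment_tendsto[OF g, of u] U(2) that jumps[of u] by (auto simp: \<delta>_def)
    have dh: "(\<lambda>n. \<delta> h n (idx n u)) \<longlonglongrightarrow> 0" if "u \<in> U" for u
      using tendsto_diff[OF dg[OF that] df[OF that]] by (simp add: \<delta>_def h_def algebra_simps)
    have "B \<longlonglongrightarrow> (\<Sum>u\<in>U. 0\<^sup>2) + 2 * (Q - q) + 2 * (Q - q)"
      unfolding B_def q_def by (intro tendsto_intros df dg dh qf' qg')
    then have "\<forall>\<^sub>F n in sequentially. B n < \<epsilon>"
      by (rule order_tendstoD(2)) (use U(3) in \<open>simp add: q_def\<close>)
    then show "\<forall>\<^sub>F n in sequentially. (\<Sum>i<m n. (\<delta> h n i)\<^sup>2) < \<epsilon>"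
      using idx_inj_on_eventually[OF U(1,2)]
    proof eventually_elim
      fix n assume Bn: "B n < \<epsilon>" and inj: "inj_on (idx n) U"
      define I where "I = idx n ` U"
      have I: "I \<subseteq> {..<m n}" using idx(1) U(2) by (auto simp: I_def)
      have split: "(\<Sum>i<m n. (\<delta> k n i)\<^sup>2) = (\<Sum>i\<in>{..<m n} - I. (\<delta> k n i)\<^sup>2) + (\<Sum>u\<in>U. (\<delta> k n (idx n u))\<^sup>2)" for k
      proof -
        have "(\<Sum>i\<in>I. (\<delta> k n i)\<^sup>2) = (\<Sum>u\<in>U. (\<delta> k n (idx n u))\<^sup>2)"
          unfolding I_def by (simp add: sum.reindex[OF inj])
        then show ?thesis using sum.subset_diff[OF I, of "\<lambda>i. (\<delta> k n i)\<^sup>2"] by simp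
      qed
      have "\<delta> h n i = \<delta> g n i - \<delta> f n i" for i by (simp add: \<delta>_def h_def)
      then have "(\<Sum>i\<in>{..<m n} - I. (\<delta> h n i)\<^sup>2)
          \<le> 2 * (\<Sum>i\<in>{..<m n} - I. (\<delta> f n i)\<^sup>2) + 2 * (\<Sum>i\<in>{..<m n} - I. (\<delta> g n i)\<^sup>2)"
        using sum_sq_diff_le[of "\<lambda>i. \<delta> g n i" "\<lambda>i. \<delta> f n i"] by simp
      then have "(\<Sum>i<m n. (\<delta> h n i)\<^sup>2) \<le> B n"
        unfolding split[of h] B_def split[of f] split[of g] by simp
      with Bn show "(\<Sum>i<m n. (\<delta> h n i)\<^sup>2) < \<epsilon>" by simp
    qed
  qed
  then show ?thesis by (simp add: \<delta>_def)
qed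

text \<open>Stopping at \<open>r\<close> keeps the increments to the left of \<open>r\<close> and
  annihilates those to the right. The interval around \<open>r\<close> leaves the increment
  \<open>h r - h (\<tau> n (idx n r))\<close>, which tends to 0 because \<open>h\<close> has no jump
  at \<open>r\<close>.\<close>

lemma stopped_square_sum_tendsto_0:
  assumes h: "cadlag_on t h" and jump: "\<And>s. s \<in> {0<..t} \<Longrightarrow> jump h s = 0"
    and q: "(\<lambda>n. \<Sum>i<m n. (h (\<tau> n (Suc i)) - h (\<tau> n i))\<^sup>2) \<longlonglongrightarrow> 0" and r: "r \<in> {0..t}"
  shows "(\<lambda>n. \<Sum>i<m n. (h (min (\<tau> n (Suc i)) r) - h (min (\<tau> n i) r))\<^sup>2) \<longlonglongrightarrow> 0"
proof (cases "r = 0")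
  case True
  have "(\<Sum>i<m n. (h (min (\<tau> n (Suc i)) r) - h (min (\<tau> n i) r))\<^sup>2) = 0" for n
    using in_range[of _ n] True by (intro sum.neutral ballI) (force simp: min_absorb2)
  then show ?thesis by simp
next
  case False
  then have r': "r \<in> {0<..t}" using r by auto
  have "(\<lambda>n. h (\<tau> n (idx n r))) \<longlonglongrightarrow> h r"
    using left_value_tendsto[OF h r'] jump[OF r'] by simp
  then have "(\<lambda>n. (\<Sum>i<m n. (h (\<tau> n (Suc i)) - h (\<tau> n i))\<^sup>2) + (h r - h (\<tau> n (idx n r)))\<^sup>2) \<longlonglongrightarrow> 0 + (h r - h r)\<^sup>2"
    by (intro tendsto_intros q)
  then have lim: "(\<lambda>n. (\<Sum>i<m n. (h (\<tau> n (Suc i)) - h (\<tau> n i))\<^sup>2) + (h r - h (\<tau> n (idx n r)))\<^sup>2) \<longlonglongrightarrow> 0"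
    by simp
  show ?thesis
  proof (rule tendsto_sandwich[OF always_eventually always_eventually tendsto_const lim])
    show "\<forall>n. (\<Sum>i<m n. (h (min (\<tau> n (Suc i)) r) - h (min (\<tau> n i) r))\<^sup>2)
        \<le> (\<Sum>i<m n. (h (\<tau> n (Suc i)) - h (\<tau> n i))\<^sup>2) + (h r - h (\<tau> n (idx n r)))\<^sup>2"
    proof
      fix n
      have "(h (min (\<tau> n (Suc i)) r) - h (min (\<tau> n i) r))\<^sup>2
          \<le> (h (\<tau> n (Suc i)) - h (\<tau> n i))\<^sup>2 + (if i = idx n r then (h r - h (\<tau> n (idx n r)))\<^sup>2 else 0)"
        if i: "i < m n" for i
      proof -
        consider "\<tau> n (Suc i) \<le> r" | "r \<le> \<tau> n i" | "\<tau> n i < r" "r < \<tau> n (Suc i)" by linarith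
        then show ?thesis
        proof cases
          case 1
          then show ?thesis using incr[OF i] by (simp add: min_absorb1)
        next
          case 2
          then show ?thesis using incr[OF i] by (simp add: min_absorb2)
        next
          case 3
          then have "i = idx n r" using i r' by (intro idx_unique) auto
          with 3 show ?thesis by (simp add: min_absorb1 min_absorb2)
        qed
      qed
      then have "(\<Sum>i<m n. (h (min (\<tau> n (Suc i)) r) - h (min (\<tau> n i) r))\<^sup>2)
          \<le> (\<Sum>i<m n. (h (\<tau> n (Suc i)) - h (\<tau> n i))\<^sup>2 + (if i = idx n r then (h r - h (\<tau> n (idx n r)))\<^sup>2 else 0))"
        by (intro sum_mono) auto
      also have "\<dots> = (\<Sum>i<m n. (h (\<tau> n (Suc i)) - h (\<tau> n i))\<^sup>2) + (h r - h (\<tau> n (idx n r)))\<^sup>2"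
        using idx(1)[OF r', of n] by (simp add: sum.distrib)
      finally show "(\<Sum>i<m n. (h (min (\<tau> n (Suc i)) r) - h (min (\<tau> n i) r))\<^sup>2)
        \<le> (\<Sum>i<m n. (h (\<tau> n (Suc i)) - h (\<tau> n i))\<^sup>2) + (h r - h (\<tau> n (idx n r)))\<^sup>2" .
    qed
  qed (auto intro: sum_nonneg)
qed

end

section \<open>Differences of cadlag paths and paths without jumps\<close>

lemma cadlag_on_diff:
  assumes f: "cadlag_on t f" and g: "cadlag_on t g"
  shows "cadlag_on t (\<lambda>s. g s - f s)"
  unfolding cadlag_on_def
proof (intro conjI ballI)
  show "((\<lambda>s. g s - f s) \<longlongrightarrow> g s - f s) (at_right s)" if "s \<in> {0..<t}" for s
    using f g that by (intro tendsto_diff) (auto simp: cadlag_on_def)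
  show "\<exists>l. ((\<lambda>s. g s - f s) \<longlongrightarrow> l) (at_left s)" if "s \<in> {0<..t}" for s
    using cadlag_on_left_limit[OF f, of s] cadlag_on_left_limit[OF g, of s] that
    by (auto intro!: exI tendsto_diff)
qed

lemma jump_diff:
  assumes f: "cadlag_on t f" and g: "cadlag_on t g" and s: "s \<in> {0<..t}"
  shows "jump (\<lambda>s. g s - f s) s = jump g s - jump f s"
proof -
  have "((\<lambda>s. g s - f s) \<longlongrightarrow> (g s - jump g s) - (f s - jump f s)) (at_left s)"
    using cadlag_on_left_limit[OF f, of s] cadlag_on_left_limit[OF g, of s] s
    by (intro tendsto_diff) auto
  from jump_eqI[OF _ this] s show ?thesis by simp
qed

lemma cadlag_on_continuous:
  assumes h: "cadlag_on t h" and jump: "\<And>s. s \<in> {0<..t} \<Longrightarrow> jump h s = 0" and t: "0 < t"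
  shows "continuous_on {0..t} h"
proof (rule continuous_on_IccI[OF _ _ _ t])
  have left: "(h \<longlongrightarrow> h s) (at_left s)" if "s \<in> {0<..t}" for s
    using cadlag_on_left_limit[OF h, of s] jump[OF that] that by simp
  have right: "(h \<longlongrightarrow> h s) (at_right s)" if "s \<in> {0..<t}" for s
    using h that by (simp add: cadlag_on_def)
  show "(h \<longlongrightarrow> h 0) (at_right 0)" "(h \<longlongrightarrow> h t) (at_left t)"
    using left right t by auto
  show "h \<midarrow>s\<rightarrow> h s" if "0 < s" "s < t" for s
    using left[of s] right[of s] that by (simp add: filterlim_at_split)
qed

section \<open>Bounded martingales with small quadratic variation\<close>

text \<open>The weight \<open>Z k\<close> in the proof stops the martingale once its square sum has reached \<open>\<epsilon>\<close>. The step
  that crosses \<open>\<epsilon>\<close> contributes at most \<open>4 * K\<^sup>2\<close>, and the unstopped end value at most \<open>K\<^sup>2\<close>.\<close>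

lemma (in prob_space) bounded_martingale_square_le:
  fixes Y :: "nat \<Rightarrow> 'a \<Rightarrow> real" and G :: "nat \<Rightarrow> 'a measure"
  assumes sub: "\<And>i. i \<le> m \<Longrightarrow> subalgebra M (G i)"
    and mono: "\<And>i j. i \<le> j \<Longrightarrow> j \<le> m \<Longrightarrow> sets (G i) \<subseteq> sets (G j)"
    and meas: "\<And>i. i \<le> m \<Longrightarrow> Y i \<in> borel_measurable (G i)"
    and bound: "\<And>i \<omega>. i \<le> m \<Longrightarrow> \<omega> \<in> space M \<Longrightarrow> \<bar>Y i \<omega>\<bar> \<le> K"
    and mart: "\<And>i A. i < m \<Longrightarrow> A \<in> sets (G i) \<Longrightarrow> (\<integral>\<omega>\<in>A. Y (Suc i) \<omega> \<partial>M) = (\<integral>\<omega>\<in>A. Y i \<omega> \<partial>M)"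
    and start: "AE \<omega> in M. Y 0 \<omega> = 0" and eps: "0 < \<epsilon>"
  shows "(\<integral>\<omega>. (Y m \<omega>)\<^sup>2 \<partial>M)
    \<le> \<epsilon> + 5 * K\<^sup>2 * prob {\<omega> \<in> space M. \<epsilon> \<le> (\<Sum>i<m. (Y (Suc i) \<omega> - Y i \<omega>)\<^sup>2)}"
proof -
  define S where "S k \<omega> = (\<Sum>i<k. (Y (Suc i) \<omega> - Y i \<omega>)\<^sup>2)" for k \<omega>
  define Z :: "nat \<Rightarrow> 'a \<Rightarrow> real" where "Z k \<omega> = (if S k \<omega> < \<epsilon> then 1 else 0)" for k \<omega>
  have measG: "Y i \<in> borel_measurable (G j)" if "i \<le> j" "j \<le> m" for i j
    using that meas[of i] mono[OF that] sub[of i] sub[of j]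
    by (intro measurable_from_subalg[of "G j" "G i"]) (auto simp: subalgebra_def)
  have SG: "S k \<in> borel_measurable (G k)" if "k \<le> m" for k
    unfolding S_def using that by (intro borel_measurable_sum borel_measurable_power borel_measurable_diff measG) auto
  \<comment> \<open>\<open>S k\<close> only involves \<open>Y 0\<close>, ..., \<open>Y k\<close>, so
    \<open>Z k\<close> is known before the step from \<open>k\<close> to \<open>Suc k\<close> that
    it weights: the weighted sums are discrete stochastic integrals.\<close>
  then have ZG: "Z k \<in> borel_measurable (G k)" if "k \<le> m" for k
    using that unfolding Z_def by (intro measurable_If) (auto simp: measurable_const)
  have measM: "Y k \<in> borel_measurable M" "S k \<in> borel_measurable M" "Z k \<in> borel_measurable M" if "k \<le> m" for k
    using that measurable_from_subalg[OF sub] SG ZG meas by blast+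
  have K: "0 \<le> K"
    using bound[of 0] not_empty by fastforce
  have sq: "(Y i \<omega>)\<^sup>2 \<le> K\<^sup>2" if "i \<le> m" "\<omega> \<in> space M" for i \<omega>
    using bound[OF that] K by (simp add: abs_le_square_iff[symmetric])
  have dsq: "(Y (Suc i) \<omega> - Y i \<omega>)\<^sup>2 \<le> 4 * K\<^sup>2" if "i < m" "\<omega> \<in> space M" for i \<omega>
  proof -
    have "\<bar>Y (Suc i) \<omega> - Y i \<omega>\<bar> \<le> \<bar>2 * K\<bar>"
      using bound[of "Suc i" \<omega>] bound[of i \<omega>] that K by (simp add: abs_le_iff)
    then have "(Y (Suc i) \<omega> - Y i \<omega>)\<^sup>2 \<le> (2 * K)\<^sup>2"
      by (simp only: abs_le_square_iff)
    then show ?thesis by (simp add: power_mult_distrib)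
  qed
  have intY: "integrable M (Y i)" if "i \<le> m" for i
    using that bound measM by (intro integrable_const_bound[where B=K]) auto
  have intZ: "integrable M (\<lambda>\<omega>. Z i \<omega> * (Y j \<omega> * Y k \<omega>))" if "i \<le> m" "j \<le> m" "k \<le> m" for i j k
  proof (rule integrable_const_bound[where B="K * K"])
    show "AE \<omega> in M. norm (Z i \<omega> * (Y j \<omega> * Y k \<omega>)) \<le> K * K"
      using bound that K by (intro AE_I2) (auto simp: Z_def abs_mult intro!: mult_mono)
  qed (use measM that in \<open>auto intro!: borel_measurable_times\<close>)
  \<comment> \<open>\<open>Z i * Y i\<close> is \<open>G i\<close>-measurable, so
    \<open>Y (Suc i)\<close> may be replaced by its conditional expectation \<open>Y i\<close>.
    Hence the weighted squared increment and the weighted increment of the square have the same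
    expectation.\<close>
  have orth: "(\<integral>\<omega>. Z i \<omega> * (Y i \<omega> * Y (Suc i) \<omega>) \<partial>M) = (\<integral>\<omega>. Z i \<omega> * (Y i \<omega> * Y i \<omega>) \<partial>M)" if i: "i < m" for i
  proof -
    interpret finite_measure_subalgebra M "G i"
      using sub[of i] i by unfold_locales auto
    have [measurable]: "Y i \<in> borel_measurable M" "Y (Suc i) \<in> borel_measurable M" "Z i \<in> borel_measurable M"
      using measM i by auto
    have ce: "AE \<omega> in M. real_cond_exp M (G i) (Y (Suc i)) \<omega> = Y i \<omega>"
      by (rule real_cond_exp_charact) (use mart i intY meas in auto)
    have "(\<integral>\<omega>. (Z i \<omega> * Y i \<omega>) * real_cond_exp M (G i) (Y (Suc i)) \<omega> \<partial>M) = (\<integral>\<omega>. (Z i \<omega> * Y i \<omega>) * Y (Suc i) \<omega> \<partial>M)"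
      using intZ[of i i "Suc i"] i ZG[of i] meas[of i]
      by (intro real_cond_exp_intg(2)) (auto simp: mult.assoc)
    moreover have "(\<integral>\<omega>. (Z i \<omega> * Y i \<omega>) * real_cond_exp M (G i) (Y (Suc i)) \<omega> \<partial>M) = (\<integral>\<omega>. (Z i \<omega> * Y i \<omega>) * Y i \<omega> \<partial>M)"
      using ce by (intro integral_cong_AE) auto
    ultimately show ?thesis by (simp add: mult.assoc)
  qed
  have intsq: "integrable M (\<lambda>\<omega>. Z i \<omega> * ((Y (Suc i) \<omega>)\<^sup>2 - (Y i \<omega>)\<^sup>2))"
    and intd: "integrable M (\<lambda>\<omega>. Z i \<omega> * (Y (Suc i) \<omega> - Y i \<omega>)\<^sup>2)"
    and step: "(\<integral>\<omega>. Z i \<omega> * ((Y (Suc i) \<omega>)\<^sup>2 - (Y i \<omega>)\<^sup>2) \<partial>M) = (\<integral>\<omega>. Z i \<omega> * (Y (Suc i) \<omega> - Y i \<omega>)\<^sup>2 \<partial>M)"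
    if i: "i < m" for i
  proof -
    have int: "integrable M (\<lambda>\<omega>. Z i \<omega> * (Y (Suc i) \<omega> * Y (Suc i) \<omega>))"
      "integrable M (\<lambda>\<omega>. Z i \<omega> * (Y i \<omega> * Y i \<omega>))" "integrable M (\<lambda>\<omega>. Z i \<omega> * (Y i \<omega> * Y (Suc i) \<omega>))"
      using i by (auto intro!: intZ)
    have 1: "(\<lambda>\<omega>. Z i \<omega> * ((Y (Suc i) \<omega>)\<^sup>2 - (Y i \<omega>)\<^sup>2))
        = (\<lambda>\<omega>. Z i \<omega> * (Y (Suc i) \<omega> * Y (Suc i) \<omega>) - Z i \<omega> * (Y i \<omega> * Y i \<omega>))"
      by (auto simp: fun_eq_iff power2_eq_square algebra_simps)
    have 2: "(\<lambda>\<omega>. Z i \<omega> * (Y (Suc i) \<omega> - Y i \<omega>)\<^sup>2)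
        = (\<lambda>\<omega>. Z i \<omega> * (Y (Suc i) \<omega> * Y (Suc i) \<omega>) + Z i \<omega> * (Y i \<omega> * Y i \<omega>) - 2 * (Z i \<omega> * (Y i \<omega> * Y (Suc i) \<omega>)))"
      by (auto simp: fun_eq_iff power2_eq_square algebra_simps)
    show "integrable M (\<lambda>\<omega>. Z i \<omega> * ((Y (Suc i) \<omega>)\<^sup>2 - (Y i \<omega>)\<^sup>2))"
      unfolding 1 by (intro Bochner_Integration.integrable_diff int)
    show "integrable M (\<lambda>\<omega>. Z i \<omega> * (Y (Suc i) \<omega> - Y i \<omega>)\<^sup>2)"
      unfolding 2 by (intro Bochner_Integration.integrable_diff Bochner_Integration.integrable_add integrable_mult_right int)
    show "(\<integral>\<omega>. Z i \<omega> * ((Y (Suc i) \<omega>)\<^sup>2 - (Y i \<omega>)\<^sup>2) \<partial>M) = (\<integral>\<omega>. Z i \<omega> * (Y (Suc i) \<omega> - Y i \<omega>)\<^sup>2 \<partial>M)"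
      unfolding 1 2 using int orth[OF i] by simp
  qed
  \<comment> \<open>While \<open>S\<close> is below \<epsilon> the sum telescopes. Afterwards it is
    frozen at a square minus \<open>(Y 0)\<^sup>2\<close>, and the lower bound only needs that
    square to be nonnegative.\<close>
  have tele: "(S k \<omega> < \<epsilon> \<longrightarrow> (\<Sum>i<k. Z i \<omega> * ((Y (Suc i) \<omega>)\<^sup>2 - (Y i \<omega>)\<^sup>2)) = (Y k \<omega>)\<^sup>2 - (Y 0 \<omega>)\<^sup>2)
      \<and> - (Y 0 \<omega>)\<^sup>2 \<le> (\<Sum>i<k. Z i \<omega> * ((Y (Suc i) \<omega>)\<^sup>2 - (Y i \<omega>)\<^sup>2))" for k \<omega>
  proof (induction k)
    case (Suc k)
    have "S (Suc k) \<omega> = S k \<omega> + (Y (Suc k) \<omega> - Y k \<omega>)\<^sup>2" by (simp add: S_def)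
    then have "S k \<omega> \<le> S (Suc k) \<omega>" by simp
    with Suc show ?case by (cases "S k \<omega> < \<epsilon>") (auto simp: Z_def)
  qed simp
  \<comment> \<open>The crossing step still has weight 1, since \<open>Z i\<close> looks at
    \<open>S i\<close> and not at \<open>S (Suc i)\<close>; hence the summand
    \<open>4 * K\<^sup>2\<close>.\<close>
  have qv: "(S k \<omega> < \<epsilon> \<longrightarrow> (\<Sum>i<k. Z i \<omega> * (Y (Suc i) \<omega> - Y i \<omega>)\<^sup>2) = S k \<omega>)
      \<and> (\<Sum>i<k. Z i \<omega> * (Y (Suc i) \<omega> - Y i \<omega>)\<^sup>2) \<le> \<epsilon> + 4 * K\<^sup>2" if "k \<le> m" "\<omega> \<in> space M" for k \<omega>
    using that
  proof (induction k)
    case 0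
    then show ?case using eps by (simp add: S_def)
  next
    case (Suc k)
    have *: "S (Suc k) \<omega> = S k \<omega> + (Y (Suc k) \<omega> - Y k \<omega>)\<^sup>2" by (simp add: S_def)
    then have le: "S k \<omega> \<le> S (Suc k) \<omega>" by simp
    show ?case
    proof (cases "S k \<omega> < \<epsilon>")
      case True
      with * Suc dsq[of k \<omega>] show ?thesis by (auto simp: Z_def)
    next
      case False
      with le Suc show ?thesis by (auto simp: Z_def)
    qed
  qed
  let ?B = "{\<omega> \<in> space M. \<epsilon> \<le> S m \<omega>}"
  have B [measurable]: "?B \<in> sets M"
    using measM(2)[of m] by measurable
  have "(\<integral>\<omega>. (Y m \<omega>)\<^sup>2 \<partial>M) \<le> (\<integral>\<omega>. (\<Sum>i<m. Z i \<omega> * ((Y (Suc i) \<omega>)\<^sup>2 - (Y i \<omega>)\<^sup>2)) + K\<^sup>2 * indicator ?B \<omega> \<partial>M)"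
  proof (rule integral_mono_AE)
    show "integrable M (\<lambda>\<omega>. (Y m \<omega>)\<^sup>2)"
      using sq measM(1)[of m] by (intro integrable_const_bound[where B="K\<^sup>2"]) auto
    show "integrable M (\<lambda>\<omega>. (\<Sum>i<m. Z i \<omega> * ((Y (Suc i) \<omega>)\<^sup>2 - (Y i \<omega>)\<^sup>2)) + K\<^sup>2 * indicator ?B \<omega>)"
      using B by (intro Bochner_Integration.integrable_add Bochner_Integration.integrable_sum intsq) (auto simp: less_top[symmetric])
    show "AE \<omega> in M. (Y m \<omega>)\<^sup>2 \<le> (\<Sum>i<m. Z i \<omega> * ((Y (Suc i) \<omega>)\<^sup>2 - (Y i \<omega>)\<^sup>2)) + K\<^sup>2 * indicator ?B \<omega>"
      using start AE_space
    proof eventually_elim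
      fix \<omega> assume "Y 0 \<omega> = 0" "\<omega> \<in> space M"
      with tele[of m \<omega>] sq[of m \<omega>]
      show "(Y m \<omega>)\<^sup>2 \<le> (\<Sum>i<m. Z i \<omega> * ((Y (Suc i) \<omega>)\<^sup>2 - (Y i \<omega>)\<^sup>2)) + K\<^sup>2 * indicator ?B \<omega>"
        by (cases "S m \<omega> < \<epsilon>") (auto simp: indicator_def)
    qed
  qed
  also have "\<dots> = (\<Sum>i<m. \<integral>\<omega>. Z i \<omega> * ((Y (Suc i) \<omega>)\<^sup>2 - (Y i \<omega>)\<^sup>2) \<partial>M) + K\<^sup>2 * prob ?B"
    using B intsq by (subst Bochner_Integration.integral_add)
      (auto simp: less_top[symmetric] intro!: Bochner_Integration.integral_sum)
  also have "(\<Sum>i<m. \<integral>\<omega>. Z i \<omega> * ((Y (Suc i) \<omega>)\<^sup>2 - (Y i \<omega>)\<^sup>2) \<partial>M)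
      = (\<Sum>i<m. \<integral>\<omega>. Z i \<omega> * (Y (Suc i) \<omega> - Y i \<omega>)\<^sup>2 \<partial>M)"
    by (intro sum.cong refl step) auto
  also have "\<dots> = (\<integral>\<omega>. (\<Sum>i<m. Z i \<omega> * (Y (Suc i) \<omega> - Y i \<omega>)\<^sup>2) \<partial>M)"
    using intd by (subst Bochner_Integration.integral_sum) auto
  also have "\<dots> \<le> (\<integral>\<omega>. \<epsilon> + 4 * K\<^sup>2 * indicator ?B \<omega> \<partial>M)"
  proof (rule integral_mono)
    show "(\<Sum>i<m. Z i \<omega> * (Y (Suc i) \<omega> - Y i \<omega>)\<^sup>2) \<le> \<epsilon> + 4 * K\<^sup>2 * indicator ?B \<omega>" if "\<omega> \<in> space M" for \<omega>
      using qv[OF order.refl that] that by (cases "S m \<omega> < \<epsilon>") (auto simp: indicator_def)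
  qed (use B intd in \<open>auto simp: less_top[symmetric] intro!: Bochner_Integration.integrable_add Bochner_Integration.integrable_sum\<close>)
  also have "\<dots> = \<epsilon> + 4 * K\<^sup>2 * prob ?B"
    using B by (subst Bochner_Integration.integral_add) (auto simp: less_top[symmetric] prob_space)
  finally show ?thesis by (simp add: S_def algebra_simps)
qed

section \<open>Localization\<close>

text \<open>A supremum of good times instead of an infimum of bad ones: if |f 0| \<le> K, the set
  contains 0, and a path that never leaves [-K, K] gets the value \<open>t\<close> rather than the
  infimum of an empty set.\<close>

definition exit_time :: "real \<Rightarrow> real \<Rightarrow> (real \<Rightarrow> real) \<Rightarrow> real" where
  "exit_time t K f = Sup {s \<in> {0..t}. \<forall>r\<in>{0..s}. \<bar>f r\<bar> \<le> K}"

text \<open>The level \<open>K\<close> is left arbitrary: large levels serve localization, and level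
  0 serves to pass from rational times to all times.\<close>

locale bounded_start_path =
  fixes t K :: real and f :: "real \<Rightarrow> real"
  assumes cadlag: "cadlag_on t f" and no_jump: "\<And>s. s \<in> {0<..t} \<Longrightarrow> jump f s = 0"
    and start: "\<bar>f 0\<bar> \<le> K" and t_pos: "0 < t"
begin

lemma zero_mem: "0 \<in> {s \<in> {0..t}. \<forall>r\<in>{0..s}. \<bar>f r\<bar> \<le> K}"
  using start t_pos by auto

lemma exit_time_range: "0 \<le> exit_time t K f" "exit_time t K f \<le> t"
  unfolding exit_time_def using zero_mem
  by (auto intro!: cSup_upper cSup_least bdd_aboveI[of _ t])

text \<open>Before the exit time the bound holds by definition. At the exit time it passes to the
  left limit, which is the value because the path has no jump there.\<close>

lemma bounded_at_exit_time:
  assumes "r \<in> {0..exit_time t K f}"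
  shows "\<bar>f r\<bar> \<le> K"
proof -
  have less: "\<bar>f r\<bar> \<le> K" if r: "0 \<le> r" "r < exit_time t K f" for r
  proof -
    obtain s where "s \<in> {s \<in> {0..t}. \<forall>r\<in>{0..s}. \<bar>f r\<bar> \<le> K}" "r < s"
      using less_cSupD[OF _ r(2)[unfolded exit_time_def]] zero_mem by blast
    then show ?thesis using r(1) by auto
  qed
  show ?thesis
  proof (cases "r < exit_time t K f")
    case True
    then show ?thesis using less assms by auto
  next
    case False
    then have r: "r = exit_time t K f" using assms by auto
    show ?thesis
    proof (cases "0 < r")
      case True
      then have rt: "r \<in> {0<..t}" using r exit_time_range by auto
      have "(f \<longlongrightarrow> f r) (at_left r)"
        using cadlag_on_left_limit[OF cadlag, of r] no_jump[OF rt] rt by simp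
      then have "((\<lambda>s. \<bar>f s\<bar>) \<longlongrightarrow> \<bar>f r\<bar>) (at_left r)"
        by (rule tendsto_rabs)
      moreover have "\<forall>\<^sub>F s in at_left r. \<bar>f s\<bar> \<le> K"
        using eventually_at_left_real[OF True] by eventually_elim (use less r in auto)
      ultimately show ?thesis
        by (rule tendsto_upperbound) (simp add: trivial_limit_at_left_real)
    next
      case False
      then have "r = 0" using assms by auto
      then show ?thesis using start by simp
    qed
  qed
qed

lemma le_exit_time_iff:
  assumes "s \<in> {0..t}"
  shows "s \<le> exit_time t K f \<longleftrightarrow> (\<forall>r\<in>{0..s}. \<bar>f r\<bar> \<le> K)"
proof
  assume "\<forall>r\<in>{0..s}. \<bar>f r\<bar> \<le> K"
  then show "s \<le> exit_time t K f"
    unfolding exit_time_def using assms by (intro cSup_upper bdd_aboveI[of _ t]) auto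
qed (use bounded_at_exit_time in auto)

text \<open>By right-continuity a violation at \<open>r < s\<close> persists to the right of
  \<open>r\<close>, and so occurs at a rational time below \<open>s\<close>. The end point
  \<open>s\<close> has no such room within [0, s] and is listed separately.\<close>

lemma bounded_iff_rational:
  assumes s: "s \<in> {0..t}"
  shows "(\<forall>r\<in>{0..s}. \<bar>f r\<bar> \<le> K) \<longleftrightarrow> (\<forall>r\<in>insert s (\<rat> \<inter> {0..s}). \<bar>f r\<bar> \<le> K)"
proof
  assume rat: "\<forall>r\<in>insert s (\<rat> \<inter> {0..s}). \<bar>f r\<bar> \<le> K"
  show "\<forall>r\<in>{0..s}. \<bar>f r\<bar> \<le> K"
  proof (rule ballI, rule ccontr)
    fix r assume r: "r \<in> {0..s}" and "\<not> \<bar>f r\<bar> \<le> K"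
    then have gt: "K < \<bar>f r\<bar>" by simp
    have "\<bar>f s\<bar> \<le> K" using rat by blast
    with gt have "r \<noteq> s" by auto
    with r have "r < s" by auto
    then have "(f \<longlongrightarrow> f r) (at_right r)"
      using cadlag r s by (auto simp: cadlag_on_def)
    then have "\<forall>\<^sub>F x in at_right r. K < \<bar>f x\<bar>"
      by (intro order_tendstoD(1)[OF tendsto_rabs gt])
    then obtain b where b: "r < b" "\<And>x. r < x \<Longrightarrow> x < b \<Longrightarrow> K < \<bar>f x\<bar>"
      by (auto simp: eventually_at_right_field)
    have "r < min b s" using b(1) \<open>r < s\<close> by simp
    then obtain q where "q \<in> \<rat>" "r < q" "q < min b s"
      using Rats_dense_in_real by blast
    then have "K < \<bar>f q\<bar>" "q \<in> \<rat> \<inter> {0..s}" using b(2)[of q] r by auto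
    with rat show False by (meson insertI2 not_le)
  qed
qed (use s in auto)

end

section \<open>Convergence in probability and almost sure subsequences\<close>

lemma (in prob_space) tendsto_in_prob_min_1:
  assumes "tendsto_in_prob M X L"
  shows "(\<lambda>n. \<integral>\<omega>. min 1 \<bar>X n \<omega> - L \<omega>\<bar> \<partial>M) \<longlonglongrightarrow> 0"
proof -
  have [measurable]: "X n \<in> borel_measurable M" "L \<in> borel_measurable M" for n
    using assms by (auto simp: tendsto_in_prob_def)
  have int: "integrable M (\<lambda>\<omega>. min 1 \<bar>X n \<omega> - L \<omega>\<bar>)" for n
    by (rule integrable_const_bound[where B=1]) auto
  show ?thesis
  proof (rule order_tendstoI)
    fix a :: real assume "a < 0"
    then show "\<forall>\<^sub>F n in sequentially. a < (\<integral>\<omega>. min 1 \<bar>X n \<omega> - L \<omega>\<bar> \<partial>M)"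
      by (intro always_eventually allI order.strict_trans2[OF _ integral_nonneg_AE]) auto
  next
    fix \<epsilon> :: real assume \<epsilon>: "0 < \<epsilon>"
    \<comment> \<open>One half bounds the integrand off the exceptional event, the other half bounds
      the probability of that event, on which the integrand is at most 1.\<close>
    then have \<epsilon>2: "0 < \<epsilon>/2" by simp
    then have "(\<lambda>n. prob {\<omega> \<in> space M. \<bar>X n \<omega> - L \<omega>\<bar> > \<epsilon>/2}) \<longlonglongrightarrow> 0"
      using assms unfolding tendsto_in_prob_def by blast
    from order_tendstoD(2)[OF this \<epsilon>2]
    show "\<forall>\<^sub>F n in sequentially. (\<integral>\<omega>. min 1 \<bar>X n \<omega> - L \<omega>\<bar> \<partial>M) < \<epsilon>"
    proof eventually_elim
      fix n assume n: "prob {\<omega> \<in> space M. \<bar>X n \<omega> - L \<omega>\<bar> > \<epsilon>/2} < \<epsilon>/2" (is "prob ?B < _")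
      have B: "?B \<in> sets M" by measurable
      have "(\<integral>\<omega>. min 1 \<bar>X n \<omega> - L \<omega>\<bar> \<partial>M) \<le> (\<integral>\<omega>. \<epsilon>/2 + indicator ?B \<omega> \<partial>M)"
      proof (rule integral_mono[OF int])
        show "integrable M (\<lambda>\<omega>. \<epsilon>/2 + indicator ?B \<omega>)"
          using \<epsilon> B by (intro integrable_const_bound[where B="\<epsilon>/2 + 1"]) (auto simp: indicator_def)
        show "min 1 \<bar>X n \<omega> - L \<omega>\<bar> \<le> \<epsilon>/2 + indicator ?B \<omega>" if "\<omega> \<in> space M" for \<omega>
        proof (cases "\<epsilon>/2 < \<bar>X n \<omega> - L \<omega>\<bar>")
          case True
          then show ?thesis
            using that \<epsilon> by (intro order_trans[OF min.cobounded1]) (simp add: indicator_def)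
        next
          case False
          then show ?thesis
            by (intro order_trans[OF min.cobounded2]) (simp add: indicator_def)
        qed
      qed
      also have "\<dots> = \<epsilon>/2 + prob ?B"
        using B by (subst Bochner_Integration.integral_add) (auto simp: less_top[symmetric] prob_space)
      finally show "(\<integral>\<omega>. min 1 \<bar>X n \<omega> - L \<omega>\<bar> \<partial>M) < \<epsilon>" using n by simp
    qed
  qed
qed

lemma tendsto_0_of_min_1_le:
  fixes x y :: "nat \<Rightarrow> real"
  assumes y: "y \<longlonglongrightarrow> 0" and le: "\<And>n. min 1 \<bar>x n - l\<bar> \<le> y n"
  shows "x \<longlonglongrightarrow> l"
proof -
  have "\<forall>\<^sub>F n in sequentially. y n < 1"
    by (rule order_tendstoD(2)[OF y]) simp
  then have "\<forall>\<^sub>F n in sequentially. \<bar>x n - l\<bar> \<le> y n"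
    by eventually_elim (use le in \<open>fastforce simp: min_def split: if_splits\<close>)
  then have "(\<lambda>n. x n - l) \<longlonglongrightarrow> 0"
    by (intro tendsto_rabs_zero_cancel[OF tendsto_sandwich[OF _ _ tendsto_const y]]) auto
  then show ?thesis by (rule LIM_zero_cancel)
qed

text \<open>The sum of the three distances capped at 1 tends to 0 in L1, so one subsequence serves
  all three limits. It has to be common, since the three limits are later combined along the same
  partitions.\<close>

lemma (in prob_space) tendsto_in_prob_common_subsequence:
  assumes "tendsto_in_prob M X L" "tendsto_in_prob M X' L'" "tendsto_in_prob M X'' L''"
  obtains \<phi> :: "nat \<Rightarrow> nat" where "strict_mono \<phi>"
    "AE \<omega> in M. (\<lambda>n. X (\<phi> n) \<omega>) \<longlonglongrightarrow> L \<omega> \<and> (\<lambda>n. X' (\<phi> n) \<omega>) \<longlonglongrightarrow> L' \<omega> \<and> (\<lambda>n. X'' (\<phi> n) \<omega>) \<longlonglongrightarrow> L'' \<omega>"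
proof -
  define u where "u n \<omega> = min 1 \<bar>X n \<omega> - L \<omega>\<bar> + min 1 \<bar>X' n \<omega> - L' \<omega>\<bar> + min 1 \<bar>X'' n \<omega> - L'' \<omega>\<bar>" for n \<omega>
  have [measurable]: "X n \<in> borel_measurable M" "L \<in> borel_measurable M" "X' n \<in> borel_measurable M"
    "L' \<in> borel_measurable M" "X'' n \<in> borel_measurable M" "L'' \<in> borel_measurable M" for n
    using assms by (auto simp: tendsto_in_prob_def)
  have int: "integrable M (\<lambda>\<omega>. min 1 \<bar>X n \<omega> - L \<omega>\<bar>)" "integrable M (\<lambda>\<omega>. min 1 \<bar>X' n \<omega> - L' \<omega>\<bar>)"
    "integrable M (\<lambda>\<omega>. min 1 \<bar>X'' n \<omega> - L'' \<omega>\<bar>)" for n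
    by (rule integrable_const_bound[where B=1]; auto)+
  have intu: "integrable M (u n)" for n
    unfolding u_def by (intro Bochner_Integration.integrable_add int)
  have "(\<integral>\<omega>. norm (u n \<omega>) \<partial>M) = (\<integral>\<omega>. min 1 \<bar>X n \<omega> - L \<omega>\<bar> \<partial>M) + (\<integral>\<omega>. min 1 \<bar>X' n \<omega> - L' \<omega>\<bar> \<partial>M)
      + (\<integral>\<omega>. min 1 \<bar>X'' n \<omega> - L'' \<omega>\<bar> \<partial>M)" for n
  proof -
    have "norm (u n \<omega>) = u n \<omega>" for \<omega> by (simp add: u_def)
    then show ?thesis using int by (simp add: u_def)
  qed
  moreover have "(\<lambda>n. (\<integral>\<omega>. min 1 \<bar>X n \<omega> - L \<omega>\<bar> \<partial>M) + (\<integral>\<omega>. min 1 \<bar>X' n \<omega> - L' \<omega>\<bar> \<partial>M)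
      + (\<integral>\<omega>. min 1 \<bar>X'' n \<omega> - L'' \<omega>\<bar> \<partial>M)) \<longlonglongrightarrow> 0 + 0 + 0"
    by (intro tendsto_add tendsto_in_prob_min_1 assms)
  ultimately have "(\<lambda>n. \<integral>\<omega>. norm (u n \<omega>) \<partial>M) \<longlonglongrightarrow> 0" by simp
  from tendsto_L1_AE_subseq[OF intu this]
  obtain \<phi> :: "nat \<Rightarrow> nat" where \<phi>: "strict_mono \<phi>" "AE \<omega> in M. (\<lambda>n. u (\<phi> n) \<omega>) \<longlonglongrightarrow> 0" by blast
  from \<phi>(2) have "AE \<omega> in M. (\<lambda>n. X (\<phi> n) \<omega>) \<longlonglongrightarrow> L \<omega> \<and> (\<lambda>n. X' (\<phi> n) \<omega>) \<longlonglongrightarrow> L' \<omega> \<and> (\<lambda>n. X'' (\<phi> n) \<omega>) \<longlonglongrightarrow> L'' \<omega>"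
    by eventually_elim (auto elim!: tendsto_0_of_min_1_le simp: u_def)
  with \<phi>(1) show thesis by (rule that)
qed

lemma (in prob_space) AE_tendsto_0_prob:
  assumes [measurable]: "\<And>n. X n \<in> borel_measurable M" and lim: "AE \<omega> in M. (\<lambda>n. X n \<omega>) \<longlonglongrightarrow> (0::real)"
    and \<epsilon>: "0 < \<epsilon>"
  shows "(\<lambda>n. prob {\<omega> \<in> space M. \<epsilon> \<le> X n \<omega>}) \<longlonglongrightarrow> 0"
proof -
  have B: "{\<omega> \<in> space M. \<epsilon> \<le> X n \<omega>} \<in> sets M" for n by measurable
  have "(\<lambda>n. \<integral>\<omega>. indicator {\<omega> \<in> space M. \<epsilon> \<le> X n \<omega>} \<omega> \<partial>M) \<longlonglongrightarrow> (\<integral>\<omega>. (0::real) \<partial>M)"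
  proof (rule integral_dominated_convergence[where w="\<lambda>_. 1"])
    show "AE \<omega> in M. (\<lambda>n. indicator {\<omega> \<in> space M. \<epsilon> \<le> X n \<omega>} \<omega>) \<longlonglongrightarrow> (0::real)"
      using lim
    proof eventually_elim
      fix \<omega> assume "(\<lambda>n. X n \<omega>) \<longlonglongrightarrow> 0"
      then have "\<forall>\<^sub>F n in sequentially. X n \<omega> < \<epsilon>"
        by (rule order_tendstoD(2)) (rule \<epsilon>)
      then show "(\<lambda>n. indicator {\<omega> \<in> space M. \<epsilon> \<le> X n \<omega>} \<omega>) \<longlonglongrightarrow> (0::real)"
        by (intro tendsto_eventually) (auto simp: indicator_def elim!: eventually_mono)
    qed
  qed (use B in \<open>auto simp: indicator_def\<close>)
  then show ?thesis using B by simp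
qed

section \<open>Stopping at exit times and vanishing of the difference\<close>

context usual_filtered_prob_space
begin

text \<open>A bound on a whole path segment is a countable condition by
  \<open>bounded_iff_rational\<close>, which puts \<open>T < s\<close> into \<open>F s\<close>.
  Right-continuity of the filtration turns the strict inequality into a weak one.\<close>

lemma exit_time_stopping_time:
  assumes N: "adapted_on F t N"
    and path: "\<And>\<omega>. \<omega> \<in> space P \<Longrightarrow> bounded_start_path t K (\<lambda>s. N s \<omega>)" and t: "0 < t"
  shows "nonneg_stopping_time P F (\<lambda>\<omega>. exit_time t K (\<lambda>s. N s \<omega>))"
proof -
  define T where "T = (\<lambda>\<omega>. exit_time t K (\<lambda>s. N s \<omega>))"
  have T: "0 \<le> T \<omega>" "T \<omega> \<le> t" if "\<omega> \<in> space P" for \<omega>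
    using bounded_start_path.exit_time_range[OF path[OF that]] by (auto simp: T_def)
  have le: "{\<omega> \<in> space P. s \<le> T \<omega>} \<in> sets (F s)" if s: "s \<in> {0..t}" for s
  proof -
    have "{\<omega> \<in> space P. s \<le> T \<omega>} = {\<omega> \<in> space (F s). \<forall>r\<in>insert s (\<rat> \<inter> {0..s}). \<bar>N r \<omega>\<bar> \<le> K}"
      using bounded_start_path.le_exit_time_iff[OF path s] bounded_start_path.bounded_iff_rational[OF path s]
      by (auto simp: T_def space_F)
    also have "\<dots> \<in> sets (F s)"
      unfolding pred_def[symmetric]
    proof (rule measurable_pred_countable)
      fix r assume r: "r \<in> insert s (\<rat> \<inter> {0..s})"
      then have "N r \<in> borel_measurable (F r)" "r \<le> s"
        using N s by (auto simp: adapted_on_def)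
      then have "N r \<in> borel_measurable (F s)" by (rule F_measurable_mono)
      then show "Measurable.pred (F s) (\<lambda>\<omega>. \<bar>N r \<omega>\<bar> \<le> K)" by measurable
    qed (simp add: countable_rat)
    finally show ?thesis .
  qed
  have less: "{\<omega> \<in> space P. T \<omega> < s} \<in> sets (F s)" if s: "0 \<le> s" for s
  proof (cases "s \<le> t")
    case True
    have "space (F s) - {\<omega> \<in> space P. s \<le> T \<omega>} \<in> sets (F s)"
      using le[of s] True s by auto
    also have "space (F s) - {\<omega> \<in> space P. s \<le> T \<omega>} = {\<omega> \<in> space P. T \<omega> < s}"
      by (auto simp: space_F)
    finally show ?thesis .
  next
    case False
    then have "{\<omega> \<in> space P. T \<omega> < s} = space (F s)"
      using T by (force simp: space_F)
    then show ?thesis by simp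
  qed
  have "stopping_time F T"
  proof
    fix s
    have "{\<omega> \<in> space P. T \<omega> \<le> s} \<in> sets (F s)"
    proof (cases "0 \<le> s")
      case False
      then have "{\<omega> \<in> space P. T \<omega> \<le> s} = {}" using T by force
      then show ?thesis by (simp only: sets.empty_sets)
    next
      case s: True
      have "{\<omega> \<in> space P. T \<omega> \<le> s} \<in> sets (F u)" if u: "s < u" for u
      proof -
        \<comment> \<open>Times in (s, u] that tend to \<open>s\<close>, so that all events
          \<open>T < v n\<close> lie in \<open>F u\<close>.\<close>
        define v where "v n = s + (u - s) / real (Suc n)" for n
        have v: "s < v n" "v n \<le> u" for n
        proof -
          have "0 < (u - s) / real (Suc n)" "(u - s) / real (Suc n) \<le> (u - s) / 1"
            using u frac_le[of "u - s" "u - s" 1 "real (Suc n)"] by auto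
          then show "s < v n" "v n \<le> u" by (auto simp: v_def)
        qed
        have "(\<lambda>n. (u - s) * (1 / real (Suc n))) \<longlonglongrightarrow> (u - s) * 0"
          by (intro tendsto_mult tendsto_const LIMSEQ_Suc[OF lim_1_over_n])
        then have "(\<lambda>n. s + (u - s) * (1 / real (Suc n))) \<longlonglongrightarrow> s + (u - s) * 0"
          by (intro tendsto_add tendsto_const)
        then have vlim: "v \<longlonglongrightarrow> s" by (simp add: v_def[abs_def])
        have "{\<omega> \<in> space P. T \<omega> \<le> s} = (\<Inter>n. {\<omega> \<in> space P. T \<omega> < v n})"
        proof (intro set_eqI iffI)
          fix \<omega> assume "\<omega> \<in> {\<omega> \<in> space P. T \<omega> \<le> s}"
          then show "\<omega> \<in> (\<Inter>n. {\<omega> \<in> space P. T \<omega> < v n})"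
            using v(1) by (auto intro: le_less_trans)
        next
          fix \<omega> assume "\<omega> \<in> (\<Inter>n. {\<omega> \<in> space P. T \<omega> < v n})"
          then have "\<omega> \<in> space P" "\<And>n. T \<omega> \<le> v n" by (auto intro: less_imp_le)
          then show "\<omega> \<in> {\<omega> \<in> space P. T \<omega> \<le> s}"
            using LIMSEQ_le_const[OF vlim] by auto
        qed
        moreover have "{\<omega> \<in> space P. T \<omega> < v n} \<in> sets (F u)" for n
          using less[of "v n"] v[of n] s sets_F_mono[of "v n" u] by auto
        ultimately show ?thesis by auto
      qed
      then show ?thesis using right_continuous_F[OF s] by auto
    qed
    then show "Measurable.pred (F s) (\<lambda>\<omega>. T \<omega> \<le> s)" by (simp add: pred_def space_F)
  qed
  then show ?thesis using T(1) by (simp add: nonneg_stopping_time_def T_def)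
qed

text \<open>Since \<open>T \<le> R\<close>, sampling the stopped process at \<open>T\<close> gives
  \<open>M\<close> at \<open>T\<close>. The right-hand side does not depend on \<open>T\<close>,
  which is how integrals at two stopping times are compared later.\<close>

lemma localized_optional_sampling:
  assumes M: "cadlag_adapted P F t M" and R: "nonneg_stopping_time P F R"
    and L: "martingale_on P F t (\<lambda>s \<omega>. M (min s (R \<omega>)) \<omega> - M 0 \<omega>)"
    and T: "nonneg_stopping_time P F T" and le: "\<And>\<omega>. \<omega> \<in> space P \<Longrightarrow> T \<omega> \<le> t" "\<And>\<omega>. \<omega> \<in> space P \<Longrightarrow> T \<omega> \<le> R \<omega>"
    and t: "0 \<le> t"
  shows "integrable P (\<lambda>\<omega>. M (T \<omega>) \<omega> - M 0 \<omega>)"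
    and "A \<in> sets (pre_sigma T) \<Longrightarrow>
      (\<integral>\<omega>\<in>A. M (T \<omega>) \<omega> - M 0 \<omega> \<partial>P) = (\<integral>\<omega>\<in>A. M (min t (R \<omega>)) \<omega> - M 0 \<omega> \<partial>P)"
proof -
  have "integrable P (\<lambda>\<omega>. M (T \<omega>) \<omega> - M 0 \<omega>) \<longleftrightarrow> integrable P (\<lambda>\<omega>. M (min (T \<omega>) (R \<omega>)) \<omega> - M 0 \<omega>)"
    using le(2) by (intro Bochner_Integration.integrable_cong) (auto simp: min_absorb1)
  moreover have "integrable P (\<lambda>\<omega>. M (min (T \<omega>) (R \<omega>)) \<omega> - M 0 \<omega>)"
    by (rule optional_sampling(1)[OF local_martingale_localized[OF M R L] L T le(1) t])
  ultimately show "integrable P (\<lambda>\<omega>. M (T \<omega>) \<omega> - M 0 \<omega>)" by simp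
  assume A: "A \<in> sets (pre_sigma T)"
  have "(\<integral>\<omega>\<in>A. M (T \<omega>) \<omega> - M 0 \<omega> \<partial>P) = (\<integral>\<omega>\<in>A. M (min (T \<omega>) (R \<omega>)) \<omega> - M 0 \<omega> \<partial>P)"
    unfolding set_lebesgue_integral_def
    using le(2) by (intro Bochner_Integration.integral_cong) (auto simp: min_absorb1)
  also have "\<dots> = (\<integral>\<omega>\<in>A. M (min t (R \<omega>)) \<omega> - M 0 \<omega> \<partial>P)"
    by (rule optional_sampling(2)[OF local_martingale_localized[OF M R L] L T le(1) t A])
  finally show "(\<integral>\<omega>\<in>A. M (T \<omega>) \<omega> - M 0 \<omega> \<partial>P) = (\<integral>\<omega>\<in>A. M (min t (R \<omega>)) \<omega> - M 0 \<omega> \<partial>P)" .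
qed

text \<open>\<open>bounded_martingale_square_le\<close> is applied to the partition stopped at
  \<open>r\<close>, whose last point is \<open>r\<close> itself. Letting the partitions become fine
  for fixed \<epsilon>, and then \<epsilon> tend to 0, leaves second moment 0. The martingale
  property is requested only for times up to \<open>r\<close>, where localization provides
  it.\<close>

lemma zero_quadratic_variation_stopped_zero:
  fixes m :: "nat \<Rightarrow> nat" and \<tau> :: "nat \<Rightarrow> nat \<Rightarrow> 'a \<Rightarrow> real"
  assumes N: "cadlag_adapted P F t N" and N0: "\<And>\<omega>. \<omega> \<in> space P \<Longrightarrow> N 0 \<omega> = 0" and t: "0 \<le> t"
    and r: "nonneg_stopping_time P F r" and rt: "\<And>\<omega>. \<omega> \<in> space P \<Longrightarrow> r \<omega> \<le> t"
    and bound: "\<And>\<omega> u. \<omega> \<in> space P \<Longrightarrow> u \<in> {0..r \<omega>} \<Longrightarrow> \<bar>N u \<omega>\<bar> \<le> K"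
    and mart: "\<And>S T A. nonneg_stopping_time P F S \<Longrightarrow> nonneg_stopping_time P F T \<Longrightarrow>
      (\<And>\<omega>. \<omega> \<in> space P \<Longrightarrow> S \<omega> \<le> T \<omega>) \<Longrightarrow> (\<And>\<omega>. \<omega> \<in> space P \<Longrightarrow> T \<omega> \<le> r \<omega>) \<Longrightarrow>
      A \<in> sets (pre_sigma S) \<Longrightarrow> (\<integral>\<omega>\<in>A. N (T \<omega>) \<omega> \<partial>P) = (\<integral>\<omega>\<in>A. N (S \<omega>) \<omega> \<partial>P)"
    and \<tau>: "\<And>k i. i \<le> m k \<Longrightarrow> nonneg_stopping_time P F (\<tau> k i)"
    and \<tau>0: "\<And>k \<omega>. \<omega> \<in> space P \<Longrightarrow> \<tau> k 0 \<omega> = 0" and \<tau>t: "\<And>k \<omega>. \<omega> \<in> space P \<Longrightarrow> \<tau> k (m k) \<omega> = t"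
    and \<tau>mono: "\<And>k i \<omega>. \<omega> \<in> space P \<Longrightarrow> i < m k \<Longrightarrow> \<tau> k i \<omega> \<le> \<tau> k (Suc i) \<omega>"
    and lim: "AE \<omega> in P. (\<lambda>k. \<Sum>i<m k. (N (min (\<tau> k (Suc i) \<omega>) (r \<omega>)) \<omega> - N (min (\<tau> k i \<omega>) (r \<omega>)) \<omega>)\<^sup>2) \<longlonglongrightarrow> 0"
  shows "AE \<omega> in P. N (r \<omega>) \<omega> = 0"
proof -
  define \<rho> where "\<rho> k i \<omega> = min (\<tau> k i \<omega>) (r \<omega>)" for k i \<omega>
  have r0: "0 \<le> r \<omega>" if "\<omega> \<in> space P" for \<omega> using r that by (simp add: nonneg_stopping_time_def)
  have N\<rho>: "nonneg_stopping_time P F (\<rho> k i)" if "i \<le> m k" for k i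
    using \<tau>[OF that] r unfolding \<rho>_def[abs_def] nonneg_stopping_time_def by (auto intro: stopping_time_min)
  have ST: "stopping_time F (\<rho> k i)" if "i \<le> m k" for k i
    using N\<rho>[OF that] by (simp add: nonneg_stopping_time_def)
  have \<rho>0: "0 \<le> \<rho> k i \<omega>" if "i \<le> m k" "\<omega> \<in> space P" for k i \<omega>
    using N\<rho>[OF that(1)] that(2) by (simp add: nonneg_stopping_time_def)
  have \<rho>r: "\<rho> k i \<omega> \<le> r \<omega>" for k i \<omega> by (simp add: \<rho>_def)
  have \<rho>t: "\<rho> k i \<omega> \<le> t" if "\<omega> \<in> space P" for k i \<omega>
    using \<rho>r rt[OF that] by (rule order_trans)
  have \<rho>mono: "\<rho> k i \<omega> \<le> \<rho> k j \<omega>" if "i \<le> j" "j \<le> m k" "\<omega> \<in> space P" for k i j \<omega>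
    using partition_mono[of "m k" "\<lambda>i. \<tau> k i \<omega>", OF \<tau>mono[OF that(3)] that(1,2)] by (simp add: \<rho>_def min.coboundedI1)
  have meas: "(\<lambda>\<omega>. N (\<rho> k i \<omega>) \<omega>) \<in> borel_measurable (pre_sigma (\<rho> k i))" if "i \<le> m k" for k i
    by (rule stopped_measurable_pre_sigma[OF N N\<rho>[OF that] \<rho>t t])
  have measP: "(\<lambda>\<omega>. N (\<rho> k i \<omega>) \<omega>) \<in> borel_measurable P" if "i \<le> m k" for k i
    by (rule measurable_from_subalg[OF subalgebra_pre_sigma[OF ST[OF that]] meas[OF that]])
  have measr: "(\<lambda>\<omega>. N (r \<omega>) \<omega>) \<in> borel_measurable P"
    using r by (intro measurable_from_subalg[OF subalgebra_pre_sigma stopped_measurable_pre_sigma[OF N r rt t]])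
      (auto simp: nonneg_stopping_time_def)
  define Q where "Q k \<omega> = (\<Sum>i<m k. (N (\<rho> k (Suc i) \<omega>) \<omega> - N (\<rho> k i \<omega>) \<omega>)\<^sup>2)" for k \<omega>
  have le: "(\<integral>\<omega>. (N (r \<omega>) \<omega>)\<^sup>2 \<partial>P) \<le> \<epsilon> + 5 * K\<^sup>2 * prob {\<omega> \<in> space P. \<epsilon> \<le> Q k \<omega>}" if \<epsilon>: "0 < \<epsilon>" for \<epsilon> k
  proof -
    have "(\<integral>\<omega>. (N (r \<omega>) \<omega>)\<^sup>2 \<partial>P) = (\<integral>\<omega>. (N (\<rho> k (m k) \<omega>) \<omega>)\<^sup>2 \<partial>P)"
      using \<tau>t rt by (intro Bochner_Integration.integral_cong) (auto simp: \<rho>_def min_absorb2)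
    also have "\<dots> \<le> \<epsilon> + 5 * K\<^sup>2 * prob {\<omega> \<in> space P. \<epsilon> \<le> (\<Sum>i<m k. (N (\<rho> k (Suc i) \<omega>) \<omega> - N (\<rho> k i \<omega>) \<omega>)\<^sup>2)}"
    proof (rule bounded_martingale_square_le[where G="\<lambda>i. pre_sigma (\<rho> k i)" and Y="\<lambda>i \<omega>. N (\<rho> k i \<omega>) \<omega>"])
      show "subalgebra P (pre_sigma (\<rho> k i))" if "i \<le> m k" for i
        by (rule subalgebra_pre_sigma[OF ST[OF that]])
      show "sets (pre_sigma (\<rho> k i)) \<subseteq> sets (pre_sigma (\<rho> k j))" if "i \<le> j" "j \<le> m k" for i j
        using that by (intro mono_pre_sigma ST \<rho>mono) auto
      show "\<bar>N (\<rho> k i \<omega>) \<omega>\<bar> \<le> K" if "i \<le> m k" "\<omega> \<in> space P" for i \<omega>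
        using that by (intro bound) (auto simp: \<rho>0 \<rho>r)
      show "(\<integral>\<omega>\<in>A. N (\<rho> k (Suc i) \<omega>) \<omega> \<partial>P) = (\<integral>\<omega>\<in>A. N (\<rho> k i \<omega>) \<omega> \<partial>P)"
        if "i < m k" "A \<in> sets (pre_sigma (\<rho> k i))" for i A
        using that by (intro mart N\<rho> \<rho>mono \<rho>r) auto
      show "AE \<omega> in P. N (\<rho> k 0 \<omega>) \<omega> = 0"
        using \<tau>0 N0 r0 by (intro AE_I2) (simp add: \<rho>_def min_absorb1)
    qed (use meas \<epsilon> in auto)
    finally show ?thesis by (simp add: Q_def)
  qed
  have "(\<integral>\<omega>. (N (r \<omega>) \<omega>)\<^sup>2 \<partial>P) \<le> \<epsilon>" if \<epsilon>: "0 < \<epsilon>" for \<epsilon>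
  proof -
    have "Q k \<in> borel_measurable P" for k
      unfolding Q_def[abs_def] using measP by (intro borel_measurable_sum borel_measurable_power borel_measurable_diff) auto
    then have "(\<lambda>k. prob {\<omega> \<in> space P. \<epsilon> \<le> Q k \<omega>}) \<longlonglongrightarrow> 0"
      using lim \<epsilon> by (intro AE_tendsto_0_prob) (simp_all add: Q_def[abs_def] \<rho>_def)
    then have "(\<lambda>k. \<epsilon> + 5 * K\<^sup>2 * prob {\<omega> \<in> space P. \<epsilon> \<le> Q k \<omega>}) \<longlonglongrightarrow> \<epsilon> + 5 * K\<^sup>2 * 0"
      by (intro tendsto_intros)
    then show ?thesis
      using le[OF \<epsilon>] by (intro LIMSEQ_le_const) auto
  qed
  then have le0: "(\<integral>\<omega>. (N (r \<omega>) \<omega>)\<^sup>2 \<partial>P) \<le> 0"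
    by (rule field_le_epsilon[of _ 0, simplified])
  have int: "integrable P (\<lambda>\<omega>. (N (r \<omega>) \<omega>)\<^sup>2)"
  proof (rule integrable_const_bound[where B="K\<^sup>2"])
    show "AE \<omega> in P. norm ((N (r \<omega>) \<omega>)\<^sup>2) \<le> K\<^sup>2"
    proof (rule AE_I2)
      fix \<omega> assume "\<omega> \<in> space P"
      then have "\<bar>N (r \<omega>) \<omega>\<bar> \<le> \<bar>K\<bar>" using bound[of \<omega> "r \<omega>"] r0 by auto
      then show "norm ((N (r \<omega>) \<omega>)\<^sup>2) \<le> K\<^sup>2" by (simp only: abs_le_square_iff) simp
    qed
  qed (use measr in simp)
  have "(\<integral>\<omega>. (N (r \<omega>) \<omega>)\<^sup>2 \<partial>P) = 0"
    using le0 by (intro antisym integral_nonneg_AE) auto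
  then have "AE \<omega> in P. (N (r \<omega>) \<omega>)\<^sup>2 = 0"
    by (subst (asm) integral_nonneg_eq_0_iff_AE[OF int]) auto
  then show ?thesis by simp
qed

lemma special_dirichlet_martingale_part_unique:
  assumes t: "0 < t"
    and d: "special_dirichlet_decomposition P F t m \<tau> X M \<Gamma>"
    and d': "special_dirichlet_decomposition P F t m \<tau> X M' \<Gamma>'"
  shows "AE \<omega> in P. \<forall>s\<in>{0..t}. M s \<omega> = M' s \<omega>"
proof -
  note dd = d[unfolded special_dirichlet_decomposition_def]
    and dd' = d'[unfolded special_dirichlet_decomposition_def]
  have lm: "local_martingale_on P F t M" "local_martingale_on P F t M'"
    using dd dd' by auto
  have cad: "cadlag_on t (\<lambda>r. M r \<omega>)" "cadlag_on t (\<lambda>r. M' r \<omega>)"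
    "cadlag_on t (\<lambda>r. \<Gamma> r \<omega>)" "cadlag_on t (\<lambda>r. \<Gamma>' r \<omega>)" if "\<omega> \<in> space P" for \<omega>
    using dd dd' that by (auto simp: local_martingale_on_def cadlag_adapted_def)
  obtain C where C: "qv_cont_part P F t m \<tau> \<Gamma> C" "AE \<omega> in P. C t \<omega> = 0" using dd by auto
  obtain C' where C': "qv_cont_part P F t m \<tau> \<Gamma>' C'" "AE \<omega> in P. C' t \<omega> = 0" using dd' by auto
  have ref: "refining_sequence P F t m \<tau>" using C(1) by (simp add: qv_cont_part_def)
  have \<tau>: "nonneg_stopping_time P F (\<tau> n i)" if "i \<le> m n" for n i
    using ref that by (simp add: refining_sequence_def)
  have part: "\<tau> n 0 \<omega> = 0" "\<tau> n (m n) \<omega> = t" "i < m n \<Longrightarrow> \<tau> n i \<omega> \<le> \<tau> n (Suc i) \<omega>" if "\<omega> \<in> space P" for n i \<omega>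
    using ref that by (auto simp: refining_sequence_def)
  have mesh: "tendsto_in_prob P (\<lambda>n \<omega>. Max ((\<lambda>i. \<tau> n (Suc i) \<omega> - \<tau> n i \<omega>) ` {..<m n})) (\<lambda>\<omega>. 0)"
    using ref by (simp add: refining_sequence_def)
  have qv: "tendsto_in_prob P
      (\<lambda>n \<omega>. \<Sum>i<m n. (Y (min (\<tau> n (Suc i) \<omega>) t) \<omega> - Y (min (\<tau> n i \<omega>) t) \<omega>)\<^sup>2)
      (\<lambda>\<omega>. D t \<omega> + (\<Sum>\<^sub>\<infinity>u\<in>{0<..t}. (jump (\<lambda>r. Y r \<omega>) u)\<^sup>2))"
    if "qv_cont_part P F t m \<tau> Y D" for Y D
    using that t by (auto simp: qv_cont_part_def)
  \<comment> \<open>The mesh joins the two square sums because the pathwise argument needs the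
    partitions of the given outcome to become fine.\<close>
  obtain \<phi> :: "nat \<Rightarrow> nat" where \<phi>: "AE \<omega> in P.
      (\<lambda>n. Max ((\<lambda>i. \<tau> (\<phi> n) (Suc i) \<omega> - \<tau> (\<phi> n) i \<omega>) ` {..<m (\<phi> n)})) \<longlonglongrightarrow> 0 \<and>
      (\<lambda>n. \<Sum>i<m (\<phi> n). (\<Gamma> (min (\<tau> (\<phi> n) (Suc i) \<omega>) t) \<omega> - \<Gamma> (min (\<tau> (\<phi> n) i \<omega>) t) \<omega>)\<^sup>2)
        \<longlonglongrightarrow> C t \<omega> + (\<Sum>\<^sub>\<infinity>u\<in>{0<..t}. (jump (\<lambda>r. \<Gamma> r \<omega>) u)\<^sup>2) \<and>
      (\<lambda>n. \<Sum>i<m (\<phi> n). (\<Gamma>' (min (\<tau> (\<phi> n) (Suc i) \<omega>) t) \<omega> - \<Gamma>' (min (\<tau> (\<phi> n) i \<omega>) t) \<omega>)\<^sup>2)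
        \<longlonglongrightarrow> C' t \<omega> + (\<Sum>\<^sub>\<infinity>u\<in>{0<..t}. (jump (\<lambda>r. \<Gamma>' r \<omega>) u)\<^sup>2)"
    by (rule tendsto_in_prob_common_subsequence[OF mesh qv[OF C(1)] qv[OF C'(1)]])
  have jumps: "AE \<omega> in P. \<forall>s\<in>{0..t}. jump (\<lambda>r. \<Gamma> r \<omega>) s = jump (\<lambda>r. \<Gamma>' r \<omega>) s"
    using decompositions_same_jumps[OF d d'] t by simp
  have "AE \<omega> in P. (\<forall>s\<in>{0..t}. M s \<omega> + \<Gamma> s \<omega> = M' s \<omega> + \<Gamma>' s \<omega>)
      \<and> (\<forall>s\<in>{0..t}. jump (\<lambda>r. \<Gamma> r \<omega>) s = jump (\<lambda>r. \<Gamma>' r \<omega>) s) \<and> M 0 \<omega> = 0 \<and> M' 0 \<omega> = 0"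
    using conjunct1[OF dd] conjunct1[OF dd'] jumps
      conjunct1[OF conjunct2[OF conjunct2[OF dd]]] conjunct1[OF conjunct2[OF conjunct2[OF dd']]]
    by eventually_elim auto
  then obtain Z where Z: "Z \<in> null_sets P"
    and eq: "\<And>s \<omega>. \<omega> \<in> space P - Z \<Longrightarrow> s \<in> {0..t} \<Longrightarrow> M s \<omega> + \<Gamma> s \<omega> = M' s \<omega> + \<Gamma>' s \<omega>"
    and jeq: "\<And>s \<omega>. \<omega> \<in> space P - Z \<Longrightarrow> s \<in> {0..t} \<Longrightarrow> jump (\<lambda>r. \<Gamma> r \<omega>) s = jump (\<lambda>r. \<Gamma>' r \<omega>) s"
    and M0: "\<And>\<omega>. \<omega> \<in> space P - Z \<Longrightarrow> M 0 \<omega> = 0 \<and> M' 0 \<omega> = 0"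
    by (elim AE_E3) blast
  \<comment> \<open>Setting the process to 0 on \<open>Z\<close> makes every path start at 0 and
    have no jumps, as the exit time requires. It remains adapted because null sets belong to
    \<open>F 0\<close>.\<close>
  define N where "N s \<omega> = (if \<omega> \<in> Z then 0 else M s \<omega> - M' s \<omega>)" for s \<omega>
  have AE_Z: "AE \<omega> in P. \<omega> \<notin> Z" by (rule AE_not_in[OF Z])
  have N0: "N 0 \<omega> = 0" if "\<omega> \<in> space P" for \<omega>
    using M0[of \<omega>] that by (simp add: N_def)
  have Ncad: "cadlag_on t (\<lambda>s. N s \<omega>)" if "\<omega> \<in> space P" for \<omega>
  proof (cases "\<omega> \<in> Z")
    case True
    then have "(\<lambda>s. N s \<omega>) = (\<lambda>s. 0)" by (simp add: N_def)
    then show ?thesis by (auto simp: cadlag_on_def)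
  next
    case False
    then show ?thesis
      using cadlag_on_diff[OF cad(2,1)[OF that]] by (simp add: N_def)
  qed
  have Njump: "jump (\<lambda>s. N s \<omega>) s = 0" if \<omega>: "\<omega> \<in> space P" and s: "s \<in> {0<..t}" for \<omega> s
  proof (cases "\<omega> \<in> Z")
    case True
    then have "(\<lambda>s. N s \<omega>) = (\<lambda>s. 0)" by (simp add: N_def)
    moreover have "jump (\<lambda>s. 0) s = 0 - 0"
      using s by (intro jump_eqI) auto
    ultimately show ?thesis by simp
  next
    case False
    then have "jump (\<lambda>s. N s \<omega>) s = jump (\<lambda>s. M s \<omega>) s - jump (\<lambda>s. M' s \<omega>) s"
      using jump_diff[OF cad(2,1)[OF \<omega>] s] by (simp add: N_def)
    also have "\<dots> = jump (\<lambda>s. \<Gamma>' s \<omega>) s - jump (\<lambda>s. \<Gamma> s \<omega>) s"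
      using eq[of \<omega>] False \<omega> s by (intro jump_diff_eq[OF cad[OF \<omega>]]) auto
    also have "\<dots> = 0" using jeq[of \<omega> s] False \<omega> s by simp
    finally show ?thesis .
  qed
  have Nad: "cadlag_adapted P F t N"
    unfolding cadlag_adapted_def adapted_on_def
  proof (intro conjI ballI Ncad)
    fix s assume s: "s \<in> {0..t}"
    have "Z \<in> sets (F s)"
      using Z null_sets_F sets_F_mono[of 0 s] s by auto
    moreover have "M s \<in> borel_measurable (F s)" "M' s \<in> borel_measurable (F s)"
      using lm s by (auto simp: local_martingale_on_def cadlag_adapted_def adapted_on_def)
    ultimately show "N s \<in> borel_measurable (F s)"
      unfolding N_def[abs_def] by measurable
  qed
  \<comment> \<open>The quantifier over \<open>r\<close> stands inside the almost sure statement, so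
    that a random \<open>r\<close> can be inserted later. This is possible because the limit at
    \<open>t\<close> and the continuity of \<open>N\<close> give all \<open>r\<close> on the same
    path.\<close>
  have lim: "AE \<omega> in P. \<forall>r\<in>{0..t}.
      (\<lambda>k. \<Sum>i<m (\<phi> k). (N (min (\<tau> (\<phi> k) (Suc i) \<omega>) r) \<omega> - N (min (\<tau> (\<phi> k) i \<omega>) r) \<omega>)\<^sup>2) \<longlonglongrightarrow> 0"
  proof -
    have "AE \<omega> in P. (\<lambda>u. (jump (\<lambda>s. \<Gamma> s \<omega>) u)\<^sup>2) summable_on {0<..t}"
      using C(1) by (simp add: qv_cont_part_def)
    with \<phi> C(2) C'(2) AE_Z AE_space show ?thesis
    proof eventually_elim
      fix \<omega>
      assume \<phi>: "(\<lambda>n. Max ((\<lambda>i. \<tau> (\<phi> n) (Suc i) \<omega> - \<tau> (\<phi> n) i \<omega>) ` {..<m (\<phi> n)})) \<longlonglongrightarrow> 0 \<and>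
          (\<lambda>n. \<Sum>i<m (\<phi> n). (\<Gamma> (min (\<tau> (\<phi> n) (Suc i) \<omega>) t) \<omega> - \<Gamma> (min (\<tau> (\<phi> n) i \<omega>) t) \<omega>)\<^sup>2)
            \<longlonglongrightarrow> C t \<omega> + (\<Sum>\<^sub>\<infinity>u\<in>{0<..t}. (jump (\<lambda>r. \<Gamma> r \<omega>) u)\<^sup>2) \<and>
          (\<lambda>n. \<Sum>i<m (\<phi> n). (\<Gamma>' (min (\<tau> (\<phi> n) (Suc i) \<omega>) t) \<omega> - \<Gamma>' (min (\<tau> (\<phi> n) i \<omega>) t) \<omega>)\<^sup>2)
            \<longlonglongrightarrow> C' t \<omega> + (\<Sum>\<^sub>\<infinity>u\<in>{0<..t}. (jump (\<lambda>r. \<Gamma>' r \<omega>) u)\<^sup>2)"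
        and C0: "C t \<omega> = 0" "C' t \<omega> = 0" and nZ: "\<omega> \<notin> Z" and \<omega>: "\<omega> \<in> space P"
        and summ: "(\<lambda>u. (jump (\<lambda>s. \<Gamma> s \<omega>) u)\<^sup>2) summable_on {0<..t}"
      interpret vanishing_partitions t "\<lambda>n. m (\<phi> n)" "\<lambda>n i. \<tau> (\<phi> n) i \<omega>"
        using t part[OF \<omega>] \<phi> by unfold_locales auto
      have min_t: "min (\<tau> (\<phi> n) i \<omega>) t = \<tau> (\<phi> n) i \<omega>" if "i \<le> m (\<phi> n)" for n i
        using in_range[OF that] by simp
      have drop: "(\<Sum>i<m (\<phi> n). (Y (min (\<tau> (\<phi> n) (Suc i) \<omega>) t) - Y (min (\<tau> (\<phi> n) i \<omega>) t))\<^sup>2)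
          = (\<Sum>i<m (\<phi> n). (Y (\<tau> (\<phi> n) (Suc i) \<omega>) - Y (\<tau> (\<phi> n) i \<omega>))\<^sup>2)" for n and Y :: "real \<Rightarrow> real"
        by (intro sum.cong refl) (simp add: min_t)
      have "(\<lambda>n. \<Sum>i<m (\<phi> n). ((\<Gamma>' (\<tau> (\<phi> n) (Suc i) \<omega>) \<omega> - \<Gamma> (\<tau> (\<phi> n) (Suc i) \<omega>) \<omega>)
          - (\<Gamma>' (\<tau> (\<phi> n) i \<omega>) \<omega> - \<Gamma> (\<tau> (\<phi> n) i \<omega>) \<omega>))\<^sup>2) \<longlonglongrightarrow> 0"
        using \<phi> C0 jeq[of \<omega>] \<omega> nZ summ
        by (intro square_sum_diff_tendsto_0[OF cad(3,4)[OF \<omega>]])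
          (simp_all add: drop[of "\<lambda>s. \<Gamma> s \<omega>"] drop[of "\<lambda>s. \<Gamma>' s \<omega>"])
      moreover have "(\<Gamma>' (\<tau> (\<phi> n) i \<omega>) \<omega> - \<Gamma> (\<tau> (\<phi> n) i \<omega>) \<omega>) = N (\<tau> (\<phi> n) i \<omega>) \<omega>"
        if "i \<le> m (\<phi> n)" for n i
        using eq[of \<omega> "\<tau> (\<phi> n) i \<omega>"] in_range[OF that] \<omega> nZ by (simp add: N_def)
      ultimately have "(\<lambda>n. \<Sum>i<m (\<phi> n). (N (\<tau> (\<phi> n) (Suc i) \<omega>) \<omega> - N (\<tau> (\<phi> n) i \<omega>) \<omega>)\<^sup>2) \<longlonglongrightarrow> 0"
        by simp
      then show "\<forall>r\<in>{0..t}.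
          (\<lambda>k. \<Sum>i<m (\<phi> k). (N (min (\<tau> (\<phi> k) (Suc i) \<omega>) r) \<omega> - N (min (\<tau> (\<phi> k) i \<omega>) r) \<omega>)\<^sup>2) \<longlonglongrightarrow> 0"
        by (intro ballI stopped_square_sum_tendsto_0[OF Ncad[OF \<omega>] Njump[OF \<omega>]])
    qed
  qed
  obtain R :: "nat \<Rightarrow> 'a \<Rightarrow> real" where R: "\<And>n. nonneg_stopping_time P F (R n)"
      "\<And>\<omega>. \<omega> \<in> space P \<Longrightarrow> incseq (\<lambda>n. R n \<omega>)" "AE \<omega> in P. \<exists>n. t \<le> R n \<omega>"
      "\<And>n. martingale_on P F t (\<lambda>s \<omega>. M (min s (R n \<omega>)) \<omega> - M 0 \<omega>)"
    and Mc: "cadlag_adapted P F t M"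
    using lm(1) unfolding local_martingale_on_def by blast
  obtain R' :: "nat \<Rightarrow> 'a \<Rightarrow> real" where R': "\<And>n. nonneg_stopping_time P F (R' n)"
      "\<And>\<omega>. \<omega> \<in> space P \<Longrightarrow> incseq (\<lambda>n. R' n \<omega>)" "AE \<omega> in P. \<exists>n. t \<le> R' n \<omega>"
      "\<And>n. martingale_on P F t (\<lambda>s \<omega>. M' (min s (R' n \<omega>)) \<omega> - M' 0 \<omega>)"
    and Mc': "cadlag_adapted P F t M'"
    using lm(2) unfolding local_martingale_on_def by blast
  have path: "bounded_start_path t (real K) (\<lambda>s. N s \<omega>)" if "\<omega> \<in> space P" for K \<omega>
    using Ncad[OF that] Njump[OF that] N0[OF that] t by unfold_locales auto
  define T where "T K \<omega> = exit_time t (real K) (\<lambda>s. N s \<omega>)" for K \<omega>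
  \<comment> \<open>\<open>R n\<close> and \<open>R' n\<close> turn the two parts into martingales,
    \<open>T K\<close> bounds their difference, and the deterministic \<open>s\<close> yields the
    value at \<open>s\<close> once the other times have passed it.\<close>
  define r where "r s n K \<omega> = min s (min (min (R n \<omega>) (R' n \<omega>)) (T K \<omega>))" for s n K \<omega>
  have zero: "AE \<omega> in P. N (r s n K \<omega>) \<omega> = 0" if s: "s \<in> {0..t}" for s n K
  proof (rule zero_quadratic_variation_stopped_zero[where K="real K" and N=N and r="r s n K" and m="\<lambda>k. m (\<phi> k)" and \<tau>="\<lambda>k. \<tau> (\<phi> k)" and t=t])
    have "nonneg_stopping_time P F (T K)"
      unfolding T_def[abs_def] using Nad path t by (intro exit_time_stopping_time) (auto simp: cadlag_adapted_def)
    then show r: "nonneg_stopping_time P F (r s n K)"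
      using R(1)[of n] R'(1)[of n] s unfolding r_def[abs_def] nonneg_stopping_time_def
      by (auto intro!: stopping_time_min stopping_time_const)
    show rt: "r s n K \<omega> \<le> t" for \<omega> using s by (auto simp: r_def min.coboundedI1)
    show "\<bar>N u \<omega>\<bar> \<le> real K" if "\<omega> \<in> space P" "u \<in> {0..r s n K \<omega>}" for \<omega> u
      using that by (intro bounded_start_path.bounded_at_exit_time[OF path]) (auto simp: r_def T_def)
    fix S T' A assume S: "nonneg_stopping_time P F S" and T': "nonneg_stopping_time P F T'"
      and ST: "\<And>\<omega>. \<omega> \<in> space P \<Longrightarrow> S \<omega> \<le> T' \<omega>" and Tr: "\<And>\<omega>. \<omega> \<in> space P \<Longrightarrow> T' \<omega> \<le> r s n K \<omega>"
      and A: "A \<in> sets (pre_sigma S)"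
    have stop: "stopping_time F S" "stopping_time F T'"
      using S T' by (auto simp: nonneg_stopping_time_def)
    \<comment> \<open>The right-hand side is the same for every admissible \<open>V\<close>, so the
      integrals at \<open>S\<close> and \<open>T'\<close> agree. \<open>M\<close> and
      \<open>M'\<close> are sampled separately because each has its own localizing sequence.\<close>
    have const: "(\<integral>\<omega>\<in>A. N (V \<omega>) \<omega> \<partial>P)
        = (\<integral>\<omega>\<in>A. M (min t (R n \<omega>)) \<omega> - M 0 \<omega> \<partial>P) - (\<integral>\<omega>\<in>A. M' (min t (R' n \<omega>)) \<omega> - M' 0 \<omega> \<partial>P)"
      if V: "nonneg_stopping_time P F V" "\<And>\<omega>. \<omega> \<in> space P \<Longrightarrow> V \<omega> \<le> r s n K \<omega>" "A \<in> sets (pre_sigma V)" for V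
    proof -
      have Vt: "V \<omega> \<le> t" "V \<omega> \<le> R n \<omega>" "V \<omega> \<le> R' n \<omega>" if "\<omega> \<in> space P" for \<omega>
        using V(2)[OF that] s by (auto simp: r_def)
      have t0: "0 \<le> t" using t by simp
      have AP: "A \<in> sets P"
        using V subalgebra_pre_sigma[of V] by (auto simp: subalgebra_def nonneg_stopping_time_def)
      have int: "integrable P (\<lambda>\<omega>. M (V \<omega>) \<omega> - M 0 \<omega>)" "integrable P (\<lambda>\<omega>. M' (V \<omega>) \<omega> - M' 0 \<omega>)"
        by (rule localized_optional_sampling(1)[OF Mc R(1) R(4) V(1) Vt(1,2) t0] localized_optional_sampling(1)[OF Mc' R'(1) R'(4) V(1) Vt(1,3) t0]; assumption)+
      have mV: "(\<lambda>\<omega>. N (V \<omega>) \<omega>) \<in> borel_measurable P"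
        using V by (intro measurable_from_subalg[OF subalgebra_pre_sigma stopped_measurable_pre_sigma[OF Nad V(1) Vt(1) t0]])
          (auto simp: nonneg_stopping_time_def)
      have "(\<integral>\<omega>\<in>A. N (V \<omega>) \<omega> \<partial>P) = (\<integral>\<omega>\<in>A. (M (V \<omega>) \<omega> - M 0 \<omega>) - (M' (V \<omega>) \<omega> - M' 0 \<omega>) \<partial>P)"
        unfolding set_lebesgue_integral_def
      proof (rule integral_cong_AE)
        show "AE \<omega> in P. indicator A \<omega> *\<^sub>R N (V \<omega>) \<omega> = indicator A \<omega> *\<^sub>R ((M (V \<omega>) \<omega> - M 0 \<omega>) - (M' (V \<omega>) \<omega> - M' 0 \<omega>))"
          using AE_Z AE_space
        proof eventually_elim
          fix \<omega> assume "\<omega> \<notin> Z" "\<omega> \<in> space P"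
          then show "indicator A \<omega> *\<^sub>R N (V \<omega>) \<omega> = indicator A \<omega> *\<^sub>R ((M (V \<omega>) \<omega> - M 0 \<omega>) - (M' (V \<omega>) \<omega> - M' 0 \<omega>))"
            using M0[of \<omega>] by (simp add: N_def)
        qed
      qed (use AP mV int in auto)
      also have "\<dots> = (\<integral>\<omega>\<in>A. M (V \<omega>) \<omega> - M 0 \<omega> \<partial>P) - (\<integral>\<omega>\<in>A. M' (V \<omega>) \<omega> - M' 0 \<omega> \<partial>P)"
        by (intro set_integral_diff integrable_imp_set_integrable int AP)
      also have "(\<integral>\<omega>\<in>A. M (V \<omega>) \<omega> - M 0 \<omega> \<partial>P) = (\<integral>\<omega>\<in>A. M (min t (R n \<omega>)) \<omega> - M 0 \<omega> \<partial>P)"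
        by (rule localized_optional_sampling(2)[OF Mc R(1) R(4) V(1) Vt(1,2) t0 V(3)])
      also have "(\<integral>\<omega>\<in>A. M' (V \<omega>) \<omega> - M' 0 \<omega> \<partial>P) = (\<integral>\<omega>\<in>A. M' (min t (R' n \<omega>)) \<omega> - M' 0 \<omega> \<partial>P)"
        by (rule localized_optional_sampling(2)[OF Mc' R'(1) R'(4) V(1) Vt(1,3) t0 V(3)])
      finally show ?thesis .
    qed
    have "A \<in> sets (pre_sigma T')"
      using mono_pre_sigma[OF stop ST] A by blast
    then show "(\<integral>\<omega>\<in>A. N (T' \<omega>) \<omega> \<partial>P) = (\<integral>\<omega>\<in>A. N (S \<omega>) \<omega> \<partial>P)"
      using const[OF T' Tr] const[OF S order_trans[OF ST Tr] A] by simp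
  next
    have r_range: "r s n K \<omega> \<in> {0..t}" if "\<omega> \<in> space P" for \<omega>
      using R(1)[of n] R'(1)[of n] s that bounded_start_path.exit_time_range(1)[OF path[OF that], of K]
      by (auto simp: r_def T_def nonneg_stopping_time_def min.coboundedI1)
    show "AE \<omega> in P. (\<lambda>k. \<Sum>i<m (\<phi> k). (N (min (\<tau> (\<phi> k) (Suc i) \<omega>) (r s n K \<omega>)) \<omega>
        - N (min (\<tau> (\<phi> k) i \<omega>) (r s n K \<omega>)) \<omega>)\<^sup>2) \<longlonglongrightarrow> 0"
      using lim AE_space by eventually_elim (use r_range in blast)
  qed (use Nad N0 t \<tau> part in auto)
  \<comment> \<open>Countably many \<open>s\<close>, \<open>n\<close> and \<open>K\<close> leave a
    single null set. The time \<open>t\<close> is added because it may be irrational and nothing to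
    its right is available.\<close>
  have "AE \<omega> in P. \<forall>s\<in>insert t (\<rat> \<inter> {0..t}). \<forall>n K. N (r s n K \<omega>) \<omega> = 0"
    using zero t by (subst AE_ball_countable) (auto simp: countable_rat AE_all_countable)
  with R(3) R'(3) AE_Z AE_space show ?thesis
  proof eventually_elim
    fix \<omega> assume ex: "\<exists>n. t \<le> R n \<omega>" "\<exists>n. t \<le> R' n \<omega>" and nZ: "\<omega> \<notin> Z" and \<omega>: "\<omega> \<in> space P"
      and Nr: "\<forall>s\<in>insert t (\<rat> \<inter> {0..t}). \<forall>n K. N (r s n K \<omega>) \<omega> = 0"
    have cont: "continuous_on {0..t} (\<lambda>s. N s \<omega>)"
      by (rule cadlag_on_continuous[OF Ncad[OF \<omega>] Njump[OF \<omega>] t])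
    then have "bounded ((\<lambda>s. N s \<omega>) ` {0..t})"
      by (intro compact_imp_bounded compact_continuous_image) auto
    then obtain B where B: "\<forall>s\<in>{0..t}. \<bar>N s \<omega>\<bar> \<le> B"
      unfolding bounded_iff ball_simps real_norm_def by blast
    \<comment> \<open>The level depends on the path, which is why \<open>K\<close> is quantified
      inside the almost sure statement.\<close>
    obtain K where "B \<le> real K" using real_arch_simple by blast
    then have "\<forall>s\<in>{0..t}. \<bar>N s \<omega>\<bar> \<le> real K" using B order_trans by blast
    then have TK: "t \<le> T K \<omega>"
      using bounded_start_path.le_exit_time_iff[OF path[OF \<omega>], of t K] t by (simp add: T_def)
    obtain n n' where "t \<le> R n \<omega>" "t \<le> R' n' \<omega>" using ex by blast
    moreover have "R n \<omega> \<le> R (max n n') \<omega>" "R' n' \<omega> \<le> R' (max n n') \<omega>"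
      using incseqD[OF R(2)[OF \<omega>]] incseqD[OF R'(2)[OF \<omega>]] by auto
    ultimately have Rt: "t \<le> R (max n n') \<omega>" "t \<le> R' (max n n') \<omega>" by auto
    have rat: "N q \<omega> = 0" if "q \<in> insert t (\<rat> \<inter> {0..t})" for q
    proof -
      have "r q (max n n') K \<omega> = q"
        using that Rt TK t by (auto simp: r_def min_absorb1)
      then show ?thesis using Nr that by metis
    qed
    \<comment> \<open>At level 0 the rational criterion for boundedness says that a path vanishing
      at \<open>t\<close> and at all rational times vanishes on [0, t].\<close>
    have "bounded_start_path t 0 (\<lambda>s. N s \<omega>)"
      using Ncad[OF \<omega>] Njump[OF \<omega>] N0[OF \<omega>] t by unfold_locales auto
    then have "(\<forall>s\<in>{0..t}. \<bar>N s \<omega>\<bar> \<le> 0) \<longleftrightarrow> (\<forall>s\<in>insert t (\<rat> \<inter> {0..t}). \<bar>N s \<omega>\<bar> \<le> 0)"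
      by (rule bounded_start_path.bounded_iff_rational) (use t in simp)
    then show "\<forall>s\<in>{0..t}. M s \<omega> = M' s \<omega>"
      using rat nZ by (simp add: N_def)
  qed
qed

end

theorem lemma3p2:
  fixes P :: "'a measure" and F :: "real \<Rightarrow> 'a measure" and t :: real
    and m :: "nat \<Rightarrow> nat" and \<tau> :: "nat \<Rightarrow> nat \<Rightarrow> 'a \<Rightarrow> real"
    and X M \<Gamma> M' \<Gamma>' :: "real \<Rightarrow> 'a \<Rightarrow> real"
  assumes "usual_filtered_prob_space P F"
    and "0 < t"
    and "refining_sequence P F t m \<tau>"
    and "special_dirichlet P F t m \<tau> X"
    and "special_dirichlet_decomposition P F t m \<tau> X M \<Gamma>"
    and "special_dirichlet_decomposition P F t m \<tau> X M' \<Gamma>'"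
  shows "AE \<omega> in P. \<forall>s\<in>{0..t}. M s \<omega> = M' s \<omega>"
  using usual_filtered_prob_space.special_dirichlet_martingale_part_unique[OF assms(1,2,5,6)] .

end
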